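(* Let $W$ be a Brownian motion on a probability space $(\Omega,\mathcal{F},\mathbb{P})$, and let $X$ be the strong solution of $dX_t=b(X_t)dt+\sigma(X_t)dW_t$, $X_0=\xi\in\mathbb{R}$, where $\inf\sigma(K)>0$ for every compact $K\subset\mathbb{R}$, $\sigma$ is Lipschitz continuous, and $b$ is bounded and Borel measurable. Let $p$ be a formula such that $X(\omega),t\models p\Leftrightarrow X_t(\omega)\in B_p$ and $X(\omega),t\models_n p\Leftrightarrow X_t(\omega)\in B_p$, where $B_p=\bigcup_{i=1}^k\langle x_i,y_i\rangle$ is a union of a pairwise separated family of positive intervals on $\mathbb{R}$ ($B_p$ may be $\emptyset$ or $\mathbb{R}$). Let $\langle S,T\rangle$ be a positive interval on $[0,\infty)$, $\phi:=\Diamond_{\langle S,T\rangle}p$ and $\psi:=\Box_{\langle S,T\rangle}p$. Then for every $t\in[0,\infty)$, almost surely $\chi^{(n)}_\phi(\omega,t)\to\chi_\phi(\omega,t)$ and $\chi^{(n)}_\psi(\omega,t)\to\chi_\psi(\omega,t)$ as $n\to\infty$. In particular $\mathbb{P}(\omega : X(\omega),\Lambda_n(t)\models_n\phi)\to\mathbb{P}(\omega : X(\omega),t\models\phi)$ and $\mathbb{P}(\omega : X(\omega),\Lambda_n(t)\models_n\psi)\to\mathbb{P}(\omega : X(\omega),t\models\psi)$.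
   Context: A positive interval on $\mathbb{R}$ is $\langle x,y\rangle$ with $x<y$, endpoints open or closed; a positive interval on $[0,\infty)$ is $\langle S,T\rangle$ with $0\leq S<T\leq\infty$. Borel sets $B_1,\dots,B_k$ are pairwise separated if $\overline{B_i}\cap\overline{B_j}=\emptyset$ for $i\neq j$. Semantics: $X(\omega),t\models\Diamond_I p$ iff $\exists s\in I$ with $X(\omega),t+s\models p$; $X(\omega),t\models\Box_I p$ iff $\forall s\in I$, $X(\omega),t+s\models p$. Discrete semantics at $t\in\mathbb{N}/n:=\{k/n:k\in\mathbb{N}\}$: the same with $s\in I\cap\mathbb{N}/n$ and $\models_n$. $\Lambda_n(t):=\lfloor nt\rfloor/n$; $\chi_\phi(\omega,t)$ is $1$ if $X(\omega),t\models\phi$ and $0$ otherwise; $\chi^{(n)}_\phi(\omega,t)$ is $1$ if $X(\omega),\Lambda_n(t)\models_n\phi$ and $0$ otherwise. *)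

theory Defs
  imports "HOL-Probability.Probability"
begin

text \<open>Interval with (possibly infinite) endpoints x, y; cx / cy say whether the
  left / right endpoint is included (irrelevant for infinite endpoints).\<close>
definition ivl :: "ereal \<Rightarrow> ereal \<Rightarrow> bool \<Rightarrow> bool \<Rightarrow> real set" where
  "ivl x y cx cy = {s. (if cx then x \<le> ereal s else x < ereal s) \<and>
                       (if cy then ereal s \<le> y else ereal s < y)}"

text \<open>Continuous-time semantics of the eventually / always operators applied to an
  atomic formula p with X(omega),u |= p iff pth u in B.\<close>
definition sat_dia :: "(real \<Rightarrow> real) \<Rightarrow> real set \<Rightarrow> real set \<Rightarrow> real \<Rightarrow> bool" where
  "sat_dia pth B I t \<longleftrightarrow> (\<exists>s\<in>I. pth (t + s) \<in> B)"

definition sat_box :: "(real \<Rightarrow> real) \<Rightarrow> real set \<Rightarrow> real set \<Rightarrow> real \<Rightarrow> bool" where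
  "sat_box pth B I t \<longleftrightarrow> (\<forall>s\<in>I. pth (t + s) \<in> B)"

definition grid :: "nat \<Rightarrow> real set" where
  "grid n = {real k / real n | k::nat. True}"

definition sat_dia_n :: "(real \<Rightarrow> real) \<Rightarrow> real set \<Rightarrow> real set \<Rightarrow> nat \<Rightarrow> real \<Rightarrow> bool" where
  "sat_dia_n pth B I n t \<longleftrightarrow> (\<exists>s\<in>I \<inter> grid n. pth (t + s) \<in> B)"

definition sat_box_n :: "(real \<Rightarrow> real) \<Rightarrow> real set \<Rightarrow> real set \<Rightarrow> nat \<Rightarrow> real \<Rightarrow> bool" where
  "sat_box_n pth B I n t \<longleftrightarrow> (\<forall>s\<in>I \<inter> grid n. pth (t + s) \<in> B)"

definition Lambda :: "nat \<Rightarrow> real \<Rightarrow> real" where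
  "Lambda n t = real_of_int \<lfloor>real n * t\<rfloor> / real n"

definition brownian_motion :: "'a measure \<Rightarrow> (real \<Rightarrow> 'a \<Rightarrow> real) \<Rightarrow> bool" where
  "brownian_motion M W \<longleftrightarrow>
     (\<forall>t\<ge>0. W t \<in> borel_measurable M) \<and>
     (AE \<omega> in M. W 0 \<omega> = 0) \<and>
     (\<forall>\<omega>\<in>space M. continuous_on {0..} (\<lambda>t. W t \<omega>)) \<and>
     (\<forall>s t. 0 \<le> s \<and> s < t \<longrightarrow>
        distributed M lborel (\<lambda>\<omega>. W t \<omega> - W s \<omega>) (\<lambda>x. ennreal (normal_density 0 (sqrt (t - s)) x))) \<and>
     (\<forall>(n::nat) (ts::nat \<Rightarrow> real). 0 \<le> ts 0 \<and> (\<forall>i<n. ts i < ts (Suc i)) \<longrightarrow>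
        prob_space.indep_vars M (\<lambda>_. borel) (\<lambda>i \<omega>. W (ts (Suc i)) \<omega> - W (ts i) \<omega>) {..<n})"

definition nat_filt :: "'a measure \<Rightarrow> (real \<Rightarrow> 'a \<Rightarrow> real) \<Rightarrow> real \<Rightarrow> 'a set set" where
  "nat_filt M W t = sigma_sets (space M)
     ({W s -` A \<inter> space M | s A. 0 \<le> s \<and> s \<le> t \<and> A \<in> sets borel} \<union> null_sets M)"

text \<open>Left-point Riemann sums along the dyadic partition of [0,t]; for continuous
  adapted integrands they converge in probability to the Ito integral.\<close>
definition ito_sum :: "(real \<Rightarrow> real) \<Rightarrow> (real \<Rightarrow> 'a \<Rightarrow> real) \<Rightarrow> (real \<Rightarrow> 'a \<Rightarrow> real)
      \<Rightarrow> real \<Rightarrow> nat \<Rightarrow> 'a \<Rightarrow> real" where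
  "ito_sum \<sigma> W X t m \<omega> = (\<Sum>k<2^m. \<sigma> (X (t * real k / 2^m) \<omega>) *
       (W (t * real (Suc k) / 2^m) \<omega> - W (t * real k / 2^m) \<omega>))"

text \<open>Strong solution of dX = b(X)dt + sigma(X)dW, X_0 = xi: continuous, adapted to the
  augmented filtration of W, and X_t = xi + int_0^t b(X_s) ds + int_0^t sigma(X_s) dW_s a.s.\<close>
definition strong_solution :: "'a measure \<Rightarrow> (real \<Rightarrow> 'a \<Rightarrow> real) \<Rightarrow> (real \<Rightarrow> real)
      \<Rightarrow> (real \<Rightarrow> real) \<Rightarrow> real \<Rightarrow> (real \<Rightarrow> 'a \<Rightarrow> real) \<Rightarrow> bool" where
  "strong_solution M W b \<sigma> \<xi> X \<longleftrightarrow>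
     (\<forall>t\<ge>0. X t \<in> borel_measurable M) \<and>
     (\<forall>t\<ge>0. \<forall>A\<in>sets borel. X t -` A \<inter> space M \<in> nat_filt M W t) \<and>
     (\<forall>\<omega>\<in>space M. continuous_on {0..} (\<lambda>t. X t \<omega>)) \<and>
     (AE \<omega> in M. X 0 \<omega> = \<xi>) \<and>
     (\<forall>t\<ge>0. \<forall>\<epsilon>>0. (\<lambda>m. measure M {\<omega>\<in>space M.
         \<bar>ito_sum \<sigma> W X t m \<omega> - (X t \<omega> - \<xi> - (LINT s:{0..t}|lborel. b (X s \<omega>)))\<bar> > \<epsilon>})
       \<longlonglongrightarrow> 0)"

end

theory Submission
  imports Defs
begin

text \<open>
  Along a path on which no endpoint $c$ of $B$ is an extremal value over a time interval with
  endpoints in a countable dense set containing $t + S$ and $t + T$, a visit to the closure of $B$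
  forces a visit to its interior at an interior time, and the latter is seen by every fine enough
  grid; the box operator is the dual of the diamond. It remains to show that a.s. $X$ does not
  reach $c$ on $[p, q]$ while staying on one side of $c$.

  Let $Z$ be the residual $X_r - X_s - \int_s^r b(X)\,du - \sigma(X_s)(W_r - W_s)$. It is a limit in
  probability of sums $\sum g_i \Delta W_i$ with small adapted $g_i$. Truncating the $g_i$ and
  applying the discrete It\^o isometry bounds $P(E, |Z| > \epsilon)$ by $P(E)$ times a small
  constant, for events $E$ of the past of $s$, up to the probability that the path oscillates a lot.
  No moment bounds on $X$ are needed. So over short times $X$ moves like $\sigma(X_s) \Delta W$: it
  has no atoms, and just after it first reaches $c$ it exceeds $c$ with conditional probability
  bounded below. If $G$ is the event that $X$ reaches $c$ and stays below $c$ for some positive time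
  afterwards, this gives $P(G) \le q P(G)$ with $q < 1$.
\<close>

section \<open>Sets hit by a continuous path\<close>

text \<open>Stopping at the hitting time of c would call for a strong Markov property, whereas
  independence of the past is established at deterministic times only. The hitting time is therefore
  rounded up to a grid of mesh 2^-j, and X is inspected a time H = 2^-l later. Two meshes are
  needed: at the grid time X has to be close to c compared with sqrt H, the size of the Brownian
  increment, so j is chosen after l, by path continuity alone.

  Continuity of \<sigma>(X) comes without a rate, so its failure is not bounded by a multiple of
  P(E) for a single event E. It is kept as P(E, oscillation); over the disjoint grid events these
  terms add up to at most one oscillation probability, which tends to 0.

  With eps = \<sigma>0 sqrt H / 4, where \<sigma>0 bounds \<sigma> from below near c, the errors are
  2 eps (residual), eps (drift) and eps (distance from c), so an increment above sqrt H carries X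
  past c. The argument looks at times after the visit; an extremum at the right end of a time
  interval is excluded by the absence of atoms.\<close>

lemma open_imp_fsigma:
  fixes U :: "real set"
  assumes "open U"
  shows "fsigma U"
proof (cases "U = UNIV")
  case False
  then have ne: "- U \<noteq> {}" by auto
  have "U = (\<Union>n::nat. {x. inverse (real (Suc n)) \<le> infdist x (- U)})"
  proof (intro equalityI subsetI)
    fix x assume "x \<in> U"
    then have "infdist x (- U) \<noteq> 0"
      using in_closed_iff_infdist_zero[of "- U" x] assms ne by auto
    then have "0 < infdist x (- U)" using infdist_nonneg[of x "- U"] by simp
    then obtain n where "inverse (real (Suc n)) < infdist x (- U)" using reals_Archimedean by blast
    then show "x \<in> (\<Union>n::nat. {x. inverse (real (Suc n)) \<le> infdist x (- U)})" by (auto intro: less_imp_le)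
  next
    fix x assume "x \<in> (\<Union>n::nat. {x. inverse (real (Suc n)) \<le> infdist x (- U)})"
    then obtain n :: nat where n: "inverse (real (Suc n)) \<le> infdist x (- U)" by auto
    have "x \<notin> - U"
    proof
      assume "x \<in> - U"
      then have "infdist x (- U) = 0" by (rule infdist_zero)
      then show False using n by simp
    qed
    then show "x \<in> U" by simp
  qed
  moreover have "closed {x. inverse (real (Suc n)) \<le> infdist x (- U)}" for n
    by (intro closed_Collect_le continuous_intros)
  ultimately show ?thesis by (metis (no_types, lifting) fsigma.intros)
qed simp

lemma fsigma_Un:
  assumes "fsigma S" "fsigma T"
  shows "fsigma (S \<union> T)"
proof -
  obtain F G :: "nat \<Rightarrow> 'a set" where "\<And>n. closed (F n)" "S = (\<Union>n. F n)" "\<And>n. closed (G n)" "T = (\<Union>n. G n)"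
    using assms by (auto elim!: fsigma.cases)
  moreover from this have "fsigma (\<Union>n. F n \<union> G n)" by (intro fsigma.intros closed_Un)
  ultimately show ?thesis by (simp add: UN_Un_distrib)
qed

lemma closed_imp_fsigma: "closed S \<Longrightarrow> fsigma S"
  using fsigma.intros[of "\<lambda>_. S"] by simp

text \<open>Half-open time windows, \<open>B\<close> and its complement each consist of an open set
  and finitely many boundary points, so this one criterion covers them all.\<close>

lemma fsigma_finite_frontier:
  fixes S :: "real set"
  assumes "finite (frontier S)"
  shows "fsigma S"
proof -
  have "S = interior S \<union> (S \<inter> frontier S)"
    using interior_subset[of S] closure_subset[of S] by (auto simp: frontier_def)
  moreover have "fsigma (interior S \<union> (S \<inter> frontier S))"
    using assms by (intro fsigma_Un open_imp_fsigma closed_imp_fsigma finite_imp_closed) auto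
  ultimately show ?thesis by simp
qed

lemma fsigma_atLeastLessThan: "fsigma {a..<s::real}"
proof (rule fsigma_finite_frontier, rule finite_subset)
  show "frontier {a..<s} \<subseteq> {a, s}"
    by (cases "a < s") (auto simp: frontier_def)
qed simp

text \<open>The existential quantifier ranges over uncountably many times. On a compact
  \<open>C\<close> a continuous path meets the closed set \<open>D\<close> exactly if its distance
  from \<open>D\<close> becomes arbitrarily small on a countable dense subset of \<open>C\<close>,
  since a minimising sequence has a cluster point in \<open>C\<close>. \<open>N\<close> is left
  general because the sigma-algebra of the past is needed as well as \<open>M\<close>.\<close>

lemma compact_hit_sets:
  fixes Y :: "real \<Rightarrow> 'a \<Rightarrow> real"
  assumes C: "compact C" and D: "closed D"
    and Y: "\<And>v. v \<in> C \<Longrightarrow> Y v \<in> borel_measurable N"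
    and cont: "\<And>\<omega>. \<omega> \<in> space N \<Longrightarrow> continuous_on C (\<lambda>v. Y v \<omega>)"
  shows "{\<omega> \<in> space N. \<exists>v\<in>C. Y v \<omega> \<in> D} \<in> sets N"
proof (cases "D = {}")
  case False
  obtain Q where Q: "countable Q" "Q \<subseteq> C" "C \<subseteq> closure Q" by (rule separable)
  have "(\<exists>v\<in>C. Y v \<omega> \<in> D) \<longleftrightarrow> (\<forall>i::nat. \<exists>v\<in>Q. infdist (Y v \<omega>) D < inverse (real (Suc i)))"
    if \<omega>: "\<omega> \<in> space N" for \<omega>
  proof
    have fc: "continuous_on C (\<lambda>v. infdist (Y v \<omega>) D)"
      using cont[OF \<omega>] by (intro continuous_intros)
    {
      assume "\<exists>v\<in>C. Y v \<omega> \<in> D"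
      then obtain v where v: "v \<in> C" "infdist (Y v \<omega>) D = 0" by auto
      obtain q where q: "\<And>n. q n \<in> Q" "q \<longlonglongrightarrow> v"
        using subsetD[OF Q(3) v(1)] unfolding closure_sequential by blast
      have "(\<lambda>n. infdist (Y (q n) \<omega>) D) \<longlonglongrightarrow> infdist (Y v \<omega>) D"
        using subsetD[OF Q(2) q(1)] by (intro continuous_on_tendsto_compose[OF fc q(2) v(1)]) simp
      then have lim: "(\<lambda>n. infdist (Y (q n) \<omega>) D) \<longlonglongrightarrow> 0" by (simp add: v(2))
      show "\<forall>i::nat. \<exists>v\<in>Q. infdist (Y v \<omega>) D < inverse (real (Suc i))"
      proof
        fix i :: nat
        have "\<forall>\<^sub>F n in sequentially. infdist (Y (q n) \<omega>) D < inverse (real (Suc i))"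
          by (rule order_tendstoD(2)[OF lim]) simp
        then obtain n where "infdist (Y (q n) \<omega>) D < inverse (real (Suc i))"
          by (auto simp: eventually_sequentially)
        then show "\<exists>v\<in>Q. infdist (Y v \<omega>) D < inverse (real (Suc i))" using q(1) by blast
      qed
    next
      assume "\<forall>i::nat. \<exists>v\<in>Q. infdist (Y v \<omega>) D < inverse (real (Suc i))"
      then obtain q where q: "\<And>i::nat. q i \<in> Q" "\<And>i. infdist (Y (q i) \<omega>) D < inverse (real (Suc i))"
        by metis
      have qC: "q i \<in> C" for i using q(1) Q(2) by auto
      then obtain v r where v: "v \<in> C" "strict_mono r" "(q \<circ> r) \<longlonglongrightarrow> v"
        using C unfolding compact_def by metis
      have "(\<lambda>n. infdist (Y ((q \<circ> r) n) \<omega>) D) \<longlonglongrightarrow> infdist (Y v \<omega>) D"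
        using qC by (intro continuous_on_tendsto_compose[OF fc v(3,1)]) simp
      moreover have "(\<lambda>n. infdist (Y ((q \<circ> r) n) \<omega>) D) \<longlonglongrightarrow> 0"
      proof (rule real_tendsto_sandwich[where f="\<lambda>_. 0"])
        show "\<forall>\<^sub>F n in sequentially. infdist (Y ((q \<circ> r) n) \<omega>) D \<le> inverse (real (Suc (r n)))"
          using q(2) by (auto intro!: always_eventually less_imp_le)
        show "(\<lambda>n. inverse (real (Suc (r n)))) \<longlonglongrightarrow> 0"
          using LIMSEQ_subseq_LIMSEQ[OF LIMSEQ_inverse_real_of_nat v(2)] by (simp add: comp_def)
      qed (auto simp: infdist_nonneg)
      ultimately have "infdist (Y v \<omega>) D = 0" by (rule LIMSEQ_unique)
      then have "Y v \<omega> \<in> D" using in_closed_iff_infdist_zero[OF D False] by simp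
      then show "\<exists>v\<in>C. Y v \<omega> \<in> D" using v(1) by blast
    }
  qed
  then have "{\<omega> \<in> space N. \<exists>v\<in>C. Y v \<omega> \<in> D} =
      {\<omega> \<in> space N. \<forall>i::nat. \<exists>v\<in>Q. infdist (Y v \<omega>) D < inverse (real (Suc i))}"
    by blast
  also have "\<dots> \<in> sets N"
  proof (intro sets.sets_Collect_countable_All sets.sets_Collect_countable_Ex' Q(1))
    fix i :: nat and v assume "v \<in> Q"
    then have [measurable]: "Y v \<in> borel_measurable N" using Y Q(2) by auto
    have [measurable]: "(\<lambda>x. infdist x D) \<in> borel_measurable borel"
      by (intro borel_measurable_continuous_onI continuous_intros)
    show "{\<omega> \<in> space N. infdist (Y v \<omega>) D < inverse (real (Suc i))} \<in> sets N"
      by measurable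
  qed
  finally show ?thesis .
qed simp

text \<open>Existential quantifiers commute with countable unions, so compact time sets and closed
  targets extend to F-sigma ones. The half-open windows and strict inequalities in
  \<open>touch\<close> and the arbitrary interval ends in \<open>sat_dia\<close> call for this
  generality.\<close>

lemma fsigma_hit_sets:
  fixes Y :: "real \<Rightarrow> 'a \<Rightarrow> real"
  assumes C: "fsigma C" and D: "fsigma D"
    and Y: "\<And>v. v \<in> C \<Longrightarrow> Y v \<in> borel_measurable N"
    and cont: "\<And>\<omega>. \<omega> \<in> space N \<Longrightarrow> continuous_on C (\<lambda>v. Y v \<omega>)"
  shows "{\<omega> \<in> space N. \<exists>v\<in>C. Y v \<omega> \<in> D} \<in> sets N"
proof -
  obtain F :: "nat \<Rightarrow> real set" where F: "\<And>n. compact (F n)" "C = (\<Union>n. F n)"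
    using C unfolding fsigma_Union_compact by (metis mem_Collect_eq range_subsetD)
  obtain G :: "nat \<Rightarrow> real set" where G: "\<And>n. closed (G n)" "D = (\<Union>n. G n)"
    using D by (auto elim: fsigma.cases)
  have "{\<omega> \<in> space N. \<exists>v\<in>C. Y v \<omega> \<in> D} = (\<Union>i. \<Union>j. {\<omega> \<in> space N. \<exists>v\<in>F i. Y v \<omega> \<in> G j})"
    by (auto simp: F(2) G(2))
  also have "\<dots> \<in> sets N"
  proof (intro sets.countable_UN)
    have "F i \<subseteq> C" for i by (auto simp: F(2))
    then have "{\<omega> \<in> space N. \<exists>v\<in>F i. Y v \<omega> \<in> G j} \<in> sets N" for i j
      by (intro compact_hit_sets F(1) G(1) Y continuous_on_subset[OF cont]) auto
    then show "range (\<lambda>i. \<Union>j. {\<omega> \<in> space N. \<exists>v\<in>F i. Y v \<omega> \<in> G j}) \<subseteq> sets N" by auto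
  qed
  finally show ?thesis .
qed

lemma fsigma_imp_borel: "fsigma S \<Longrightarrow> S \<in> sets borel"
  by (auto elim!: fsigma.cases)

section \<open>Discretisation along a single path\<close>

text \<open>The property of \<open>B\<close> that the path argument uses: at each point of
  \<open>F\<close> membership changes from one side to the other, while membership of the point
  itself is free. The line without one point, which a path may leave by merely touching that point,
  is excluded. The property is invariant under complement, which reduces boxes to diamonds.\<close>

definition crossing_set :: "real set \<Rightarrow> real set \<Rightarrow> bool" where
  "crossing_set B F \<longleftrightarrow> finite F \<and> (\<forall>z. z \<in> F \<or> z \<in> interior B \<or> z \<in> interior (- B)) \<and>
     (\<forall>c\<in>F. \<exists>d>0. ({c - d<..<c} \<subseteq> - B \<and> {c<..<c + d} \<subseteq> B) \<or> ({c - d<..<c} \<subseteq> B \<and> {c<..<c + d} \<subseteq> - B))"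

lemma crossing_set_Compl: "crossing_set B F \<Longrightarrow> crossing_set (- B) F"
  unfolding crossing_set_def by (simp, blast)

lemma crossing_set_fsigma:
  assumes "crossing_set B F" shows "fsigma B"
proof (rule fsigma_finite_frontier, rule finite_subset)
  show "frontier B \<subseteq> F"
    using assms unfolding crossing_set_def frontier_def interior_complement by blast
qed (use assms in \<open>simp add: crossing_set_def\<close>)

definition crosses :: "(real \<Rightarrow> real) \<Rightarrow> real set \<Rightarrow> real set \<Rightarrow> bool" where
  "crosses f F D \<longleftrightarrow> (\<forall>c\<in>F. \<forall>p\<in>D. \<forall>q\<in>D. p < q \<longrightarrow>
     (\<forall>v\<in>{p..q}. f v = c \<longrightarrow> (\<exists>w\<in>{p..q}. c < f w) \<and> (\<exists>w\<in>{p..q}. f w < c)))"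

lemma Lambda_bounds:
  assumes "0 < n"
  shows "Lambda n t \<le> t" "t - 1 / real n < Lambda n t"
proof -
  have "Lambda n t \<le> real n * t / real n"
    unfolding Lambda_def by (intro divide_right_mono) auto
  then show "Lambda n t \<le> t" using assms by simp
  have "(real n * t - 1) / real n < Lambda n t"
    unfolding Lambda_def using assms by (intro divide_strict_right_mono) linarith+
  then show "t - 1 / real n < Lambda n t" using assms by (simp add: diff_divide_distrib)
qed

lemma Lambda_nonneg: "0 \<le> t \<Longrightarrow> 0 \<le> Lambda n t"
  by (simp add: Lambda_def)

lemma Lambda_tendsto: "(\<lambda>n. Lambda n t) \<longlonglongrightarrow> t"
proof (rule real_tendsto_sandwich)
  show "(\<lambda>n. t - 1 / real n) \<longlonglongrightarrow> t"
    using tendsto_diff[OF tendsto_const lim_inverse_n', of t] by simp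
  show "\<forall>\<^sub>F n in sequentially. t - 1 / real n \<le> Lambda n t"
    using eventually_gt_at_top[of 0] by eventually_elim (simp add: Lambda_bounds less_imp_le)
  show "\<forall>\<^sub>F n in sequentially. Lambda n t \<le> t"
    using eventually_gt_at_top[of 0] by eventually_elim (simp add: Lambda_bounds)
qed simp

lemma Lambda_grid: "0 \<le> t \<Longrightarrow> Lambda n t \<in> grid n"
  unfolding Lambda_def grid_def
  by (intro CollectI exI[of _ "nat \<lfloor>real n * t\<rfloor>"]) simp

text \<open>If \<open>f v\<close> is already interior, continuity lets the time be moved off the
  ends of [p, q] (\<open>move\<close>). Otherwise \<open>f v\<close> is a boundary value c. On a
  short interval around v with ends in \<open>D\<close> the path exceeds c and falls below it while
  staying within d of c, and one of these two sides belongs to \<open>B\<close>.\<close>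

lemma hit_interior:
  fixes f :: "real \<Rightarrow> real"
  assumes f: "continuous_on {0..} f" and p: "0 \<le> p" "p < q" and v: "p \<le> v" "v \<le> q" "f v \<in> closure B"
    and B: "crossing_set B F" and R: "crosses f F D" and D: "p \<in> D" "q \<in> D"
    and D_dense: "\<And>x y. 0 \<le> x \<Longrightarrow> x < y \<Longrightarrow> \<exists>d\<in>D. x < d \<and> d < y"
  shows "\<exists>u. p < u \<and> u < q \<and> f u \<in> interior B"
proof -
  have move: "\<exists>u. p < u \<and> u < q \<and> f u \<in> interior B" if w: "p \<le> w" "w \<le> q" "f w \<in> interior B" for w
  proof -
    obtain \<epsilon> where \<epsilon>: "0 < \<epsilon>" "ball (f w) \<epsilon> \<subseteq> interior B"
      using w(3) open_contains_ball[of "interior B"] by auto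
    obtain d where d: "0 < d" "\<And>x. 0 \<le> x \<Longrightarrow> dist x w < d \<Longrightarrow> dist (f x) (f w) < \<epsilon>"
      using f[unfolded continuous_on_iff, rule_format, of w \<epsilon>] w p \<epsilon>(1) by auto
    have near: "f x \<in> interior B" if "0 \<le> x" "dist x w < d" for x
      using d(2)[OF that] \<epsilon>(2) by (auto simp: dist_commute)
    show ?thesis
    proof (cases "w < q")
      case True
      then obtain u where "w < u" "u < min q (w + d)" using d(1) dense[of w "min q (w + d)"] by auto
      then show ?thesis using w p near[of u] by (intro exI[of _ u]) (auto simp: dist_real_def)
    next
      case False
      then have "max p (w - d) < w" using w p d(1) by auto
      then obtain u where "max p (w - d) < u" "u < w" using dense[of "max p (w - d)" w] by blast
      then show ?thesis using w p near[of u] by (intro exI[of _ u]) (auto simp: dist_real_def)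
    qed
  qed
  show ?thesis
  proof (cases "f v \<in> interior B")
    case True
    then show ?thesis using move v by blast
  next
    case False
    define c where "c = f v"
    have "f v \<notin> interior (- B)" using v(3) by (simp add: interior_complement)
    then have cF: "c \<in> F" using False B unfolding crossing_set_def c_def by blast
    then obtain d where d: "0 < d" "({c - d<..<c} \<subseteq> - B \<and> {c<..<c + d} \<subseteq> B) \<or> ({c - d<..<c} \<subseteq> B \<and> {c<..<c + d} \<subseteq> - B)"
      using B unfolding crossing_set_def by blast
    obtain \<delta> where \<delta>: "0 < \<delta>" "\<And>x. 0 \<le> x \<Longrightarrow> dist x v < \<delta> \<Longrightarrow> dist (f x) c < d"
      using f[unfolded continuous_on_iff, rule_format, of v d] v p d(1) unfolding c_def by auto
    \<comment> \<open>If v is an end of [p, q], that end itself is used, since no time beyond it is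
      allowed. Strictness in the other case ensures p' < q' wherever v lies.\<close>
    have "\<exists>p'\<in>D. p \<le> p' \<and> p' \<le> v \<and> v - \<delta> < p' \<and> (p < v \<longrightarrow> p' < v)"
    proof (cases "p < v")
      case True
      then have "0 \<le> max p (v - \<delta>)" "max p (v - \<delta>) < v" using \<delta>(1) p by auto
      from D_dense[OF this] obtain p' where "p' \<in> D" "max p (v - \<delta>) < p'" "p' < v" by blast
      then show ?thesis by (intro bexI[of _ p']) auto
    next
      case False
      then show ?thesis using D v \<delta> by (intro bexI[of _ p]) auto
    qed
    then obtain p' where p': "p' \<in> D" "p \<le> p'" "p' \<le> v" "v - \<delta> < p'" "p < v \<Longrightarrow> p' < v" by blast
    have "\<exists>q'\<in>D. v \<le> q' \<and> q' \<le> q \<and> q' < v + \<delta> \<and> (v < q \<longrightarrow> v < q')"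
    proof (cases "v < q")
      case True
      then have "0 \<le> v" "v < min q (v + \<delta>)" using \<delta>(1) p v by auto
      from D_dense[OF this] obtain q' where "q' \<in> D" "v < q'" "q' < min q (v + \<delta>)" by blast
      then show ?thesis by (intro bexI[of _ q']) auto
    next
      case False
      then show ?thesis using D v \<delta> by (intro bexI[of _ q]) auto
    qed
    then obtain q' where q': "q' \<in> D" "v \<le> q'" "q' \<le> q" "q' < v + \<delta>" "v < q \<Longrightarrow> v < q'" by blast
    have "p' < q'" using p p' q' v by (cases "p < v") auto
    then have "(\<exists>w\<in>{p'..q'}. c < f w) \<and> (\<exists>w\<in>{p'..q'}. f w < c)"
      using R cF p' q' unfolding crosses_def c_def by force
    then obtain w1 w2 where w: "w1 \<in> {p'..q'}" "c < f w1" "w2 \<in> {p'..q'}" "f w2 < c" by blast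
    have near: "\<bar>f w - c\<bar> < d" if "w \<in> {p'..q'}" for w
      using \<delta>(2)[of w] that p' q' p by (auto simp: dist_real_def)
    have "f w1 \<in> interior B \<or> f w2 \<in> interior B"
      using d(2)
    proof
      assume "{c - d<..<c} \<subseteq> - B \<and> {c<..<c + d} \<subseteq> B"
      then have "{c<..<c + d} \<subseteq> interior B" by (intro interior_maximal) auto
      moreover have "f w1 \<in> {c<..<c + d}" using near[OF w(1)] w(2) by auto
      ultimately show ?thesis by blast
    next
      assume "{c - d<..<c} \<subseteq> B \<and> {c<..<c + d} \<subseteq> - B"
      then have "{c - d<..<c} \<subseteq> interior B" by (intro interior_maximal) auto
      moreover have "f w2 \<in> {c - d<..<c}" using near[OF w(3)] w(4) by auto
      ultimately show ?thesis by blast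
    qed
    then show ?thesis using move[of w1] move[of w2] w p' q' by auto
  qed
qed

text \<open>The witness rounds t and the offset u - t separately. \<open>Lambda n (u - t)\<close> is
  a grid point that for large n lies strictly between S and T, whatever the type of the window ends,
  and \<open>Lambda n t + Lambda n (u - t)\<close> tends to u, so the path at this time enters the
  open set \<open>interior B\<close>.\<close>

lemma eventually_sat_dia_n:
  assumes f: "continuous_on {0..} f" and t: "0 \<le> t" "0 \<le> S"
    and u: "t + S < u" "ereal (u - t) < T" "f u \<in> interior B"
  shows "\<forall>\<^sub>F n in sequentially. sat_dia_n f B (ivl (ereal S) T cS cT) n (Lambda n t)"
proof -
  have u0: "0 \<le> u - t" using u t by simp
  have "(\<lambda>n. Lambda n t + Lambda n (u - t)) \<longlonglongrightarrow> t + (u - t)"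
    by (intro tendsto_add Lambda_tendsto)
  then have "(\<lambda>n. f (Lambda n t + Lambda n (u - t))) \<longlonglongrightarrow> f u"
    using t u0 by (intro continuous_on_tendsto_compose[OF f]) (auto intro!: always_eventually Lambda_nonneg add_nonneg_nonneg)
  then have "\<forall>\<^sub>F n in sequentially. f (Lambda n t + Lambda n (u - t)) \<in> interior B"
    using u(3) by (intro topological_tendstoD) auto
  moreover have "\<forall>\<^sub>F n in sequentially. S < Lambda n (u - t)"
    using u by (intro order_tendstoD[OF Lambda_tendsto]) simp
  moreover have "\<forall>\<^sub>F n in sequentially. ereal (Lambda n (u - t)) < T"
    using u(2) by (intro order_tendstoD[OF tendsto_ereal[OF Lambda_tendsto]])
  ultimately show ?thesis
  proof eventually_elim
    case (elim n)
    show ?case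
      unfolding sat_dia_n_def
    proof (intro bexI[of _ "Lambda n (u - t)"] IntI)
      show "Lambda n (u - t) \<in> grid n" using u0 by (rule Lambda_grid)
      show "f (Lambda n t + Lambda n (u - t)) \<in> B" using elim(1) interior_subset by blast
      show "Lambda n (u - t) \<in> ivl (ereal S) T cS cT" using elim by (simp add: ivl_def less_imp_le)
    qed
  qed
qed

text \<open>\<open>push\<close> turns a visit to the closure of \<open>B\<close> in the closed
  window into an interior visit at an interior time, which settles the true case. In the false case
  the danger is that \<open>Lambda n t\<close> lies before t, so that the discrete window reaches
  back to times just before t + S. But then f (t + S) is off the closure of \<open>B\<close>, again
  by \<open>push\<close>, and continuity keeps f off \<open>B\<close> nearby.\<close>

lemma sat_dia_n_eventually_iff:
  fixes cS cT :: bool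
  assumes f: "continuous_on {0..} f" and t: "0 \<le> t" "0 \<le> S" and T: "ereal S < T"
    and B: "crossing_set B F" and R: "crosses f F D"
    and D: "t + S \<in> D" "\<And>r. T = ereal r \<Longrightarrow> t + r \<in> D"
    and D_dense: "\<And>x y. 0 \<le> x \<Longrightarrow> x < y \<Longrightarrow> \<exists>d\<in>D. x < d \<and> d < y"
  defines "I \<equiv> ivl (ereal S) T cS cT"
  shows "\<forall>\<^sub>F n in sequentially. sat_dia_n f B I n (Lambda n t) \<longleftrightarrow> sat_dia f B I t"
proof -
  have push: "\<exists>u. t + S < u \<and> ereal (u - t) < T \<and> f u \<in> interior B"
    if v: "t + S \<le> v" "ereal (v - t) \<le> T" "f v \<in> closure B" for v
  proof -
    \<comment> \<open>For finite T the interval ends at t + T, so that u does not leave the window.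
      For infinite T any later time in \<open>D\<close> will do.\<close>
    obtain q where q: "q \<in> D" "t + S < q" "v \<le> q" "ereal (q - t) \<le> T"
    proof (cases T)
      case (real r)
      then show ?thesis using T v D(2)[OF real] by (intro that[of "t + r"]) auto
    next
      case PInf
      obtain q where "q \<in> D" "v < q" "q < v + 1" using D_dense[of v "v + 1"] v t by auto
      then show ?thesis using v PInf by (intro that[of q]) auto
    next
      case MInf
      then show ?thesis using T by simp
    qed
    have "\<exists>u. t + S < u \<and> u < q \<and> f u \<in> interior B"
      using t v q D by (intro hit_interior[OF f _ q(2) v(1) q(3) v(3) B R D(1) q(1) D_dense]) auto
    then obtain u where u: "t + S < u" "u < q" "f u \<in> interior B" by blast
    have "ereal (u - t) < ereal (q - t)" using u by simp
    then have "ereal (u - t) < T" using q(4) by (rule less_le_trans)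
    then show ?thesis using u by blast
  qed
  show ?thesis
  proof (cases "sat_dia f B I t")
    case True
    then obtain s where s: "s \<in> I" "f (t + s) \<in> B" by (auto simp: sat_dia_def)
    have "S \<le> s" "ereal s \<le> T" using s(1) by (auto simp: I_def ivl_def split: if_splits)
    then obtain u where "t + S < u" "ereal (u - t) < T" "f u \<in> interior B"
      using push[of "t + s"] s(2) closure_subset[of B] by auto
    from eventually_sat_dia_n[OF f t this] True show ?thesis by (simp add: I_def)
  next
    case False
    have "f (t + S) \<notin> closure B"
    proof
      assume "f (t + S) \<in> closure B"
      then obtain u where u: "t + S < u" "ereal (u - t) < T" "f u \<in> interior B"
        using push[of "t + S"] less_imp_le[OF T] by auto
      then have "u - t \<in> I" "f (t + (u - t)) \<in> B"
        using interior_subset by (auto simp: I_def ivl_def less_imp_le)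
      then show False using False by (auto simp: sat_dia_def)
    qed
    then obtain \<epsilon> where \<epsilon>: "0 < \<epsilon>" "ball (f (t + S)) \<epsilon> \<inter> B = {}"
      by (metis (no_types, lifting) closure_approachable disjoint_iff dist_commute mem_ball)
    obtain \<delta> where \<delta>: "0 < \<delta>" "\<And>x. 0 \<le> x \<Longrightarrow> dist x (t + S) < \<delta> \<Longrightarrow> dist (f x) (f (t + S)) < \<epsilon>"
      using f[unfolded continuous_on_iff, rule_format, of "t + S" \<epsilon>] t \<epsilon>(1) by auto
    have "\<forall>\<^sub>F n in sequentially. t - \<delta> < Lambda n t"
      using \<delta>(1) by (intro order_tendstoD[OF Lambda_tendsto]) simp
    then have "\<forall>\<^sub>F n in sequentially. \<not> sat_dia_n f B I n (Lambda n t)"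
      using eventually_gt_at_top[of 0]
    proof eventually_elim
      case (elim n)
      show ?case
      proof
        assume "sat_dia_n f B I n (Lambda n t)"
        then obtain s where s: "s \<in> I" "f (Lambda n t + s) \<in> B" by (auto simp: sat_dia_n_def)
        define v where "v = Lambda n t + s"
        have le: "Lambda n t \<le> t" using Lambda_bounds(1)[OF elim(2)] .
        have Ss: "S \<le> s" using s(1) by (auto simp: I_def ivl_def split: if_splits)
        have "v - t \<notin> I" using False s(2) by (auto simp: sat_dia_def v_def)
        \<comment> \<open>Since v - t does not exceed s, it respects the upper end of the window.
          Being outside the window, it must fail at the lower end.\<close>
        moreover have "ereal (v - t) \<le> ereal s" using le by (simp add: v_def)
        then have "if cT then ereal (v - t) \<le> T else ereal (v - t) < T"
          using s(1) order_trans[of "ereal (v - t)" "ereal s" T] le_less_trans[of "ereal (v - t)" "ereal s" T]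
          unfolding I_def ivl_def by (cases cT) simp_all
        ultimately have "v - t \<le> S" by (auto simp: I_def ivl_def split: if_splits)
        then have "dist v (t + S) < \<delta>" using elim(1) Ss by (simp add: v_def dist_real_def abs_less_iff)
        moreover have "0 \<le> v" using Lambda_nonneg[OF t(1), of n] Ss t(2) by (simp add: v_def)
        ultimately have "dist (f v) (f (t + S)) < \<epsilon>" by (intro \<delta>(2))
        then have "f v \<in> ball (f (t + S)) \<epsilon> \<inter> B" using s(2) by (simp add: v_def dist_commute)
        then show False using \<epsilon>(2) by blast
      qed
    qed
    then show ?thesis using False by (auto elim: eventually_mono)
  qed
qed

section \<open>Finite unions of separated intervals\<close>

lemma closure_UN_finite: "finite A \<Longrightarrow> closure (\<Union>i\<in>A. f i) = (\<Union>i\<in>A. closure (f i))"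
  by (induction A rule: finite_induct) auto

lemma closure_ivl_subset: "closure (ivl x y cx cy) \<subseteq> {s. x \<le> ereal s \<and> ereal s \<le> y}"
proof (rule closure_minimal)
  show "closed {s. x \<le> ereal s \<and> ereal s \<le> y}"
    by (intro closed_Collect_conj closed_Collect_le continuous_on_const continuous_on_ereal continuous_on_id)
qed (auto simp: ivl_def split: if_splits)

text \<open>An endpoint c of one interval lies in the closure of that interval, hence by separation
  at positive distance from all the others, and positive length makes one side of c belong to it.
  Infinite endpoints contribute no point; the empty set and the whole line are covered with an empty
  set of crossing points.\<close>

lemma crossing_set_Union_ivl:
  fixes x y :: "nat \<Rightarrow> ereal"
  assumes pos: "\<And>i. i < k \<Longrightarrow> x i < y i"
    and sep: "\<And>i j. i < k \<Longrightarrow> j < k \<Longrightarrow> i \<noteq> j \<Longrightarrow>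
      closure (ivl (x i) (y i) (cx i) (cy i)) \<inter> closure (ivl (x j) (y j) (cx j) (cy j)) = {}"
  shows "crossing_set (\<Union>i<k. ivl (x i) (y i) (cx i) (cy i)) {c. \<exists>i<k. x i = ereal c \<or> y i = ereal c}"
    (is "crossing_set ?B ?F")
proof -
  let ?J = "\<lambda>i. ivl (x i) (y i) (cx i) (cy i)"
  have open_in: "{s. x i < ereal s \<and> ereal s < y i} \<subseteq> ?J i" for i
    by (auto simp: ivl_def less_imp_le)
  have "finite ?F"
  proof (rule finite_subset)
    show "?F \<subseteq> real_of_ereal ` (x ` {..<k} \<union> y ` {..<k})"
      by (force simp: image_iff)
  qed simp
  moreover have "z \<in> ?F \<or> z \<in> interior ?B \<or> z \<in> interior (- ?B)" for z
  proof (cases "z \<in> ?F")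
    case zF: False
    show ?thesis
    proof (cases "z \<in> ?B")
      case True
      then obtain i where i: "i < k" "z \<in> ?J i" by auto
      have "x i \<noteq> ereal z" "y i \<noteq> ereal z" using zF i(1) by auto
      then have z: "z \<in> {s. x i < ereal s \<and> ereal s < y i}"
        using i(2) by (auto simp: ivl_def less_le split: if_splits)
      have "open {s. x i < ereal s \<and> ereal s < y i}"
        by (intro open_Collect_conj open_Collect_less continuous_on_const continuous_on_ereal continuous_on_id)
      moreover have "{s. x i < ereal s \<and> ereal s < y i} \<subseteq> ?B" using open_in i(1) by blast
      ultimately show ?thesis using z interiorI by blast
    next
      case False
      have "z \<notin> closure (?J i)" if "i < k" for i
      proof
        assume "z \<in> closure (?J i)"
        then have "x i \<le> ereal z" "ereal z \<le> y i" using closure_ivl_subset by blast+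
        moreover have "x i \<noteq> ereal z" "y i \<noteq> ereal z" using zF that by auto
        ultimately have "z \<in> ?J i" using open_in[of i] by (auto simp: less_le)
        then show False using False that by auto
      qed
      then have "z \<notin> closure ?B" by (simp add: closure_UN_finite)
      then show ?thesis unfolding interior_complement by blast
    qed
  qed simp
  moreover have "\<exists>d>0. ({c - d<..<c} \<subseteq> - ?B \<and> {c<..<c + d} \<subseteq> ?B) \<or> ({c - d<..<c} \<subseteq> ?B \<and> {c<..<c + d} \<subseteq> - ?B)"
    if c: "c \<in> ?F" for c
  proof -
    obtain i where i: "i < k" "x i = ereal c \<or> y i = ereal c" using c by auto
    \<comment> \<open>\<open>a\<close> and \<open>b\<close> are real even if the opposite endpoint
      of the interval is infinite: one of them is c, the other is picked strictly inside by
      density.\<close>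
    obtain a b where ab: "a < b" "{a<..<b} \<subseteq> ?J i" "(c = a \<and> x i = ereal c) \<or> (c = b \<and> y i = ereal c)"
    proof (cases "x i = ereal c")
      case True
      obtain b where b: "ereal c < ereal b" "ereal b < y i"
        using ereal_dense2[of "x i" "y i"] pos[OF i(1)] True by auto
      have "{c<..<b} \<subseteq> ?J i"
      proof
        fix s assume s: "s \<in> {c<..<b}"
        then have "ereal s < ereal b" by simp
        then have "ereal s < y i" using b(2) by (rule less_trans)
        then show "s \<in> ?J i" using True s open_in[of i] by auto
      qed
      then show ?thesis using that[of c b] b True by auto
    next
      case False
      then have y: "y i = ereal c" using i by simp
      obtain a where a: "x i < ereal a" "ereal a < ereal c"
        using ereal_dense2[of "x i" "y i"] pos[OF i(1)] y by auto
      have "{a<..<c} \<subseteq> ?J i"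
      proof
        fix s assume s: "s \<in> {a<..<c}"
        then have "ereal a < ereal s" by simp
        with a(1) have "x i < ereal s" by (rule less_trans)
        then show "s \<in> ?J i" using y s open_in[of i] by auto
      qed
      then show ?thesis using that[of a c] a y by auto
    qed
    have "c \<in> closure {a<..<b}" using ab(1,3) by auto
    then have ci: "c \<in> closure (?J i)" using closure_mono[OF ab(2)] by blast
    define C where "C = closure (\<Union>j\<in>{..<k} - {i}. ?J j)"
    have "c \<notin> C" using sep[OF i(1)] ci unfolding C_def by (auto simp: closure_UN_finite)
    moreover have "open (- C)" by (simp add: C_def open_Compl)
    ultimately obtain d1 where d1: "0 < d1" "ball c d1 \<subseteq> - C"
      unfolding open_contains_ball by blast
    have other: "s \<notin> ?J j" if "\<bar>s - c\<bar> < d1" "j < k" "j \<noteq> i" for s j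
    proof
      assume "s \<in> ?J j"
      then have "s \<in> (\<Union>j\<in>{..<k} - {i}. ?J j)" using that by auto
      then have "s \<in> C" unfolding C_def by (rule subsetD[OF closure_subset])
      moreover have "s \<in> ball c d1" using that(1) by (simp add: dist_real_def abs_minus_commute)
      ultimately show False using d1(2) by blast
    qed
    define d where "d = min d1 (b - a)"
    have d: "0 < d" "d \<le> d1" "d \<le> b - a" using d1 ab by (auto simp: d_def)
    have JB: "?J i \<subseteq> ?B" using i(1) by blast
    from ab(3) show ?thesis
    proof
      assume c: "c = a \<and> x i = ereal c"
      have "{c<..<c + d} \<subseteq> {a<..<b}" using c d by auto
      then have "{c<..<c + d} \<subseteq> ?B" using ab(2) JB by (blast intro: subset_trans)
      moreover have "{c - d<..<c} \<subseteq> - ?B"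
      proof
        fix s assume s: "s \<in> {c - d<..<c}"
        have "s \<notin> ?J i" using s c by (auto simp: ivl_def)
        moreover have "\<bar>s - c\<bar> < d1" using s d by auto
        ultimately show "s \<in> - ?B" using other by auto
      qed
      ultimately show ?thesis using d(1) by blast
    next
      assume c: "c = b \<and> y i = ereal c"
      have "{c - d<..<c} \<subseteq> {a<..<b}" using c d by auto
      then have "{c - d<..<c} \<subseteq> ?B" using ab(2) JB by (blast intro: subset_trans)
      moreover have "{c<..<c + d} \<subseteq> - ?B"
      proof
        fix s assume s: "s \<in> {c<..<c + d}"
        have "s \<notin> ?J i" using s c by (auto simp: ivl_def)
        moreover have "\<bar>s - c\<bar> < d1" using s d by auto
        ultimately show "s \<in> - ?B" using other by auto
      qed
      ultimately show ?thesis using d(1) by blast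
    qed
  qed
  ultimately show ?thesis unfolding crossing_set_def by blast
qed

lemma fsigma_ivl: "x < y \<Longrightarrow> fsigma (ivl x y cx cy)"
  using crossing_set_fsigma[OF crossing_set_Union_ivl[of 1 "\<lambda>_. x" "\<lambda>_. y" "\<lambda>_. cx" "\<lambda>_. cy"]]
  by (simp add: lessThan_Suc)

lemma sat_box_iff_dia: "sat_box f B I t \<longleftrightarrow> \<not> sat_dia f (- B) I t"
  and sat_box_n_iff_dia: "sat_box_n f B I n t \<longleftrightarrow> \<not> sat_dia_n f (- B) I n t"
  by (auto simp: sat_box_def sat_dia_def sat_box_n_def sat_dia_n_def)

section \<open>Probabilistic preliminaries\<close>

lemma (in prob_space) prob_tendsto_of_eventually:
  assumes A: "\<And>n. A n \<in> events" and B: "B \<in> events"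
    and ev: "AE \<omega> in M. eventually (\<lambda>n. \<omega> \<in> A n \<longleftrightarrow> \<omega> \<in> B) sequentially"
  shows "(\<lambda>n. prob (A n)) \<longlonglongrightarrow> prob B"
proof -
  have "(\<lambda>n. expectation (indicator (A n) :: 'a \<Rightarrow> real)) \<longlonglongrightarrow> expectation (indicator B)"
  proof (rule integral_dominated_convergence[where w="\<lambda>_. 1"])
    show "AE \<omega> in M. (\<lambda>n. indicator (A n) \<omega>) \<longlonglongrightarrow> (indicator B \<omega> :: real)"
      using ev
    proof eventually_elim
      case (elim \<omega>)
      then have "eventually (\<lambda>n. indicator (A n) \<omega> = (indicator B \<omega> :: real)) sequentially"
        by eventually_elim (auto simp: indicator_def)
      then show ?case by (rule tendsto_eventually)
    qed
  qed (use A B in \<open>auto simp: indicator_def\<close>)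
  then show ?thesis using A B by simp
qed

lemma (in finite_measure) measure_Un5_le:
  assumes "A \<subseteq> B1 \<union> B2 \<union> B3 \<union> B4 \<union> B5" "B1 \<in> sets M" "B2 \<in> sets M" "B3 \<in> sets M" "B4 \<in> sets M" "B5 \<in> sets M"
  shows "measure M A \<le> measure M B1 + measure M B2 + measure M B3 + measure M B4 + measure M B5"
proof -
  have "measure M A \<le> measure M (B1 \<union> B2 \<union> B3 \<union> B4 \<union> B5)"
    using assms by (intro finite_measure_mono) auto
  also have "\<dots> \<le> measure M (B1 \<union> B2 \<union> B3 \<union> B4) + measure M B5"
    using assms by (intro measure_Un_le) auto
  also have "measure M (B1 \<union> B2 \<union> B3 \<union> B4) \<le> measure M (B1 \<union> B2 \<union> B3) + measure M B4"
    using assms by (intro measure_Un_le) auto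
  also have "measure M (B1 \<union> B2 \<union> B3) \<le> measure M (B1 \<union> B2) + measure M B3"
    using assms by (intro measure_Un_le) auto
  also have "measure M (B1 \<union> B2) \<le> measure M B1 + measure M B2"
    using assms by (intro measure_Un_le) auto
  finally show ?thesis by simp
qed

lemma (in finite_measure) sum_measure_disjoint_le:
  assumes "finite S" "disjoint_family_on A S" "\<And>k. k \<in> S \<Longrightarrow> A k \<in> sets M" "\<And>k. k \<in> S \<Longrightarrow> A k \<subseteq> B" "B \<in> sets M"
  shows "(\<Sum>k\<in>S. measure M (A k)) \<le> measure M B"
proof -
  have "(\<Sum>k\<in>S. measure M (A k)) = measure M (\<Union>k\<in>S. A k)"
    using assms by (intro finite_measure_finite_Union[symmetric]) auto
  also have "\<dots> \<le> measure M B" using assms by (intro finite_measure_mono) auto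
  finally show ?thesis .
qed

text \<open>Fubini's theorem: with \<open>V\<close> frozen at v, a bound on an event of
  \<open>D\<close> alone remains, and it is uniform in v. This replaces conditioning on
  \<open>V\<close>.\<close>

lemma (in prob_space) indep_var_prob_le:
  fixes V D :: "'a \<Rightarrow> real"
  assumes ind: "indep_var borel V borel D" and Q: "Q \<in> sets (borel \<Otimes>\<^sub>M borel)"
    and K: "\<And>v. prob {\<omega> \<in> space M. (v, D \<omega>) \<in> Q} \<le> K"
  shows "prob {\<omega> \<in> space M. (V \<omega>, D \<omega>) \<in> Q} \<le> K"
proof -
  have [measurable]: "random_variable borel V" "random_variable borel D"
    using ind by (auto simp: indep_var_eq)
  have K0: "0 \<le> K" using K[of 0] measure_nonneg order_trans by blast
  interpret DD: prob_space "distr M borel D" by (rule prob_space_distr) simp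
  interpret DV: prob_space "distr M borel V" by (rule prob_space_distr) simp
  have "emeasure M {\<omega> \<in> space M. (V \<omega>, D \<omega>) \<in> Q} = emeasure (distr M (borel \<Otimes>\<^sub>M borel) (\<lambda>\<omega>. (V \<omega>, D \<omega>))) Q"
    using Q by (subst emeasure_distr) (auto intro!: arg_cong[where f="emeasure M"])
  also have "\<dots> = emeasure (distr M borel V \<Otimes>\<^sub>M distr M borel D) Q"
    using ind by (simp add: indep_var_distribution_eq)
  also have "\<dots> = (\<integral>\<^sup>+v. emeasure (distr M borel D) (Pair v -` Q) \<partial>distr M borel V)"
    using Q by (intro DD.emeasure_pair_measure_alt) simp
  also have "\<dots> \<le> (\<integral>\<^sup>+v. ennreal K \<partial>distr M borel V)"
  proof (rule nn_integral_mono)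
    fix v
    have "emeasure (distr M borel D) (Pair v -` Q) = emeasure M {\<omega> \<in> space M. (v, D \<omega>) \<in> Q}"
      using sets_Pair1[OF Q] by (subst emeasure_distr) (auto intro!: arg_cong[where f="emeasure M"])
    also have "\<dots> \<le> ennreal K" using K by (simp add: emeasure_eq_measure ennreal_leI)
    finally show "emeasure (distr M borel D) (Pair v -` Q) \<le> ennreal K" .
  qed
  also have "\<dots> = ennreal K" using DV.emeasure_space_1 by (simp)
  finally show ?thesis using K0 by (simp add: emeasure_eq_measure)
qed

text \<open>The modulus of continuity of the path at scale \<delta> exceeds \<theta>. Times are
  restricted to \<open>U\<close>, in applications a countable set that contains all relevant grids,
  which makes the event measurable.\<close>

definition osc :: "'a measure \<Rightarrow> (real \<Rightarrow> 'a \<Rightarrow> real) \<Rightarrow> real set \<Rightarrow> real \<Rightarrow> real \<Rightarrow> 'a set" where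
  "osc M Y U \<delta> \<theta> = {\<omega> \<in> space M. \<exists>v\<in>U. \<exists>w\<in>U. \<bar>v - w\<bar> \<le> \<delta> \<and> \<theta> < \<bar>Y v \<omega> - Y w \<omega>\<bar>}"

lemma osc_sets:
  assumes U: "countable U" and Y: "\<And>v. v \<in> U \<Longrightarrow> Y v \<in> borel_measurable M"
  shows "osc M Y U \<delta> \<theta> \<in> sets M"
proof -
  have "osc M Y U \<delta> \<theta> = (\<Union>v\<in>U. \<Union>w\<in>{w\<in>U. \<bar>v - w\<bar> \<le> \<delta>}. {\<omega> \<in> space M. \<theta> < \<bar>Y v \<omega> - Y w \<omega>\<bar>})"
    by (auto simp: osc_def)
  also have "\<dots> \<in> sets M"
    using U Y by (intro sets.countable_UN'' borel_measurable_less borel_measurable_abs borel_measurable_diff) auto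
  finally show ?thesis .
qed

text \<open>Uniform continuity on [0, K] excludes the event path by path once \<delta> is small.
  Dominated convergence of indicators then gives the limit without a rate and without moments of
  \<open>Y\<close>.\<close>

lemma (in prob_space) prob_osc_tendsto_0:
  assumes U: "countable U" "U \<subseteq> {0..K}" and Y: "\<And>v. v \<in> U \<Longrightarrow> random_variable borel (Y v)"
    and cont: "\<And>\<omega>. \<omega> \<in> space M \<Longrightarrow> continuous_on {0..} (\<lambda>v. Y v \<omega>)"
    and \<theta>: "0 < \<theta>" and \<delta>: "\<delta> \<longlonglongrightarrow> 0"
  shows "(\<lambda>n. prob (osc M Y U (\<delta> n) \<theta>)) \<longlonglongrightarrow> 0"
proof -
  have "(\<lambda>n. prob (osc M Y U (\<delta> n) \<theta>)) \<longlonglongrightarrow> prob {}"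
  proof (rule prob_tendsto_of_eventually)
    show "AE \<omega> in M. eventually (\<lambda>n. \<omega> \<in> osc M Y U (\<delta> n) \<theta> \<longleftrightarrow> \<omega> \<in> {}) sequentially"
    proof (rule AE_I2)
      fix \<omega> assume "\<omega> \<in> space M"
      then have "continuous_on {0..K} (\<lambda>v. Y v \<omega>)"
        by (intro continuous_on_subset[OF cont]) auto
      then have "uniformly_continuous_on {0..K} (\<lambda>v. Y v \<omega>)"
        by (intro compact_uniformly_continuous) auto
      then obtain d where d: "d > 0" "\<And>v w. v \<in> {0..K} \<Longrightarrow> w \<in> {0..K} \<Longrightarrow> dist w v < d \<Longrightarrow> dist (Y w \<omega>) (Y v \<omega>) < \<theta>"
        using \<theta> unfolding uniformly_continuous_on_def by metis
      have "eventually (\<lambda>n. \<delta> n < d) sequentially"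
        using \<delta> d(1) by (rule order_tendstoD)
      then show "eventually (\<lambda>n. \<omega> \<in> osc M Y U (\<delta> n) \<theta> \<longleftrightarrow> \<omega> \<in> {}) sequentially"
      proof eventually_elim
        case (elim n)
        have "\<not> \<theta> < \<bar>Y v \<omega> - Y w \<omega>\<bar>" if "v \<in> U" "w \<in> U" "\<bar>v - w\<bar> \<le> \<delta> n" for v w
          using d(2)[of w v] that elim subsetD[OF U(2) that(1)] subsetD[OF U(2) that(2)]
          by (simp add: dist_real_def)
        then show ?case by (auto simp: osc_def)
      qed
    qed
  qed (use osc_sets[OF U(1) Y] in auto)
  then show ?thesis by simp
qed

text \<open>Each coarse increment telescopes into \<open>N\<close> fine ones, and
  \<open>i div N\<close> recovers the coarse cell of the fine index i. In this way a step integrand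
  is carried to a refinement of its partition.\<close>

lemma sum_div_telescope:
  fixes g w :: "nat \<Rightarrow> real"
  shows "(\<Sum>k<q. g k * (w (N * Suc k) - w (N * k))) = (\<Sum>i<N * q. g (i div N) * (w (Suc i) - w i))"
proof -
  have "g k * (w (N * Suc k) - w (N * k)) = (\<Sum>i\<in>{k * N..<k * N + N}. g (i div N) * (w (Suc i) - w i))" for k
  proof -
    have "(\<Sum>i\<in>{k * N..<k * N + N}. g (i div N) * (w (Suc i) - w i)) = (\<Sum>i\<in>{k * N..<k * N + N}. g k * (w (Suc i) - w i))"
    proof (rule sum.cong)
      fix i assume "i \<in> {k * N..<k * N + N}"
      then have "i div N = k" by (intro div_nat_eqI) (auto simp: mult.commute)
      then show "g (i div N) * (w (Suc i) - w i) = g k * (w (Suc i) - w i)" by simp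
    qed simp
    also have "\<dots> = g k * (w (k * N + N) - w (k * N))"
      by (simp add: sum_distrib_left[symmetric] sum_Suc_diff')
    finally show ?thesis by (simp add: algebra_simps)
  qed
  then show ?thesis
    using sum.nat_group[of "\<lambda>i. g (i div N) * (w (Suc i) - w i)" N q] by (simp add: mult.commute)
qed

text \<open>The dyadic partition of [0, N u] has mesh N d, and cutting each cell into N pieces gives
  mesh d whatever N is. Ito sums whose end times are different multiples of u thus become sums over
  the same increments and can be subtracted.\<close>

lemma ito_sum_grid:
  fixes N m :: nat and u :: real
  defines "d \<equiv> u / 2 ^ m"
  shows "ito_sum \<sigma> W X (real N * u) m \<omega> =
    (\<Sum>i<N * 2 ^ m. \<sigma> (X (real (N * (i div N)) * d) \<omega>) * (W (real (Suc i) * d) \<omega> - W (real i * d) \<omega>))"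
proof -
  have *: "real N * u * real k / 2 ^ m = real (N * k) * d" for k
    by (simp add: d_def field_simps)
  show ?thesis
    unfolding ito_sum_def *
    by (rule sum_div_telescope[where w="\<lambda>i. W (real i * d) \<omega>" and g="\<lambda>k. \<sigma> (X (real (N * k) * d) \<omega>)"])
qed

section \<open>Brownian increments and the discrete It\^o isometry\<close>

locale brownian = prob_space M for M :: "'a measure" +
  fixes W :: "real \<Rightarrow> 'a \<Rightarrow> real"
  assumes bm: "brownian_motion M W"
begin

lemma W_measurable [measurable]: "0 \<le> t \<Longrightarrow> W t \<in> borel_measurable M"
  using bm by (auto simp: brownian_motion_def)

lemma W_0: "AE \<omega> in M. W 0 \<omega> = 0"
  using bm by (auto simp: brownian_motion_def)

lemma W_increment_distributed:
  assumes "0 \<le> s" "s < t"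
  shows "distributed M lborel (\<lambda>\<omega>. W t \<omega> - W s \<omega>) (\<lambda>x. ennreal (normal_density 0 (sqrt (t - s)) x))"
  using bm assms by (auto simp: brownian_motion_def)

lemma W_increments_indep:
  assumes "0 \<le> ts 0" "\<And>i. i < n \<Longrightarrow> ts i < ts (Suc i)"
  shows "indep_vars (\<lambda>_. borel) (\<lambda>i \<omega>. W (ts (Suc i)) \<omega> - W (ts i) \<omega>) {..<n}"
  using bm assms unfolding brownian_motion_def by blast

text \<open>Events are taken up to null sets, so that these sets form a $\pi$-system that generates the
  augmented filtration and $W_0$ may be treated as $0$.\<close>

definition cylinders :: "real \<Rightarrow> 'a set set" where
  "cylinders s = {A \<in> events. \<exists>U D. finite U \<and> U \<subseteq> {0..s} \<and> D \<in> sets (PiM U (\<lambda>_. borel)) \<and>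
     (AE \<omega> in M. \<omega> \<in> A \<longleftrightarrow> (\<lambda>u\<in>U. W u \<omega>) \<in> D)}"

lemma cylinders_lift:
  assumes "U \<subseteq> V" "D \<in> sets (PiM U (\<lambda>_. borel :: real measure))"
  shows "(\<lambda>f. restrict f U) -` D \<inter> space (PiM V (\<lambda>_. borel)) \<in> sets (PiM V (\<lambda>_. borel))"
  using assms by (intro measurable_sets[OF measurable_restrict_subset]) auto

lemma Int_stable_cylinders: "Int_stable (cylinders s)"
proof (rule Int_stableI)
  fix A B assume "A \<in> cylinders s" "B \<in> cylinders s"
  then obtain U D V E where A: "A \<in> events" "finite U" "U \<subseteq> {0..s}" "D \<in> sets (PiM U (\<lambda>_. borel))"
      "AE \<omega> in M. \<omega> \<in> A \<longleftrightarrow> (\<lambda>u\<in>U. W u \<omega>) \<in> D"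
    and B: "B \<in> events" "finite V" "V \<subseteq> {0..s}" "E \<in> sets (PiM V (\<lambda>_. borel))"
      "AE \<omega> in M. \<omega> \<in> B \<longleftrightarrow> (\<lambda>u\<in>V. W u \<omega>) \<in> E"
    by (auto simp: cylinders_def)
  let ?P = "PiM (U \<union> V) (\<lambda>_. borel :: real measure)"
  define F where "F = ((\<lambda>f. restrict f U) -` D \<inter> space ?P) \<inter> ((\<lambda>f. restrict f V) -` E \<inter> space ?P)"
  have F: "F \<in> sets ?P"
    unfolding F_def using A(4) B(4) by (intro sets.Int cylinders_lift) auto
  have "AE \<omega> in M. \<omega> \<in> A \<inter> B \<longleftrightarrow> (\<lambda>u\<in>U \<union> V. W u \<omega>) \<in> F"
    using A(5) B(5)
  proof eventually_elim
    case (elim \<omega>)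
    have "restrict (\<lambda>u\<in>U \<union> V. W u \<omega>) U = (\<lambda>u\<in>U. W u \<omega>)" "restrict (\<lambda>u\<in>U \<union> V. W u \<omega>) V = (\<lambda>u\<in>V. W u \<omega>)"
      by auto
    then show ?case
      using elim by (auto simp: F_def space_PiM)
  qed
  then show "A \<inter> B \<in> cylinders s"
    using A B F unfolding cylinders_def by (intro CollectI conjI exI[of _ "U \<union> V"] exI[of _ F]) auto
qed

text \<open>Independence is postulated for consecutive increments along an increasing sequence of
  times. The finitely many times of the cylinder are therefore sorted together with 0 and s, and r
  is appended: the cylinder is almost surely determined by the first \<open>n\<close> increments,
  and the increment from s to r is the next one.\<close>

lemma cylinders_indep_increment:
  assumes "A \<in> cylinders s" "0 \<le> s" "s < r" "C \<in> sets borel"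
  shows "prob (A \<inter> ((\<lambda>\<omega>. W r \<omega> - W s \<omega>) -` C \<inter> space M)) =
         prob A * prob ((\<lambda>\<omega>. W r \<omega> - W s \<omega>) -` C \<inter> space M)"
proof -
  obtain U D where A: "A \<in> events" "finite U" "U \<subseteq> {0..s}" "D \<in> sets (PiM U (\<lambda>_. borel))"
      "AE \<omega> in M. \<omega> \<in> A \<longleftrightarrow> (\<lambda>u\<in>U. W u \<omega>) \<in> D"
    using assms by (auto simp: cylinders_def)
  \<comment> \<open>0 is included so that values of \<open>W\<close> are partial sums of increments,
    s so that the last increment starts exactly there.\<close>
  define us where "us = sorted_list_of_set (insert 0 (insert s U))"
  have us: "set us = insert 0 (insert s U)" "sorted us" "distinct us"
    using A(2) unfolding us_def
    by (intro set_sorted_list_of_set, simp) (rule sorted_sorted_list_of_set distinct_sorted_list_of_set)+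
  define n where "n = length us - 1"
  have len: "length us = Suc n" using us(1) by (cases us) (auto simp: n_def)
  define ts where "ts i = (if i \<le> n then us ! i else r)" for i
  have mem: "ts i \<in> {0..s}" if "i \<le> n" for i
    using that us(1) A(3) assms(2) nth_mem[of i us] len by (auto simp: ts_def)
  have mono: "ts i < ts j" if "i < j" "j \<le> n" for i j
    using that us(2,3) len
    by (simp add: ts_def order_less_le sorted_nth_mono nth_eq_iff_index_eq)
  have idx: "\<exists>i\<le>n. ts i = u" if "u \<in> insert 0 (insert s U)" for u
    using that us(1) len unfolding in_set_conv_nth ts_def
    by (metis in_set_conv_nth less_Suc_eq_le)
  have ts0: "ts 0 = 0"
  proof -
    obtain i where "i \<le> n" "ts i = 0" using idx[of 0] by auto
    then show ?thesis using mono[of 0 i] mem[of 0] by (cases i) auto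
  qed
  have tsn: "ts n = s"
  proof -
    obtain i where "i \<le> n" "ts i = s" using idx[of s] by auto
    then show ?thesis using mono[of i n] mem[of n] by (cases "i = n") auto
  qed
  have tsS: "ts (Suc n) = r" by (simp add: ts_def)
  have step: "ts i < ts (Suc i)" if "i < Suc n" for i
    using mono[of i "Suc i"] that tsn tsS assms(3) by (cases "i = n") auto
  define d where "d i \<omega> = W (ts (Suc i)) \<omega> - W (ts i) \<omega>" for i \<omega>
  have ind: "indep_vars (\<lambda>_. borel) d {..<Suc n}"
    unfolding d_def using ts0 step by (intro W_increments_indep) auto
  have tele: "W (ts i) \<omega> = W 0 \<omega> + (\<Sum>j<i. d j \<omega>)" for i \<omega>
    by (induction i) (auto simp: d_def ts0)
  obtain ix where ix: "\<And>u. u \<in> U \<Longrightarrow> ix u \<le> n \<and> ts (ix u) = u"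
    using idx by (metis insertCI)
  \<comment> \<open>Partial sums recover the values of \<open>W\<close> at the times in
    \<open>U\<close> from the increments. The missing term \<open>W 0\<close> vanishes almost
    surely.\<close>
  define \<phi> where "\<phi> f = (\<lambda>u\<in>U. \<Sum>j<ix u. f j)" for f :: "nat \<Rightarrow> real"
  have \<phi>[measurable]: "\<phi> \<in> PiM {..<n} (\<lambda>_. borel) \<rightarrow>\<^sub>M PiM U (\<lambda>_. borel)"
    unfolding \<phi>_def
    by (intro measurable_restrict borel_measurable_sum measurable_component_singleton)
       (use ix in fastforce)
  have iv: "indep_var (PiM {..<n} (\<lambda>_. borel)) (\<lambda>\<omega>. restrict (\<lambda>i. d i \<omega>) {..<n})
              (PiM {n} (\<lambda>_. borel)) (\<lambda>\<omega>. restrict (\<lambda>i. d i \<omega>) {n})"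
    by (intro indep_var_restrict[OF ind]) auto
  let ?V = "\<phi> \<circ> (\<lambda>\<omega>. restrict (\<lambda>i. d i \<omega>) {..<n})"
  let ?P = "PiM {..<n} (\<lambda>_. borel :: real measure)" and ?Q = "PiM {n} (\<lambda>_. borel :: real measure)"
  let ?C = "(\<lambda>\<omega>. W r \<omega> - W s \<omega>) -` C \<inter> space M"
  have Vm: "?V \<in> M \<rightarrow>\<^sub>M PiM U (\<lambda>_. borel)"
    using iv by (intro measurable_comp[OF _ \<phi>]) (auto simp: indep_var_eq)
  have Vs: "?V -` D \<inter> space M \<in> events" using Vm A(4) by (rule measurable_sets)
  have Cs: "?C \<in> events"
    using assms by (intro measurable_sets[OF _ assms(4)] borel_measurable_diff W_measurable) auto
  have eqV: "?V -` D \<inter> space M = (\<lambda>\<omega>. restrict (\<lambda>i. d i \<omega>) {..<n}) -` (\<phi> -` D \<inter> space ?P) \<inter> space M"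
    by (auto simp: space_PiM)
  have eqC: "?C = (\<lambda>\<omega>. restrict (\<lambda>i. d i \<omega>) {n}) -` ((\<lambda>f. f n) -` C \<inter> space ?Q) \<inter> space M"
    by (auto simp: space_PiM d_def tsn tsS)
  have sP: "\<phi> -` D \<inter> space ?P \<in> sets ?P" using \<phi> A(4) by (rule measurable_sets)
  have sQ: "(\<lambda>f. f n) -` C \<inter> space ?Q \<in> sets ?Q"
    using assms(4) by (intro measurable_sets[of _ _ borel]) auto
  have "prob ((?V -` D \<inter> space M) \<inter> ?C) = prob (?V -` D \<inter> space M) * prob ?C"
    unfolding eqV eqC using iv[unfolded indep_var_eq] sP sQ
    by (intro indep_setD[OF conjunct2]) (assumption, (blast intro: sigma_sets.Basic)+)
  moreover have ae: "AE \<omega> in M. \<omega> \<in> A \<longleftrightarrow> \<omega> \<in> ?V -` D \<inter> space M"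
    using A(5) W_0 AE_space
  proof eventually_elim
    case (elim \<omega>)
    have "?V \<omega> = (\<lambda>u\<in>U. W u \<omega>)"
    proof -
      have "(\<Sum>j<ix u. restrict (\<lambda>i. d i \<omega>) {..<n} j) = W u \<omega>" if "u \<in> U" for u
      proof -
        have "(\<Sum>j<ix u. restrict (\<lambda>i. d i \<omega>) {..<n} j) = (\<Sum>j<ix u. d j \<omega>)"
          using ix[OF that] by (intro sum.cong) auto
        then show ?thesis using tele[of "ix u" \<omega>] ix[OF that] elim(2) by simp
      qed
      then show ?thesis by (auto simp: \<phi>_def)
    qed
    then show ?case using elim by auto
  qed
  moreover have "prob A = prob (?V -` D \<inter> space M)"
    using ae A(1) Vs by (intro finite_measure_eq_AE) auto
  moreover have "prob (A \<inter> ?C) = prob ((?V -` D \<inter> space M) \<inter> ?C)"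
    using ae A(1) Vs Cs by (intro finite_measure_eq_AE) auto
  ultimately show ?thesis by simp
qed

lemma nat_filt_subset_cylinders:
  assumes "0 \<le> s"
  shows "nat_filt M W s \<subseteq> sigma_sets (space M) (cylinders s)"
  unfolding nat_filt_def
proof (rule sigma_sets_mono, safe)
  fix u :: real and A :: "real set" assume u: "0 \<le> u" "u \<le> s" and A: "A \<in> sets borel"
  have "W u -` A \<inter> space M \<in> cylinders s"
    unfolding cylinders_def
  proof (intro CollectI conjI exI[of _ "{u}"] exI[of _ "(\<lambda>f. f u) -` A \<inter> space (PiM {u} (\<lambda>_. borel))"])
    show "AE \<omega> in M. (\<omega> \<in> W u -` A \<inter> space M) =
      ((\<lambda>u\<in>{u}. W u \<omega>) \<in> (\<lambda>f. f u) -` A \<inter> space (PiM {u} (\<lambda>_. borel)))"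
      using AE_space by eventually_elim (auto simp: space_PiM)
    show "(\<lambda>f. f u) -` A \<inter> space (PiM {u} (\<lambda>_. borel)) \<in> sets (PiM {u} (\<lambda>_. borel))"
      using A by (intro measurable_sets[of _ _ borel]) auto
  qed (use u A in \<open>auto intro: measurable_sets\<close>)
  then show "W u -` A \<inter> space M \<in> sigma_sets (space M) (cylinders s)" by auto
next
  fix A assume "A \<in> null_sets M"
  then have "A \<in> cylinders s"
    unfolding cylinders_def
    by (intro CollectI conjI exI[of _ "{}"]) (auto intro: AE_not_in)
  then show "A \<in> sigma_sets (space M) (cylinders s)" by auto
qed

lemma nat_filt_events: "0 \<le> s \<Longrightarrow> nat_filt M W s \<subseteq> events"
  unfolding nat_filt_def by (rule sets.sigma_sets_subset) (auto intro: measurable_sets W_measurable)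

lemma Int_stable_vimage_borel: "Int_stable {f -` C \<inter> space M |C. C \<in> sets borel}"
proof (rule Int_stableI, clarsimp)
  fix A B :: "'b set" assume "A \<in> sets borel" "B \<in> sets borel"
  then show "\<exists>C. f -` A \<inter> space M \<inter> (f -` B \<inter> space M) = f -` C \<inter> space M \<and> C \<in> sets borel"
    by (intro exI[of _ "A \<inter> B"]) auto
qed

text \<open>Dynkin's theorem extends the product rule from the \<pi>-system
  \<open>cylinders s\<close> to the sigma-algebra it generates, which contains the augmented
  past.\<close>

lemma nat_filt_indep_increment:
  assumes "A \<in> nat_filt M W s" "0 \<le> s" "s < r" "C \<in> sets borel"
  shows "prob (A \<inter> ((\<lambda>\<omega>. W r \<omega> - W s \<omega>) -` C \<inter> space M)) =
         prob A * prob ((\<lambda>\<omega>. W r \<omega> - W s \<omega>) -` C \<inter> space M)"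
proof -
  let ?C = "{(\<lambda>\<omega>. W r \<omega> - W s \<omega>) -` C \<inter> space M |C. C \<in> sets borel}"
  have sub: "?C \<subseteq> events"
    using assms by (auto intro!: measurable_sets[of _ M borel] borel_measurable_diff W_measurable)
  have "indep_set (cylinders s) ?C"
  proof (rule indep_setI[OF _ sub])
    fix a b assume "a \<in> cylinders s" "b \<in> ?C"
    then show "prob (a \<inter> b) = prob a * prob b"
      using cylinders_indep_increment[OF _ assms(2,3)] by blast
  qed (auto simp: cylinders_def)
  moreover have "Int_stable ?C"
    by (rule Int_stable_vimage_borel)
  ultimately have "indep_set (sigma_sets (space M) (cylinders s)) (sigma_sets (space M) ?C)"
    using Int_stable_cylinders by (intro indep_set_sigma_sets)
  then show ?thesis
    using nat_filt_subset_cylinders[OF assms(2)] assms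
    by (intro indep_setD[where A="sigma_sets (space M) (cylinders s)" and B="sigma_sets (space M) ?C"])
       (blast intro: sigma_sets.Basic)+
qed

text \<open>The augmented past packaged as a \<open>measure\<close>, so that
  \<open>borel_measurable\<close> and the measurability rules apply to it. Only its sigma-algebra
  matters.\<close>

definition filt :: "real \<Rightarrow> 'a measure" where
  "filt t = sigma (space M)
     ({W s -` A \<inter> space M | s A. 0 \<le> s \<and> s \<le> t \<and> A \<in> sets borel} \<union> null_sets M)"

lemma filt_generator_Pow:
  "{W s -` A \<inter> space M | s A. 0 \<le> s \<and> s \<le> t \<and> A \<in> sets borel} \<union> null_sets M \<subseteq> Pow (space M)"
  by (auto dest: null_setsD2 sets.sets_into_space)

lemma space_filt [simp]: "space (filt s) = space M"
  using filt_generator_Pow by (auto simp: filt_def space_measure_of)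

lemma sets_filt: "sets (filt s) = nat_filt M W s"
  using filt_generator_Pow by (auto simp: filt_def nat_filt_def sets_measure_of)

lemma sets_filt_mono: "s \<le> t \<Longrightarrow> sets (filt s) \<subseteq> sets (filt t)"
  unfolding sets_filt nat_filt_def by (intro sigma_sets_mono') fastforce

lemma measurable_filt_mono:
  assumes "f \<in> filt s \<rightarrow>\<^sub>M N" "s \<le> t"
  shows "f \<in> filt t \<rightarrow>\<^sub>M N"
proof (rule measurableI)
  show "f \<omega> \<in> space N" if "\<omega> \<in> space (filt t)" for \<omega>
    using measurable_space[OF assms(1)] that by simp
  show "f -` A \<inter> space (filt t) \<in> sets (filt t)" if "A \<in> sets N" for A
    using measurable_sets[OF assms(1) that] sets_filt_mono[OF assms(2)] by (simp add: subset_iff)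
qed

lemma sets_filt_events: "0 \<le> s \<Longrightarrow> A \<in> sets (filt s) \<Longrightarrow> A \<in> events"
  using nat_filt_events by (auto simp: sets_filt)

lemma measurable_filt_random_variable:
  assumes "f \<in> filt s \<rightarrow>\<^sub>M N" "0 \<le> s"
  shows "f \<in> M \<rightarrow>\<^sub>M N"
proof (rule measurableI)
  show "f \<omega> \<in> space N" if "\<omega> \<in> space M" for \<omega>
    using measurable_space[OF assms(1)] that by simp
  show "f -` A \<inter> space M \<in> events" if "A \<in> sets N" for A
    using sets_filt_events[OF assms(2) measurable_sets[OF assms(1) that]] by simp
qed

lemma W_measurable_filt: "0 \<le> s \<Longrightarrow> s \<le> t \<Longrightarrow> W s \<in> borel_measurable (filt t)"
  by (rule measurableI) (auto simp: sets_filt nat_filt_def intro!: sigma_sets.Basic)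

lemma filt_indep_increment:
  assumes "g \<in> borel_measurable (filt s)" "0 \<le> s" "s < r"
  shows "indep_var borel g borel (\<lambda>\<omega>. W r \<omega> - W s \<omega>)"
proof -
  let ?A = "{g -` C \<inter> space M |C. C \<in> sets borel}"
  let ?C = "{(\<lambda>\<omega>. W r \<omega> - W s \<omega>) -` C \<inter> space M |C. C \<in> sets borel}"
  have sub: "?C \<subseteq> events"
    using assms by (auto intro!: measurable_sets[of _ M borel] borel_measurable_diff W_measurable)
  have g: "g -` C \<inter> space M \<in> nat_filt M W s" if "C \<in> sets borel" for C
    using measurable_sets[OF assms(1) that] by (simp add: sets_filt)
  have gm: "random_variable borel g"
    using assms measurable_filt_random_variable by blast
  have "indep_set ?A ?C"
  proof (rule indep_setI[OF _ sub])
    show "?A \<subseteq> events" using gm by (auto intro: measurable_sets)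
    fix a b assume "a \<in> ?A" "b \<in> ?C"
    then show "prob (a \<inter> b) = prob a * prob b"
      using nat_filt_indep_increment[OF g assms(2,3)] by blast
  qed
  then have "indep_set (sigma_sets (space M) ?A) (sigma_sets (space M) ?C)"
    by (intro indep_set_sigma_sets Int_stable_vimage_borel)
  then show ?thesis
    using assms gm unfolding indep_var_eq by (auto intro!: borel_measurable_diff W_measurable)
qed

lemma W_increment_moments:
  assumes "0 \<le> s" "s < r"
  shows "integrable M (\<lambda>\<omega>. W r \<omega> - W s \<omega>)" "expectation (\<lambda>\<omega>. W r \<omega> - W s \<omega>) = 0"
    "integrable M (\<lambda>\<omega>. (W r \<omega> - W s \<omega>)\<^sup>2)" "expectation (\<lambda>\<omega>. (W r \<omega> - W s \<omega>)\<^sup>2) = r - s"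
proof -
  note D = W_increment_distributed[OF assms]
  have pos: "0 < sqrt (r - s)" using assms by simp
  show 0: "expectation (\<lambda>\<omega>. W r \<omega> - W s \<omega>) = 0"
    using normal_distributed_expectation[OF pos D] by simp
  show "expectation (\<lambda>\<omega>. (W r \<omega> - W s \<omega>)\<^sup>2) = r - s"
    using normal_distributed_variance[OF pos D] 0 assms by simp
  show "integrable M (\<lambda>\<omega>. W r \<omega> - W s \<omega>)"
    using distributed_integrable[OF D, of "\<lambda>x. x"] integrable_normal_moment_nz_1[OF pos, of 0] by simp
  show "integrable M (\<lambda>\<omega>. (W r \<omega> - W s \<omega>)\<^sup>2)"
    using distributed_integrable[OF D, of "\<lambda>x. x\<^sup>2"] integrable_normal_moment[OF pos, of 0 2] by simp
qed

text \<open>In the square of the next partial sum the cross term has mean zero, because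
  \<open>Z n\<close> times \<open>g n\<close> belongs to the past and the increment is centred and
  independent of it. The last term factorises into the second moment of \<open>g n\<close> and the
  length of the time step. The bound \<open>K\<close> secures integrability of the products, and
  measurability of the sum is carried along in the induction.\<close>

lemma discrete_ito_isometry:
  fixes n :: nat and ts :: "nat \<Rightarrow> real" and g :: "nat \<Rightarrow> 'a \<Rightarrow> real"
  assumes "0 \<le> ts 0" and step: "\<And>i. ts i < ts (Suc i)"
    and g: "\<And>i. i < n \<Longrightarrow> g i \<in> borel_measurable (filt (ts i))"
    and bd: "\<And>i \<omega>. i < n \<Longrightarrow> \<omega> \<in> space M \<Longrightarrow> \<bar>g i \<omega>\<bar> \<le> K"
  defines "Z \<equiv> \<lambda>n \<omega>. \<Sum>i<n. g i \<omega> * (W (ts (Suc i)) \<omega> - W (ts i) \<omega>)"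
  shows "integrable M (\<lambda>\<omega>. (Z n \<omega>)\<^sup>2) \<and> Z n \<in> borel_measurable (filt (ts n)) \<and>
    expectation (\<lambda>\<omega>. (Z n \<omega>)\<^sup>2) = (\<Sum>i<n. expectation (\<lambda>\<omega>. (g i \<omega>)\<^sup>2) * (ts (Suc i) - ts i))"
  using g bd
proof (induction n)
  case 0
  then show ?case by (simp add: Z_def)
next
  case (Suc n)
  have nn: "0 \<le> ts i" for i
  proof (induction i)
    case (Suc i)
    then show ?case using step[of i] by linarith
  qed (use assms(1) in simp)
  let ?d = "\<lambda>\<omega>. W (ts (Suc n)) \<omega> - W (ts n) \<omega>"
  note mom = W_increment_moments[OF nn step[of n]]
  have IH: "integrable M (\<lambda>\<omega>. (Z n \<omega>)\<^sup>2)" "Z n \<in> borel_measurable (filt (ts n))"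
    "expectation (\<lambda>\<omega>. (Z n \<omega>)\<^sup>2) = (\<Sum>i<n. expectation (\<lambda>\<omega>. (g i \<omega>)\<^sup>2) * (ts (Suc i) - ts i))"
    using Suc by auto
  have gn: "g n \<in> borel_measurable (filt (ts n))" using Suc.prems by simp
  have gM [measurable]: "random_variable borel (g n)" "random_variable borel (Z n)"
    by (rule measurable_filt_random_variable[OF gn nn], rule measurable_filt_random_variable[OF IH(2) nn])
  have dM [measurable]: "random_variable borel ?d"
    using nn by (intro borel_measurable_diff W_measurable)
  have ZS: "Z (Suc n) \<omega> = Z n \<omega> + g n \<omega> * ?d \<omega>" for \<omega>
    by (simp add: Z_def)
  have dF: "?d \<in> borel_measurable (filt (ts (Suc n)))"
    using nn step[of n] by (intro borel_measurable_diff W_measurable_filt) auto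
  have mZ: "Z (Suc n) \<in> borel_measurable (filt (ts (Suc n)))"
    unfolding ZS[abs_def] using dF
    by (intro borel_measurable_add borel_measurable_times
        measurable_filt_mono[OF IH(2) less_imp_le[OF step]] measurable_filt_mono[OF gn less_imp_le[OF step]])
  have iZ: "integrable M (Z n)"
    by (rule square_integrable_imp_integrable[OF gM(2) IH(1)])
  have ig2: "integrable M (\<lambda>\<omega>. (g n \<omega>)\<^sup>2)"
  proof (rule integrable_const_bound[where B="K\<^sup>2"])
    show "AE \<omega> in M. norm ((g n \<omega>)\<^sup>2) \<le> K\<^sup>2"
    proof (rule AE_I2)
      fix \<omega> assume "\<omega> \<in> space M"
      then have "\<bar>g n \<omega>\<bar>\<^sup>2 \<le> K\<^sup>2" using Suc.prems(2)[of n \<omega>] by (intro power_mono) auto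
      then show "norm ((g n \<omega>)\<^sup>2) \<le> K\<^sup>2" by simp
    qed
  qed simp
  have iZg: "integrable M (\<lambda>\<omega>. Z n \<omega> * g n \<omega>)"
  proof (rule Bochner_Integration.integrable_bound)
    show "integrable M (\<lambda>\<omega>. K * Z n \<omega>)" using iZ by simp
    show "AE \<omega> in M. norm (Z n \<omega> * g n \<omega>) \<le> norm (K * Z n \<omega>)"
    proof (rule AE_I2)
      fix \<omega> assume "\<omega> \<in> space M"
      then have "\<bar>g n \<omega>\<bar> \<le> \<bar>K\<bar>" using Suc.prems(2)[of n \<omega>] by auto
      then show "norm (Z n \<omega> * g n \<omega>) \<le> norm (K * Z n \<omega>)"
        by (simp add: abs_mult mult.commute[of "\<bar>K\<bar>"] mult_left_mono)
    qed
  qed auto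
  have i1: "indep_var borel (\<lambda>\<omega>. Z n \<omega> * g n \<omega>) borel ?d"
    by (rule filt_indep_increment[OF borel_measurable_times[OF IH(2) gn] nn step])
  have i2: "indep_var borel (\<lambda>\<omega>. (g n \<omega>)\<^sup>2) borel (\<lambda>\<omega>. (?d \<omega>)\<^sup>2)"
    using indep_var_compose[OF filt_indep_increment[OF gn nn step], of "\<lambda>x. x\<^sup>2" borel "\<lambda>x. x\<^sup>2" borel]
    by (simp add: comp_def)
  have e1: "expectation (\<lambda>\<omega>. Z n \<omega> * g n \<omega> * ?d \<omega>) = 0"
    using indep_var_lebesgue_integral[OF i1 iZg mom(1)] mom(2) by simp
  have e2: "expectation (\<lambda>\<omega>. (g n \<omega>)\<^sup>2 * (?d \<omega>)\<^sup>2) = expectation (\<lambda>\<omega>. (g n \<omega>)\<^sup>2) * (ts (Suc n) - ts n)"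
    using indep_var_lebesgue_integral[OF i2 ig2 mom(3)] mom(4) by simp
  have j1: "integrable M (\<lambda>\<omega>. Z n \<omega> * g n \<omega> * ?d \<omega>)"
    using indep_var_integrable[OF i1 iZg mom(1)] .
  have j2: "integrable M (\<lambda>\<omega>. (g n \<omega>)\<^sup>2 * (?d \<omega>)\<^sup>2)"
    using indep_var_integrable[OF i2 ig2 mom(3)] .
  have sq: "(Z (Suc n) \<omega>)\<^sup>2 = (Z n \<omega>)\<^sup>2 + 2 * (Z n \<omega> * g n \<omega> * ?d \<omega>) + (g n \<omega>)\<^sup>2 * (?d \<omega>)\<^sup>2" for \<omega>
    by (simp add: ZS power2_eq_square algebra_simps)
  have "integrable M (\<lambda>\<omega>. (Z (Suc n) \<omega>)\<^sup>2)"
    unfolding sq using IH(1) j1 j2 by (intro Bochner_Integration.integrable_add) auto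
  moreover have "expectation (\<lambda>\<omega>. (Z (Suc n) \<omega>)\<^sup>2) =
      expectation (\<lambda>\<omega>. (Z n \<omega>)\<^sup>2) + 2 * expectation (\<lambda>\<omega>. Z n \<omega> * g n \<omega> * ?d \<omega>) +
      expectation (\<lambda>\<omega>. (g n \<omega>)\<^sup>2 * (?d \<omega>)\<^sup>2)"
    unfolding sq using IH(1) j1 j2 by simp
  ultimately show ?case using mZ IH(3) e1 e2 by simp
qed

section \<open>Gaussian bounds for single increments\<close>

lemma increment_interval_le:
  assumes "0 \<le> s" "s < r" "l \<le> h"
  shows "prob {\<omega> \<in> space M. W r \<omega> - W s \<omega> \<in> {l..h}} \<le> (h - l) / sqrt (r - s)"
proof -
  have pos: "0 < sqrt (r - s)" using assms by simp
  have "emeasure M {\<omega> \<in> space M. W r \<omega> - W s \<omega> \<in> {l..h}} =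
      (\<integral>\<^sup>+x. ennreal (normal_density 0 (sqrt (r - s)) x) * indicator {l..h} x \<partial>lborel)"
    using distributed_emeasure[OF W_increment_distributed[OF assms(1,2)], of "{l..h}"]
    by (simp add: vimage_def Int_def conj_commute)
  also have "\<dots> \<le> (\<integral>\<^sup>+x. ennreal (1 / sqrt (r - s)) * indicator {l..h} x \<partial>lborel)"
  proof (intro nn_integral_mono mult_right_mono ennreal_leI)
    fix x
    have "normal_density 0 (sqrt (r - s)) x \<le> 1 / sqrt (2 * pi * (sqrt (r - s))\<^sup>2) * 1"
      unfolding normal_density_def using pos by (intro mult_left_mono) auto
    also have "\<dots> \<le> 1 / sqrt (r - s)"
    proof -
      have "(r - s) * 1 \<le> (r - s) * (2 * pi)" using assms pi_gt3 by (intro mult_left_mono) auto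
      then have "sqrt (r - s) \<le> sqrt (2 * pi * (sqrt (r - s))\<^sup>2)"
        using assms by (simp add: mult.commute)
      then show ?thesis using pos by (simp add: frac_le)
    qed
    finally show "normal_density 0 (sqrt (r - s)) x \<le> 1 / sqrt (r - s)" .
  qed simp
  also have "\<dots> = ennreal ((h - l) / sqrt (r - s))"
    using assms pos by (simp add: nn_integral_cmult ennreal_mult[symmetric])
  finally show ?thesis
    using assms pos by (simp add: emeasure_eq_measure)
qed

text \<open>Within two standard deviations the exponent of the density is at least -2, so the
  density is at least the constant that multiplies h - l.\<close>

lemma increment_interval_ge:
  assumes "0 \<le> s" "s < r" "l \<le> h" "\<And>x. l \<le> x \<Longrightarrow> x \<le> h \<Longrightarrow> \<bar>x\<bar> \<le> 2 * sqrt (r - s)"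
  shows "(h - l) * (exp (- 2) / sqrt (2 * pi * (r - s))) \<le> prob {\<omega> \<in> space M. W r \<omega> - W s \<omega> \<in> {l..h}}"
proof -
  have pos: "0 < sqrt (r - s)" using assms by simp
  let ?c = "exp (- 2) / sqrt (2 * pi * (r - s))"
  have "ennreal ((h - l) * ?c) = (\<integral>\<^sup>+x. ennreal ?c * indicator {l..h} x \<partial>lborel)"
    using assms by (subst nn_integral_cmult_indicator) (simp_all add: ennreal_mult[symmetric] mult.commute)
  also have "\<dots> \<le> (\<integral>\<^sup>+x. ennreal (normal_density 0 (sqrt (r - s)) x) * indicator {l..h} x \<partial>lborel)"
  proof (rule nn_integral_mono)
    fix x
    show "ennreal ?c * indicator {l..h} x \<le> ennreal (normal_density 0 (sqrt (r - s)) x) * indicator {l..h} x"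
    proof (cases "x \<in> {l..h}")
      case True
      then have "\<bar>x\<bar>\<^sup>2 \<le> (2 * sqrt (r - s))\<^sup>2" using assms(4) by (intro power_mono) auto
      then have "x\<^sup>2 \<le> 4 * (r - s)" using assms by (simp add: power_mult_distrib)
      then have "- 2 \<le> - x\<^sup>2 / (2 * (r - s))" using assms by (simp add: field_simps)
      then have "?c \<le> normal_density 0 (sqrt (r - s)) x"
        using assms pos by (simp add: normal_density_def divide_right_mono)
      then show ?thesis using True by (simp add: ennreal_leI)
    qed simp
  qed
  also have "\<dots> = emeasure M {\<omega> \<in> space M. W r \<omega> - W s \<omega> \<in> {l..h}}"
    using distributed_emeasure[OF W_increment_distributed[OF assms(1,2)], of "{l..h}"]
    by (simp add: vimage_def Int_def conj_commute)
  finally show ?thesis by (simp add: emeasure_eq_measure)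
qed

text \<open>Bounds the probability that a Brownian increment exceeds one standard deviation from below:
  the interval $[3/2, 2]$ has length $1/2$, and there the normal density is at least
  $e^{-2} / \sqrt{2\pi}$.\<close>

definition escape :: real where
  "escape = exp (- 2) / (2 * sqrt (2 * pi))"

lemma escape_pos: "0 < escape"
  by (simp add: escape_def)

lemma prob_increment_le:
  assumes "0 \<le> s" "s < r" and e: "e = 1 \<or> e = - 1"
  shows "prob {\<omega> \<in> space M. e * (W r \<omega> - W s \<omega>) \<le> sqrt (r - s)} \<le> 1 - escape"
proof -
  define q where "q = sqrt (r - s)"
  have pos: "0 < q" using assms by (simp add: q_def)
  \<comment> \<open>For e = -1 the interval is reflected. It starts at 3/2 q rather than q, hence is
    disjoint from the event in spite of the weak inequality there, and it ends at two standard
    deviations.\<close>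
  define l h where "l = (if e = 1 then 3 / 2 * q else - 2 * q)" and "h = (if e = 1 then 2 * q else - (3 / 2) * q)"
  have lh: "h - l = q / 2" "l \<le> h" using pos by (auto simp: l_def h_def)
  have [measurable]: "random_variable borel (W r)" "random_variable borel (W s)"
    using assms by (auto intro: W_measurable)
  let ?A = "{\<omega> \<in> space M. e * (W r \<omega> - W s \<omega>) \<le> q}" and ?B = "{\<omega> \<in> space M. W r \<omega> - W s \<omega> \<in> {l..h}}"
  have A: "?A \<in> events" by measurable
  have B: "?B \<in> events" by measurable
  have "?A \<subseteq> space M - ?B"
    using e pos by (auto simp: l_def h_def)
  then have "prob ?A \<le> prob (space M - ?B)" using A B by (intro finite_measure_mono) auto
  also have "\<dots> = 1 - prob ?B" using B by (rule prob_compl)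
  finally have "prob ?A \<le> 1 - prob ?B" .
  moreover have "(h - l) * (exp (- 2) / sqrt (2 * pi * (r - s))) \<le> prob ?B"
  proof (rule increment_interval_ge[OF assms(1,2) lh(2)])
    show "\<bar>x\<bar> \<le> 2 * sqrt (r - s)" if "l \<le> x" "x \<le> h" for x
      using that pos unfolding q_def[symmetric] by (auto simp: l_def h_def split: if_splits)
  qed
  moreover have "(h - l) * (exp (- 2) / sqrt (2 * pi * (r - s))) = escape"
    unfolding lh(1) using pos by (simp add: escape_def real_sqrt_mult q_def)
  ultimately show ?thesis by (simp add: q_def)
qed

end

section \<open>Local Gaussian approximation of the solution\<close>

locale sde = brownian M W for M :: "'a measure" and W +
  fixes b \<sigma> :: "real \<Rightarrow> real" and \<xi> :: real and X :: "real \<Rightarrow> 'a \<Rightarrow> real" and \<beta> :: real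
  assumes sol: "strong_solution M W b \<sigma> \<xi> X"
    and \<sigma>_cont: "continuous_on UNIV \<sigma>"
    and \<sigma>_pos: "\<And>x. 0 < \<sigma> x"
    and b_borel [measurable]: "b \<in> borel_measurable borel"
    and b_bounded: "\<And>x. \<bar>b x\<bar> \<le> \<beta>"
begin

lemma X_measurable: "0 \<le> t \<Longrightarrow> random_variable borel (X t)"
  and X_cont: "\<omega> \<in> space M \<Longrightarrow> continuous_on {0..} (\<lambda>t. X t \<omega>)"
  using sol by (auto simp: strong_solution_def)

lemma X_measurable_filt:
  assumes "0 \<le> s" "s \<le> t" shows "X s \<in> borel_measurable (filt t)"
proof (rule measurable_filt_mono[OF _ assms(2)], rule measurableI)
  show "X s -` A \<inter> space (filt s) \<in> sets (filt s)" if "A \<in> sets borel" for A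
    using sol assms(1) that by (simp add: strong_solution_def sets_filt)
qed simp

lemma \<sigma>_borel [measurable]: "\<sigma> \<in> borel_measurable borel"
  using \<sigma>_cont by (rule borel_measurable_continuous_onI)

lemma \<sigma>X_cont: "\<omega> \<in> space M \<Longrightarrow> continuous_on {0..} (\<lambda>t. \<sigma> (X t \<omega>))"
  using continuous_on_compose2[OF \<sigma>_cont X_cont] by auto

lemma \<sigma>X_measurable_filt: "0 \<le> s \<Longrightarrow> s \<le> t \<Longrightarrow> (\<lambda>\<omega>. \<sigma> (X s \<omega>)) \<in> borel_measurable (filt t)"
  by (rule measurable_compose[OF X_measurable_filt \<sigma>_borel])

definition drift :: "real \<Rightarrow> 'a \<Rightarrow> real" where
  "drift t \<omega> = (LINT s:{0..t}|lborel. b (X s \<omega>))"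

text \<open>By continuity of paths X is the pointwise limit of processes that are constant in time
  on grid cells, and those are jointly measurable because they involve countably many random
  variables. \<open>max 0\<close> extends the time axis to the whole line, as nothing is known about
  X at negative times.\<close>

lemma X_jointly_measurable: "(\<lambda>(\<omega>, s). X (max 0 s) \<omega>) \<in> borel_measurable (M \<Otimes>\<^sub>M lborel)"
proof (rule borel_measurable_LIMSEQ_real)
  let ?t = "\<lambda>n s. max 0 (real_of_int \<lfloor>real (Suc n) * s\<rfloor> / real (Suc n))"
  show "(\<lambda>n. (\<lambda>(\<omega>, s). X (?t n s) \<omega>) p) \<longlonglongrightarrow> (\<lambda>(\<omega>, s). X (max 0 s) \<omega>) p"
    if p: "p \<in> space (M \<Otimes>\<^sub>M lborel)" for p
  proof -
    obtain \<omega> s where p: "p = (\<omega>, s)" "\<omega> \<in> space M" using p by (cases p) (auto simp: space_pair_measure)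
    have "(\<lambda>n. real_of_int \<lfloor>real (Suc n) * s\<rfloor> / real (Suc n)) \<longlonglongrightarrow> s"
      using LIMSEQ_Suc[OF Lambda_tendsto] by (simp add: Lambda_def)
    then have "(\<lambda>n. ?t n s) \<longlonglongrightarrow> max 0 s"
      by (intro tendsto_max tendsto_const)
    then have "(\<lambda>n. X (?t n s) \<omega>) \<longlonglongrightarrow> X (max 0 s) \<omega>"
      by (intro continuous_on_tendsto_compose[OF X_cont[OF p(2)]]) auto
    then show ?thesis by (simp add: p)
  qed
  fix n
  have 1: "(\<lambda>p. X (max 0 (real_of_int i / real (Suc n))) (fst p)) \<in> borel_measurable (M \<Otimes>\<^sub>M lborel)" for i
    by (rule measurable_compose[OF measurable_fst X_measurable]) simp
  have 2: "(\<lambda>p. \<lfloor>real (Suc n) * snd p\<rfloor>) \<in> M \<Otimes>\<^sub>M lborel \<rightarrow>\<^sub>M count_space UNIV"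
    by (rule measurable_compose[OF measurable_snd]) simp
  have "(\<lambda>p. X (max 0 (real_of_int \<lfloor>real (Suc n) * snd p\<rfloor> / real (Suc n))) (fst p)) \<in> borel_measurable (M \<Otimes>\<^sub>M lborel)"
    by (rule measurable_compose_countable[OF 1 2])
  then show "(\<lambda>(\<omega>, s). X (?t n s) \<omega>) \<in> borel_measurable (M \<Otimes>\<^sub>M lborel)"
    by (simp add: case_prod_beta')
qed

lemma drift_measurable: "random_variable borel (drift t)"
proof -
  have [measurable]: "(\<lambda>p. X (max 0 (snd p)) (fst p)) \<in> borel_measurable (M \<Otimes>\<^sub>M lborel)"
    using X_jointly_measurable by (simp add: case_prod_beta')
  have eq: "drift t \<omega> = (LINT s|lborel. indicator {0..t} s *\<^sub>R b (X (max 0 s) \<omega>))" for \<omega>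
    unfolding drift_def set_lebesgue_integral_def
    by (rule Bochner_Integration.integral_cong) (auto simp: indicator_def)
  show ?thesis
    unfolding eq[abs_def]
    by (rule lborel.borel_measurable_lebesgue_integral) (simp add: case_prod_beta')
qed

lemma drift_diff_le:
  assumes "0 \<le> s" "s \<le> r" "\<omega> \<in> space M"
  shows "\<bar>drift r \<omega> - drift s \<omega>\<bar> \<le> \<beta> * (r - s)"
proof -
  have [measurable]: "(\<lambda>v. X (max 0 v) \<omega>) \<in> borel_measurable lborel"
  proof -
    have "continuous_on UNIV (\<lambda>v. X (max 0 v) \<omega>)"
      by (rule continuous_on_compose2[OF X_cont[OF assms(3)]]) (auto intro!: continuous_intros)
    then show ?thesis by (simp add: borel_measurable_continuous_onI)
  qed
  have eq: "drift t \<omega> = (LINT v:{0..t}|lborel. b (X (max 0 v) \<omega>))" for t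
    unfolding drift_def set_lebesgue_integral_def
    by (rule Bochner_Integration.integral_cong) (auto simp: indicator_def)
  have int: "set_integrable lborel {a..c} (\<lambda>v. b (X (max 0 v) \<omega>))" for a c
    unfolding set_integrable_def
    by (rule integrableI_bounded_set_indicator[where B=\<beta>]) (use b_bounded emeasure_bounded_finite[of "{a..c}"] in auto)
  have int': "set_integrable lborel {a<..c} (\<lambda>v. b (X (max 0 v) \<omega>))" for a c
    by (rule set_integrable_subset[OF int[of a c]]) auto
  have "{0..r} = {0..s} \<union> {s<..r}" using assms by auto
  then have "drift r \<omega> = drift s \<omega> + (LINT v:{s<..r}|lborel. b (X (max 0 v) \<omega>))"
    unfolding eq using int int' by (simp only: set_integral_Un[symmetric]) (subst set_integral_Un, auto)
  moreover have "\<bar>LINT v:{s<..r}|lborel. b (X (max 0 v) \<omega>)\<bar> \<le> \<beta> * (r - s)"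
  proof -
    have "\<bar>LINT v:{s<..r}|lborel. b (X (max 0 v) \<omega>)\<bar> \<le> (LINT v:{s<..r}|lborel. \<bar>b (X (max 0 v) \<omega>)\<bar>)"
      using set_integral_norm_bound[OF int'[of s r]] by simp
    also have "\<dots> \<le> (LINT v:{s<..r}|lborel. \<beta>)"
    proof (rule set_integral_mono)
      show "set_integrable lborel {s<..r} (\<lambda>v. \<bar>b (X (max 0 v) \<omega>)\<bar>)"
        by (rule set_integrable_abs[OF int'])
      show "set_integrable lborel {s<..r} (\<lambda>v. \<beta>)"
        unfolding set_integrable_def using emeasure_bounded_finite[of "{s<..r}"] by simp
    qed (rule b_bounded)
    also have "\<dots> = \<beta> * (r - s)"
      using assms by (simp add: set_lebesgue_integral_def)
    finally show ?thesis .
  qed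
  ultimately show ?thesis by simp
qed

lemma ito_error_tendsto:
  assumes "0 \<le> t" "0 < \<epsilon>"
  shows "(\<lambda>m. prob {\<omega>\<in>space M. \<epsilon> < \<bar>ito_sum \<sigma> W X t m \<omega> - (X t \<omega> - \<xi> - drift t \<omega>)\<bar>}) \<longlonglongrightarrow> 0"
  using sol assms by (simp add: strong_solution_def drift_def)

lemma ito_sum_measurable: "0 \<le> t \<Longrightarrow> random_variable borel (ito_sum \<sigma> W X t m)"
  unfolding ito_sum_def
  by (intro borel_measurable_sum borel_measurable_times borel_measurable_diff W_measurable
      measurable_compose[OF X_measurable \<sigma>_borel]) auto

text \<open>Formally the Ito integral of \<sigma>(X_v) - \<sigma>(X_s) over [s, r], the error made
  by freezing the diffusion coefficient at time s. The equation allows its definition without a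
  stochastic integral.\<close>

definition residual :: "real \<Rightarrow> real \<Rightarrow> 'a \<Rightarrow> real" where
  "residual s r \<omega> = X r \<omega> - X s \<omega> - (drift r \<omega> - drift s \<omega>) - \<sigma> (X s \<omega>) * (W r \<omega> - W s \<omega>)"

lemma residual_measurable:
  "0 \<le> s \<Longrightarrow> 0 \<le> r \<Longrightarrow> random_variable borel (residual s r)"
  unfolding residual_def
  by (intro borel_measurable_diff borel_measurable_times X_measurable drift_measurable W_measurable
      measurable_compose[OF X_measurable \<sigma>_borel])

text \<open>The It\^o sums for $s = nu$ and $r = Nu$ run along different dyadic partitions; both are sums
  over the common grid of mesh $u / 2^m$. The integrand differences are truncated at $\theta_1$ before
  time $s$ and at $\theta$ after it, which changes nothing off the two oscillation events.\<close>

lemma residual_bound_aux: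
  fixes u :: real and n N m :: nat
  assumes u: "0 < u" and nN: "n < N" and E: "E \<in> sets (filt (real n * u))"
    and \<theta>: "0 < \<theta>" and \<theta>1: "0 < \<theta>1" and \<epsilon>: "0 < \<epsilon>"
    and U: "countable U" "U \<subseteq> {0..}" "\<And>i. i \<le> N * 2 ^ m \<Longrightarrow> real i * (u / 2 ^ m) \<in> U"
    and m: "real N * u / 2 ^ m \<le> real N * u - real n * u"
  defines "s \<equiv> real n * u" and "r \<equiv> real N * u" and "Y \<equiv> \<lambda>v \<omega>. \<sigma> (X v \<omega>)"
  shows "prob {\<omega> \<in> E. 2 * \<epsilon> < \<bar>residual s r \<omega>\<bar>} \<le>
     prob (osc M Y U (r / 2 ^ m) \<theta>1) + prob (E \<inter> osc M Y U (r - s) \<theta>)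
     + (\<theta>1\<^sup>2 * s + \<theta>\<^sup>2 * (r - s) * prob E) / \<epsilon>\<^sup>2
     + prob {\<omega>\<in>space M. \<epsilon> / 2 < \<bar>ito_sum \<sigma> W X r m \<omega> - (X r \<omega> - \<xi> - drift r \<omega>)\<bar>}
     + prob {\<omega>\<in>space M. \<epsilon> / 2 < \<bar>ito_sum \<sigma> W X s m \<omega> - (X s \<omega> - \<xi> - drift s \<omega>)\<bar>}"
proof -
  define d where "d = u / 2 ^ m"
  have d: "0 < d" using u by (simp add: d_def)
  have sd: "s = real (n * 2 ^ m) * d" and rd: "r = real (N * 2 ^ m) * d"
    by (auto simp: s_def r_def d_def)
  have s0: "0 \<le> s" and r0: "0 \<le> r" using u by (auto simp: s_def r_def)
  have Es: "E \<in> sets (filt s)" using E by (simp add: s_def)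
  have EM: "E \<in> events" using sets_filt_events[OF s0 Es] .
  have nN2: "n * 2 ^ m < N * 2 ^ m" using nN by simp
  have split: "(\<Sum>i<N * 2 ^ m. f i) = (\<Sum>i<n * 2 ^ m. f i) + (\<Sum>i\<in>{n * 2 ^ m..<N * 2 ^ m}. f i)"
    for f :: "nat \<Rightarrow> real"
    using sum.atLeastLessThan_concat[of 0 "n * 2 ^ m" "N * 2 ^ m" f] nN2 by (simp add: lessThan_atLeast0)
  define t where "t i = real i * d" for i :: nat
  have t_mono: "t i \<le> t j \<longleftrightarrow> i \<le> j" for i j using d by (simp add: t_def)
  have t0: "0 \<le> t i" for i using d by (simp add: t_def)
  have tU: "t i \<in> U" if "i \<le> N * 2 ^ m" for i using U(3)[OF that] by (simp add: t_def d_def)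
  have sU: "s \<in> U" using tU[of "n * 2 ^ m"] nN2 by (simp add: t_def sd)
  define c where "c i = (if i < n * 2 ^ m then \<theta>1 else \<theta>)" for i
  \<comment> \<open>Index \<open>n * 2 ^ m\<close> is time s. Before it the two Ito sums differ only
    in where \<sigma>(X) is evaluated; after it the integrand is compared with its value at
    s.\<close>
  define g0 where "g0 i \<omega> = Y (t (N * (i div N))) \<omega> - (if i < n * 2 ^ m then Y (t (n * (i div n))) \<omega> else Y s \<omega>)" for i \<omega>
  \<comment> \<open>The indicator of \<open>E\<close> multiplies only terms after s, since
    \<open>E\<close> need not belong to the past of an earlier time. The terms before s do not carry
    P(E); their bound \<theta>1 is later sent to 0.\<close>
  define g where "g i \<omega> = (if i < n * 2 ^ m then 1 else indicator E \<omega>) * max (- c i) (min (c i) (g0 i \<omega>))" for i \<omega>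
  define Z where "Z \<omega> = (\<Sum>i<N * 2 ^ m. g i \<omega> * (W (t (Suc i)) \<omega> - W (t i) \<omega>))" for \<omega>
  have cpos: "0 < c i" for i using \<theta> \<theta>1 by (simp add: c_def)
  have Ym: "Y (t j) \<in> borel_measurable (filt (t i))" if "j \<le> i" for i j
    unfolding Y_def using that t0 by (intro \<sigma>X_measurable_filt) (auto simp: t_mono)
  have Ysm: "Y s \<in> borel_measurable (filt (t i))" if "n * 2 ^ m \<le> i" for i
    using Ym[OF that] by (simp add: sd t_def)
  have Em: "E \<in> sets (filt (t i))" if "n * 2 ^ m \<le> i" for i
    using sets_filt_mono[of s "t i"] Es t_mono[of "n * 2 ^ m" i] that by (auto simp: sd t_def)
  have g0m: "g0 i \<in> borel_measurable (filt (t i))" for i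
    unfolding g0_def
    by (cases "i < n * 2 ^ m") (auto intro!: borel_measurable_diff Ym Ysm)
  have gm: "g i \<in> borel_measurable (filt (t i))" for i
    unfolding g_def using g0m[of i] Em[of i]
    by (cases "i < n * 2 ^ m") (auto intro!: borel_measurable_times borel_measurable_max borel_measurable_min)
  have gbd: "\<bar>g i \<omega>\<bar> \<le> c i * (if i < n * 2 ^ m then 1 else indicator E \<omega>)" for i \<omega>
    using cpos[of i] by (auto simp: g_def indicator_def)
  have gbd': "\<bar>g i \<omega>\<bar> \<le> max \<theta>1 \<theta>" for i \<omega>
    using gbd[of i \<omega>] \<theta> \<theta>1 by (cases "\<omega> \<in> E"; cases "i < n * 2 ^ m") (auto simp: c_def)
  have iso: "integrable M (\<lambda>\<omega>. (Z \<omega>)\<^sup>2) \<and> Z \<in> borel_measurable (filt (t (N * 2 ^ m))) \<and>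
      expectation (\<lambda>\<omega>. (Z \<omega>)\<^sup>2) = (\<Sum>i<N * 2 ^ m. expectation (\<lambda>\<omega>. (g i \<omega>)\<^sup>2) * (t (Suc i) - t i))"
    unfolding Z_def
    by (rule discrete_ito_isometry[where K="max \<theta>1 \<theta>"]) (use gm gbd' d in \<open>auto simp: t_def\<close>)
  have Zm: "random_variable borel Z"
    using iso measurable_filt_random_variable t0 by blast
  have gsq: "expectation (\<lambda>\<omega>. (g i \<omega>)\<^sup>2) \<le> (if i < n * 2 ^ m then \<theta>1\<^sup>2 else \<theta>\<^sup>2 * prob E)" for i
  proof -
    have *: "(g i \<omega>)\<^sup>2 \<le> (if i < n * 2 ^ m then \<theta>1\<^sup>2 else \<theta>\<^sup>2 * indicator E \<omega>)" for \<omega>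
    proof -
      have "\<bar>g i \<omega>\<bar>\<^sup>2 \<le> (c i * (if i < n * 2 ^ m then 1 else indicator E \<omega>))\<^sup>2"
        using gbd by (intro power_mono) auto
      then show ?thesis by (auto simp: c_def indicator_def power_mult_distrib split: if_splits)
    qed
    have gM: "random_variable borel (g i)"
      using gm measurable_filt_random_variable t0 by blast
    have "integrable M (\<lambda>\<omega>. (g i \<omega>)\<^sup>2)"
    proof (intro integrable_const_bound[where B="(max \<theta>1 \<theta>)\<^sup>2"] AE_I2)
      show "norm ((g i \<omega>)\<^sup>2) \<le> (max \<theta>1 \<theta>)\<^sup>2" for \<omega>
        using power_mono[OF gbd'[of i \<omega>], of 2] by simp
    qed (use gM in simp)
    moreover have "integrable M (\<lambda>\<omega>. if i < n * 2 ^ m then \<theta>1\<^sup>2 else \<theta>\<^sup>2 * indicator E \<omega>)"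
      using integrable_real_indicator[of E M] EM by (cases "i < n * 2 ^ m") (simp_all add: emeasure_eq_measure)
    ultimately have "expectation (\<lambda>\<omega>. (g i \<omega>)\<^sup>2) \<le> expectation (\<lambda>\<omega>. if i < n * 2 ^ m then \<theta>1\<^sup>2 else \<theta>\<^sup>2 * indicator E \<omega>)"
      using * by (intro integral_mono)
    also have "\<dots> = (if i < n * 2 ^ m then \<theta>1\<^sup>2 else \<theta>\<^sup>2 * prob E)"
      using EM by (simp add: prob_space)
    finally show ?thesis .
  qed
  have EZ: "expectation (\<lambda>\<omega>. (Z \<omega>)\<^sup>2) \<le> \<theta>1\<^sup>2 * s + \<theta>\<^sup>2 * (r - s) * prob E"
  proof -
    have "expectation (\<lambda>\<omega>. (Z \<omega>)\<^sup>2) \<le> (\<Sum>i<N * 2 ^ m. (if i < n * 2 ^ m then \<theta>1\<^sup>2 else \<theta>\<^sup>2 * prob E) * d)"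
      using iso d gsq by (auto simp: t_def algebra_simps intro!: sum_mono mult_right_mono)
    also have "\<dots> = (\<Sum>i<n * 2 ^ m. \<theta>1\<^sup>2 * d) + (\<Sum>i\<in>{n * 2 ^ m..<N * 2 ^ m}. \<theta>\<^sup>2 * prob E * d)"
      unfolding split by simp
    also have "\<dots> = \<theta>1\<^sup>2 * s + \<theta>\<^sup>2 * (r - s) * prob E"
      using nN2 by (simp add: sd rd of_nat_diff algebra_simps)
    finally show ?thesis .
  qed
  let ?Sg = "\<lambda>\<omega>. \<Sum>i<N * 2 ^ m. g0 i \<omega> * (W (t (Suc i)) \<omega> - W (t i) \<omega>)"
  have Sg: "ito_sum \<sigma> W X r m \<omega> - ito_sum \<sigma> W X s m \<omega> - Y s \<omega> * (W r \<omega> - W s \<omega>) = ?Sg \<omega>" for \<omega>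
  proof -
    let ?d = "\<lambda>i. W (t (Suc i)) \<omega> - W (t i) \<omega>"
    have "ito_sum \<sigma> W X r m \<omega> = (\<Sum>i<N * 2 ^ m. Y (t (N * (i div N))) \<omega> * ?d i)"
      unfolding r_def ito_sum_grid by (simp add: Y_def t_def d_def)
    moreover have "ito_sum \<sigma> W X s m \<omega> = (\<Sum>i<n * 2 ^ m. Y (t (n * (i div n))) \<omega> * ?d i)"
      unfolding s_def ito_sum_grid by (simp add: Y_def t_def d_def)
    moreover have "Y s \<omega> * (W r \<omega> - W s \<omega>) = (\<Sum>i\<in>{n * 2 ^ m..<N * 2 ^ m}. Y s \<omega> * ?d i)"
    proof -
      have "(\<Sum>i\<in>{n * 2 ^ m..<N * 2 ^ m}. ?d i) = W (t (N * 2 ^ m)) \<omega> - W (t (n * 2 ^ m)) \<omega>"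
        using nN2 by (intro sum_Suc_diff'[of _ _ "\<lambda>i. W (t i) \<omega>"]) auto
      then show ?thesis by (simp add: sum_distrib_left[symmetric] sd rd t_def)
    qed
    moreover have "?Sg \<omega> = (\<Sum>i<n * 2 ^ m. (Y (t (N * (i div N))) \<omega> - Y (t (n * (i div n))) \<omega>) * ?d i)
        + (\<Sum>i\<in>{n * 2 ^ m..<N * 2 ^ m}. (Y (t (N * (i div N))) \<omega> - Y s \<omega>) * ?d i)"
      unfolding split g0_def by simp
    ultimately show ?thesis
      by (simp add: split left_diff_distrib sum_subtractf)
  qed
  have Zeq: "Z \<omega> = ?Sg \<omega>" if "\<omega> \<in> E" "\<omega> \<notin> osc M Y U (r / 2 ^ m) \<theta>1" "\<omega> \<notin> osc M Y U (r - s) \<theta>" for \<omega>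
    unfolding Z_def
  proof (rule sum.cong)
    fix i assume "i \<in> {..<N * 2 ^ m}"
    then have i: "i < N * 2 ^ m" by simp
    have sp: "\<omega> \<in> space M" using sets.sets_into_space[OF EM] that(1) by auto
    have N0: "0 < N" using nN by simp
    have jN: "N * (i div N) \<le> i" "i < N * (i div N) + N"
      using N0 by (simp, metis add.commute dividend_less_times_div)
    have tN: "t (N * (i div N)) \<in> U" using jN i by (intro tU) linarith
    have "\<bar>g0 i \<omega>\<bar> \<le> c i"
    proof (cases "i < n * 2 ^ m")
      case True
      then have n0: "0 < n" by (cases n) auto
      have jn: "n * (i div n) \<le> i" "i < n * (i div n) + n"
        using n0 by (simp, metis add.commute dividend_less_times_div)
      have tn: "t (n * (i div n)) \<in> U" using jn i by (intro tU) linarith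
      \<comment> \<open>Both evaluation points lie less than N fine steps behind i, so they are
        within the mesh \<open>r / 2 ^ m\<close> of the longer partition.\<close>
      have "\<bar>t (N * (i div N)) - t (n * (i div n))\<bar> = \<bar>real (N * (i div N)) - real (n * (i div n))\<bar> * d"
        using d by (simp add: t_def left_diff_distrib[symmetric] abs_mult)
      also have "\<dots> \<le> real N * d"
      proof (rule mult_right_mono)
        show "\<bar>real (N * (i div N)) - real (n * (i div n))\<bar> \<le> real N"
          using jN jn nN by linarith
      qed (use d in simp)
      also have "\<dots> = r / 2 ^ m" by (simp add: r_def d_def)
      finally show ?thesis
        using that(2) sp tN tn True by (force simp: osc_def g0_def c_def)
    next
      case False
      have "t (N * (i div N)) \<le> r"
        unfolding rd t_def using jN i d by (intro mult_right_mono of_nat_mono) linarith+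
      \<comment> \<open>The coarse cell that contains i may begin before s, but by at most one
        coarse mesh, which the assumption on m bounds by r - s.\<close>
      moreover have "s - t (N * (i div N)) \<le> r / 2 ^ m"
      proof -
        have "s - t (N * (i div N)) = (real (n * 2 ^ m) - real (N * (i div N))) * d"
          by (simp add: sd t_def left_diff_distrib)
        also have "\<dots> \<le> real N * d"
        proof (rule mult_right_mono)
          have "n * 2 ^ m \<le> N * (i div N) + N" using jN False by linarith
          then show "real (n * 2 ^ m) - real (N * (i div N)) \<le> real N"
            by (metis diff_le_eq of_nat_add of_nat_mono add.commute)
        qed (use d in simp)
        also have "\<dots> = r / 2 ^ m" by (simp add: r_def d_def)
        finally show ?thesis .
      qed
      ultimately have "\<bar>t (N * (i div N)) - s\<bar> \<le> r - s"
        using m[folded r_def s_def] by linarith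
      then show ?thesis
        using that(3) sp tN sU False by (force simp: osc_def g0_def c_def)
    qed
    then have "g i \<omega> = g0 i \<omega>" using that(1) by (auto simp: g_def)
    then show "g i \<omega> * (W (t (Suc i)) \<omega> - W (t i) \<omega>) = g0 i \<omega> * (W (t (Suc i)) \<omega> - W (t i) \<omega>)"
      by simp
  qed simp
  let ?A = "\<lambda>s. {\<omega>\<in>space M. \<epsilon> / 2 < \<bar>ito_sum \<sigma> W X s m \<omega> - (X s \<omega> - \<xi> - drift s \<omega>)\<bar>}"
  have Am: "?A v \<in> events" if "0 \<le> v" for v
    using that by (intro borel_measurable_less borel_measurable_abs borel_measurable_diff
      ito_sum_measurable X_measurable drift_measurable) auto
  have oscm: "osc M Y U \<delta> \<eta> \<in> events" for \<delta> \<eta>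
    unfolding Y_def
    using U by (intro osc_sets measurable_compose[OF X_measurable \<sigma>_borel]) auto
  have Zs: "{\<omega> \<in> space M. \<epsilon> \<le> \<bar>Z \<omega>\<bar>} \<in> events"
    using Zm by (intro borel_measurable_le borel_measurable_abs) auto
  \<comment> \<open>On \<open>E\<close> and off both oscillation events the truncations are
    inactive, so \<open>Z\<close> is the true sum. Off all five events the residual is then at most
    \<epsilon> from \<open>Z\<close> plus \<epsilon> / 2 from each Ito error.\<close>
  have "{\<omega> \<in> E. 2 * \<epsilon> < \<bar>residual s r \<omega>\<bar>} \<subseteq>
     osc M Y U (r / 2 ^ m) \<theta>1 \<union> (E \<inter> osc M Y U (r - s) \<theta>) \<union> {\<omega> \<in> space M. \<epsilon> \<le> \<bar>Z \<omega>\<bar>} \<union> ?A r \<union> ?A s"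
  proof
    fix \<omega> assume \<omega>: "\<omega> \<in> {\<omega> \<in> E. 2 * \<epsilon> < \<bar>residual s r \<omega>\<bar>}"
    then have sp: "\<omega> \<in> space M" using sets.sets_into_space[OF EM] by auto
    show "\<omega> \<in> osc M Y U (r / 2 ^ m) \<theta>1 \<union> (E \<inter> osc M Y U (r - s) \<theta>) \<union> {\<omega> \<in> space M. \<epsilon> \<le> \<bar>Z \<omega>\<bar>} \<union> ?A r \<union> ?A s"
    proof (rule ccontr)
      assume neg: "\<not> ?thesis"
      then have "Z \<omega> = ?Sg \<omega>" using \<omega> by (intro Zeq) auto
      moreover have "\<bar>Z \<omega>\<bar> < \<epsilon>"
        "\<bar>ito_sum \<sigma> W X r m \<omega> - (X r \<omega> - \<xi> - drift r \<omega>)\<bar> \<le> \<epsilon> / 2"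
        "\<bar>ito_sum \<sigma> W X s m \<omega> - (X s \<omega> - \<xi> - drift s \<omega>)\<bar> \<le> \<epsilon> / 2"
        using neg sp by auto
      moreover have "residual s r \<omega> = ?Sg \<omega> - (ito_sum \<sigma> W X r m \<omega> - (X r \<omega> - \<xi> - drift r \<omega>))
          + (ito_sum \<sigma> W X s m \<omega> - (X s \<omega> - \<xi> - drift s \<omega>))"
        using Sg[of \<omega>] by (simp add: residual_def Y_def)
      moreover have "2 * \<epsilon> < \<bar>residual s r \<omega>\<bar>" using \<omega> by simp
      ultimately show False by linarith
    qed
  qed
  then have "prob {\<omega> \<in> E. 2 * \<epsilon> < \<bar>residual s r \<omega>\<bar>} \<le> prob (osc M Y U (r / 2 ^ m) \<theta>1) + prob (E \<inter> osc M Y U (r - s) \<theta>)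
     + prob {\<omega> \<in> space M. \<epsilon> \<le> \<bar>Z \<omega>\<bar>} + prob (?A r) + prob (?A s)"
    using EM oscm Zs Am s0 r0 by (intro measure_Un5_le) auto
  moreover have "prob {\<omega> \<in> space M. \<epsilon> \<le> \<bar>Z \<omega>\<bar>} \<le> expectation (\<lambda>\<omega>. (Z \<omega>)\<^sup>2) / \<epsilon>\<^sup>2"
    using iso \<epsilon> Zm by (intro second_moment_method) auto
  moreover have "\<dots> \<le> (\<theta>1\<^sup>2 * s + \<theta>\<^sup>2 * (r - s) * prob E) / \<epsilon>\<^sup>2"
    using EZ by (intro divide_right_mono) auto
  ultimately show ?thesis by linarith
qed

text \<open>For fixed \<theta>1 the limit in m removes the fine oscillation and both Ito errors;
  then \<theta>1 tends to 0, which removes the contribution of the times before s. What remains is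
  localised to \<open>E\<close> and substitutes for a conditional Chebyshev inequality.\<close>

lemma residual_bound:
  fixes u :: real and n N :: nat
  assumes u: "0 < u" and nN: "n < N" and E: "E \<in> sets (filt (real n * u))"
    and \<theta>: "0 < \<theta>" and \<epsilon>: "0 < \<epsilon>"
    and U: "countable U" "U \<subseteq> {0..K}" "\<And>i m. i \<le> N * 2 ^ m \<Longrightarrow> real i * (u / 2 ^ m) \<in> U"
  defines "s \<equiv> real n * u" and "r \<equiv> real N * u" and "Y \<equiv> \<lambda>v \<omega>. \<sigma> (X v \<omega>)"
  shows "prob {\<omega> \<in> E. 2 * \<epsilon> < \<bar>residual s r \<omega>\<bar>} \<le>
     prob (E \<inter> osc M Y U (r - s) \<theta>) + \<theta>\<^sup>2 * (r - s) * prob E / \<epsilon>\<^sup>2"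
proof -
  have s0: "0 \<le> s" and r0: "0 \<le> r" using u by (auto simp: s_def r_def)
  let ?A = "\<lambda>s m. prob {\<omega>\<in>space M. \<epsilon> / 2 < \<bar>ito_sum \<sigma> W X s m \<omega> - (X s \<omega> - \<xi> - drift s \<omega>)\<bar>}"
  have lim0: "(\<lambda>m. r / 2 ^ m) \<longlonglongrightarrow> 0"
    using tendsto_mult_right_zero[OF LIMSEQ_realpow_zero[of "1/2"], of r] by (simp add: power_divide)
  have le: "prob {\<omega> \<in> E. 2 * \<epsilon> < \<bar>residual s r \<omega>\<bar>} \<le>
      prob (E \<inter> osc M Y U (r - s) \<theta>) + (\<theta>1\<^sup>2 * s + \<theta>\<^sup>2 * (r - s) * prob E) / \<epsilon>\<^sup>2" if \<theta>1: "0 < \<theta>1" for \<theta>1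
  proof (rule tendsto_lowerbound)
    have "(\<lambda>m. prob (osc M Y U (r / 2 ^ m) \<theta>1)) \<longlonglongrightarrow> 0"
      unfolding Y_def
      using U(2) by (intro prob_osc_tendsto_0[OF U(1,2) _ _ \<theta>1 lim0] \<sigma>X_cont measurable_compose[OF X_measurable \<sigma>_borel]) auto
    then have "(\<lambda>m. prob (osc M Y U (r / 2 ^ m) \<theta>1) + prob (E \<inter> osc M Y U (r - s) \<theta>)
        + (\<theta>1\<^sup>2 * s + \<theta>\<^sup>2 * (r - s) * prob E) / \<epsilon>\<^sup>2 + ?A r m + ?A s m) \<longlonglongrightarrow>
        0 + prob (E \<inter> osc M Y U (r - s) \<theta>) + (\<theta>1\<^sup>2 * s + \<theta>\<^sup>2 * (r - s) * prob E) / \<epsilon>\<^sup>2 + 0 + 0"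
      using \<epsilon> s0 r0 by (intro tendsto_add tendsto_const ito_error_tendsto) auto
    then show "(\<lambda>m. prob (osc M Y U (r / 2 ^ m) \<theta>1) + prob (E \<inter> osc M Y U (r - s) \<theta>)
        + (\<theta>1\<^sup>2 * s + \<theta>\<^sup>2 * (r - s) * prob E) / \<epsilon>\<^sup>2 + ?A r m + ?A s m) \<longlonglongrightarrow>
        prob (E \<inter> osc M Y U (r - s) \<theta>) + (\<theta>1\<^sup>2 * s + \<theta>\<^sup>2 * (r - s) * prob E) / \<epsilon>\<^sup>2"
      by simp
    have "0 < r - s" using u nN by (simp add: r_def s_def)
    then have "\<forall>\<^sub>F m in sequentially. r / 2 ^ m < r - s"
      by (rule order_tendstoD[OF lim0])
    then show "\<forall>\<^sub>F m in sequentially. prob {\<omega> \<in> E. 2 * \<epsilon> < \<bar>residual s r \<omega>\<bar>} \<le>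
        prob (osc M Y U (r / 2 ^ m) \<theta>1) + prob (E \<inter> osc M Y U (r - s) \<theta>)
        + (\<theta>1\<^sup>2 * s + \<theta>\<^sup>2 * (r - s) * prob E) / \<epsilon>\<^sup>2 + ?A r m + ?A s m"
    proof eventually_elim
      case (elim m)
      then show ?case
        unfolding r_def s_def Y_def
        using U(2) by (intro residual_bound_aux[OF u nN E \<theta> \<theta>1 \<epsilon> U(1) _ U(3)]) auto
    qed
  qed auto
  show ?thesis
  proof (rule tendsto_lowerbound)
    have "(\<lambda>j. prob (E \<inter> osc M Y U (r - s) \<theta>) + ((inverse (real (Suc j)))\<^sup>2 * s + \<theta>\<^sup>2 * (r - s) * prob E) / \<epsilon>\<^sup>2)
        \<longlonglongrightarrow> prob (E \<inter> osc M Y U (r - s) \<theta>) + (0\<^sup>2 * s + \<theta>\<^sup>2 * (r - s) * prob E) / \<epsilon>\<^sup>2"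
      using \<epsilon> by (intro tendsto_intros LIMSEQ_inverse_real_of_nat) auto
    then show "(\<lambda>j. prob (E \<inter> osc M Y U (r - s) \<theta>) + ((inverse (real (Suc j)))\<^sup>2 * s + \<theta>\<^sup>2 * (r - s) * prob E) / \<epsilon>\<^sup>2)
        \<longlonglongrightarrow> prob (E \<inter> osc M Y U (r - s) \<theta>) + \<theta>\<^sup>2 * (r - s) * prob E / \<epsilon>\<^sup>2"
      by simp
    show "\<forall>\<^sub>F j in sequentially. prob {\<omega> \<in> E. 2 * \<epsilon> < \<bar>residual s r \<omega>\<bar>} \<le>
      prob (E \<inter> osc M Y U (r - s) \<theta>) + ((inverse (real (Suc j)))\<^sup>2 * s + \<theta>\<^sup>2 * (r - s) * prob E) / \<epsilon>\<^sup>2"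
      by (intro always_eventually allI le) auto
  qed auto
qed

lemma \<sigma>_lower_bound: "\<exists>\<sigma>0>0. \<forall>x. \<bar>x - c\<bar> \<le> 1 \<longrightarrow> \<sigma>0 \<le> \<sigma> x"
proof -
  have "\<exists>x\<in>{c - 1..c + 1}. \<forall>y\<in>{c - 1..c + 1}. \<sigma> x \<le> \<sigma> y"
    by (intro continuous_attains_inf continuous_on_subset[OF \<sigma>_cont]) auto
  then obtain x where x: "\<forall>y\<in>{c - 1..c + 1}. \<sigma> x \<le> \<sigma> y" by blast
  have "\<sigma> x \<le> \<sigma> y" if "\<bar>y - c\<bar> \<le> 1" for y
    using that by (intro x[rule_format]) (simp add: abs_le_iff)
  then show ?thesis using \<sigma>_pos by blast
qed

text \<open>With X_s frozen at v, the event confines the increment of \<open>W\<close> to an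
  interval of length 6 \<eta> sqrt (r - s) / \<sigma>(v). The density is at most 1 / sqrt (r - s),
  so the time step cancels. The factor 3 in the radius adds the tolerances for the residual (two)
  and the drift (one).\<close>

lemma small_ball_le:
  assumes s: "0 \<le> s" "s < r" and \<sigma>0: "0 < \<sigma>0" "\<And>x. \<bar>x - c\<bar> \<le> 1 \<Longrightarrow> \<sigma>0 \<le> \<sigma> x" and \<eta>: "0 < \<eta>"
  shows "prob {\<omega> \<in> space M. \<bar>X s \<omega> - c\<bar> \<le> 1 \<and> \<bar>c - X s \<omega> - \<sigma> (X s \<omega>) * (W r \<omega> - W s \<omega>)\<bar> \<le> 3 * (\<eta> * sqrt (r - s))}
    \<le> 6 * \<eta> / \<sigma>0"
proof -
  let ?\<epsilon> = "\<eta> * sqrt (r - s)"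
  define Q where "Q = {p. \<bar>fst p - c\<bar> \<le> 1 \<and> \<bar>c - fst p - \<sigma> (fst p) * snd p\<bar> \<le> 3 * ?\<epsilon>}"
  have pos: "0 < sqrt (r - s)" using s by simp
  have "{p \<in> space (borel \<Otimes>\<^sub>M borel). \<bar>fst p - c\<bar> \<le> 1 \<and> \<bar>c - fst p - \<sigma> (fst p) * snd p\<bar> \<le> 3 * ?\<epsilon>} \<in> sets (borel \<Otimes>\<^sub>M borel)"
    by measurable
  then have Q: "Q \<in> sets (borel \<Otimes>\<^sub>M borel)"
    by (simp add: Q_def space_pair_measure)
  have "prob {\<omega> \<in> space M. (X s \<omega>, W r \<omega> - W s \<omega>) \<in> Q} \<le> 6 * \<eta> / \<sigma>0"
  proof (rule indep_var_prob_le[OF filt_indep_increment[OF X_measurable_filt[OF s(1) order_refl] s] Q])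
    fix v
    show "prob {\<omega> \<in> space M. (v, W r \<omega> - W s \<omega>) \<in> Q} \<le> 6 * \<eta> / \<sigma>0"
    proof (cases "\<bar>v - c\<bar> \<le> 1")
      case True
      let ?l = "(c - v - 3 * ?\<epsilon>) / \<sigma> v" and ?h = "(c - v + 3 * ?\<epsilon>) / \<sigma> v"
      have sv: "\<sigma>0 \<le> \<sigma> v" "0 < \<sigma> v" using \<sigma>0 True \<sigma>_pos by auto
      have "prob {\<omega> \<in> space M. (v, W r \<omega> - W s \<omega>) \<in> Q} \<le> prob {\<omega> \<in> space M. W r \<omega> - W s \<omega> \<in> {?l..?h}}"
      proof (rule finite_measure_mono)
        show "{\<omega> \<in> space M. (v, W r \<omega> - W s \<omega>) \<in> Q} \<subseteq> {\<omega> \<in> space M. W r \<omega> - W s \<omega> \<in> {?l..?h}}"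
        proof clarify
          fix \<omega> assume "(v, W r \<omega> - W s \<omega>) \<in> Q"
          then have "\<bar>c - v - \<sigma> v * (W r \<omega> - W s \<omega>)\<bar> \<le> 3 * ?\<epsilon>" by (simp add: Q_def)
          then have "c - v - 3 * ?\<epsilon> \<le> (W r \<omega> - W s \<omega>) * \<sigma> v" "(W r \<omega> - W s \<omega>) * \<sigma> v \<le> c - v + 3 * ?\<epsilon>"
            unfolding mult.commute[of "\<sigma> v"] by linarith+
          then show "W r \<omega> - W s \<omega> \<in> {?l..?h}"
            using sv(2) by (simp add: pos_divide_le_eq pos_le_divide_eq)
        qed
        have [measurable]: "random_variable borel (W r)" "random_variable borel (W s)"
          using s by (auto intro: W_measurable)
        show "{\<omega> \<in> space M. W r \<omega> - W s \<omega> \<in> {?l..?h}} \<in> events" by measurable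
      qed
      also have "\<dots> \<le> (?h - ?l) / sqrt (r - s)"
        using \<eta> pos sv(2) by (intro increment_interval_le s divide_right_mono) auto
      also have "?h - ?l = 6 * ?\<epsilon> / \<sigma> v" by (simp add: diff_divide_distrib[symmetric])
      also have "6 * ?\<epsilon> / \<sigma> v / sqrt (r - s) = 6 * \<eta> / \<sigma> v" using pos by simp
      also have "\<dots> \<le> 6 * \<eta> / \<sigma>0" using sv \<sigma>0(1) \<eta> by (intro divide_left_mono) auto
      finally show ?thesis .
    next
      case False
      then show ?thesis using \<eta> \<sigma>0 by (simp add: Q_def)
    qed
  qed
  then show ?thesis by (simp add: Q_def)
qed

lemma drift_small:
  assumes "0 \<le> s" "s < r" "\<beta> * sqrt (r - s) \<le> \<eta>" "\<omega> \<in> space M"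
  shows "\<bar>drift r \<omega> - drift s \<omega>\<bar> \<le> \<eta> * sqrt (r - s)"
proof -
  have "\<bar>drift r \<omega> - drift s \<omega>\<bar> \<le> \<beta> * (r - s)" using assms by (intro drift_diff_le) auto
  also have "\<dots> = \<beta> * sqrt (r - s) * sqrt (r - s)" using assms by simp
  also have "\<dots> \<le> \<eta> * sqrt (r - s)" using assms by (intro mult_right_mono) auto
  finally show ?thesis .
qed

text \<open>Over the last step before t, of length t / (j + 1), X_t = c forces \<sigma>(X_s)
  \<Delta>W to be close to c - X_s on the scale \<eta> sqrt (t - s), unless the residual is large or
  X_s is far from c. As j grows, \<theta>^2 / \<eta>^2 + 6 \<eta> / \<sigma>0 is left as a bound,
  and this can be made arbitrarily small.\<close>

lemma X_no_atom:
  assumes t: "0 < t"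
  shows "prob {\<omega> \<in> space M. X t \<omega> = c} = 0"
proof -
  let ?A = "{\<omega> \<in> space M. X t \<omega> = c}"
  obtain \<sigma>0 where \<sigma>0: "0 < \<sigma>0" "\<And>x. \<bar>x - c\<bar> \<le> 1 \<Longrightarrow> \<sigma>0 \<le> \<sigma> x" using \<sigma>_lower_bound[of c] by blast
  define u where "u j = t / real (Suc j)" for j
  define s where "s j = real j * u j" for j
  have r: "real (Suc j) * u j = t" for j by (simp add: u_def)
  have u0: "0 < u j" for j using t by (simp add: u_def)
  have s0: "0 \<le> s j" "s j < t" and H: "t - s j = u j" for j
    using u0[of j] r[of j] by (auto simp: s_def algebra_simps)
  have ulim: "u \<longlonglongrightarrow> 0"
    using tendsto_mult_right_zero[OF LIMSEQ_inverse_real_of_nat, of t] by (simp add: u_def[abs_def] divide_inverse)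
  have slim: "s \<longlonglongrightarrow> t"
    using tendsto_diff[OF tendsto_const ulim, of t] by (simp add: H[symmetric])
  \<comment> \<open>Rational multiples of t form a countable set that contains the grids for all j
    and m at once, even if t is irrational.\<close>
  define U where "U = (\<lambda>q. t * q) ` (\<rat> \<inter> {0..1})"
  have U: "countable U" "U \<subseteq> {0..t}"
    using t by (auto simp: U_def countable_rat mult_left_le intro!: countable_image countable_Int1)
  have UI: "real i * (u j / 2 ^ m) \<in> U" if "i \<le> Suc j * 2 ^ m" for i j m
  proof -
    have "real i \<le> real (Suc j * 2 ^ m)" using that by (rule of_nat_mono)
    then have "real i \<le> real (Suc j) * 2 ^ m" by (simp only: of_nat_mult of_nat_power of_nat_numeral)
    moreover have "0 < real (Suc j) * 2 ^ m" by simp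
    ultimately have "real i / (real (Suc j) * 2 ^ m) \<le> 1" by (simp only: divide_le_eq_1_pos)
    then have "real i / (real (Suc j) * 2 ^ m) \<in> \<rat> \<inter> {0..1}" by (simp del: of_nat_Suc)
    moreover have "real i * (u j / 2 ^ m) = t * (real i / (real (Suc j) * 2 ^ m))"
      by (simp add: u_def field_simps del: of_nat_Suc)
    ultimately show ?thesis unfolding U_def by blast
  qed
  let ?Y = "\<lambda>v \<omega>. \<sigma> (X v \<omega>)"
  have Xt [measurable]: "random_variable borel (X t)" "random_variable borel (X (s j))" for j
    using t s0(1) by (auto intro: X_measurable)
  have Wt [measurable]: "random_variable borel (W t)" "random_variable borel (W (s j))" for j
    using t s0(1) by (auto intro: W_measurable)
  let ?P = "\<lambda>j. {\<omega> \<in> space M. X t \<omega> = c \<and> \<not> \<bar>X (s j) \<omega> - c\<bar> \<le> 1}"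
  have Plim: "(\<lambda>j. prob (?P j)) \<longlonglongrightarrow> 0"
  proof -
    have "(\<lambda>j. prob (?P j)) \<longlonglongrightarrow> prob {}"
    proof (rule prob_tendsto_of_eventually)
      show "AE \<omega> in M. \<forall>\<^sub>F j in sequentially. \<omega> \<in> ?P j \<longleftrightarrow> \<omega> \<in> {}"
      proof (rule AE_I2)
        fix \<omega> assume \<omega>: "\<omega> \<in> space M"
        have "(\<lambda>j. X (s j) \<omega>) \<longlonglongrightarrow> X t \<omega>"
          using t s0(1) by (intro continuous_on_tendsto_compose[OF X_cont[OF \<omega>] slim]) auto
        then have "\<forall>\<^sub>F j in sequentially. dist (X (s j) \<omega>) (X t \<omega>) < 1"
          by (rule tendstoD) simp
        then show "\<forall>\<^sub>F j in sequentially. \<omega> \<in> ?P j \<longleftrightarrow> \<omega> \<in> {}"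
          by eventually_elim (auto simp: dist_real_def)
      qed
      show "?P j \<in> events" for j by measurable
    qed simp
    then show ?thesis by simp
  qed
  have osclim: "(\<lambda>j. prob (osc M ?Y U (u j) \<theta>)) \<longlonglongrightarrow> 0" if "0 < \<theta>" for \<theta>
    using U(2) by (intro prob_osc_tendsto_0[OF U _ _ that ulim] \<sigma>X_cont measurable_compose[OF X_measurable \<sigma>_borel]) auto
  have oscm: "osc M ?Y U \<delta> \<theta> \<in> events" for \<delta> \<theta>
    using U by (intro osc_sets measurable_compose[OF X_measurable \<sigma>_borel]) auto
  have main: "prob ?A \<le> \<theta>\<^sup>2 / \<eta>\<^sup>2 + 6 * \<eta> / \<sigma>0" if \<eta>: "0 < \<eta>" and \<theta>: "0 < \<theta>" for \<eta> \<theta>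
  proof (rule tendsto_lowerbound)
    have "(\<lambda>j. prob (?P j) + prob (osc M ?Y U (u j) \<theta>) + \<theta>\<^sup>2 / \<eta>\<^sup>2 + 6 * \<eta> / \<sigma>0) \<longlonglongrightarrow> 0 + 0 + \<theta>\<^sup>2 / \<eta>\<^sup>2 + 6 * \<eta> / \<sigma>0"
      by (intro tendsto_add tendsto_const Plim osclim \<theta>)
    then show "(\<lambda>j. prob (?P j) + prob (osc M ?Y U (u j) \<theta>) + \<theta>\<^sup>2 / \<eta>\<^sup>2 + 6 * \<eta> / \<sigma>0) \<longlonglongrightarrow> \<theta>\<^sup>2 / \<eta>\<^sup>2 + 6 * \<eta> / \<sigma>0"
      by simp
    have "(\<lambda>j. \<beta> * sqrt (u j)) \<longlonglongrightarrow> \<beta> * sqrt 0"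
      by (intro tendsto_intros ulim)
    then have "\<forall>\<^sub>F j in sequentially. \<beta> * sqrt (u j) < \<eta>"
      using \<eta> by (intro order_tendstoD) auto
    then show "\<forall>\<^sub>F j in sequentially. prob ?A \<le> prob (?P j) + prob (osc M ?Y U (u j) \<theta>) + \<theta>\<^sup>2 / \<eta>\<^sup>2 + 6 * \<eta> / \<sigma>0"
    proof eventually_elim
      case (elim j)
      define \<epsilon> where "\<epsilon> = \<eta> * sqrt (u j)"
      have \<epsilon>: "0 < \<epsilon>" using \<eta> u0 by (simp add: \<epsilon>_def)
      define E where "E = {\<omega> \<in> space M. \<bar>X (s j) \<omega> - c\<bar> \<le> 1}"
      have E: "E \<in> sets (filt (s j))"
      proof -
        have [measurable]: "X (s j) \<in> borel_measurable (filt (s j))"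
          using s0(1) by (intro X_measurable_filt) auto
        have "{\<omega> \<in> space (filt (s j)). \<bar>X (s j) \<omega> - c\<bar> \<le> 1} \<in> sets (filt (s j))"
          by measurable
        then show ?thesis by (simp add: E_def)
      qed
      have EM: "E \<in> events" using sets_filt_events[OF s0(1) E] .
      let ?R = "{\<omega> \<in> E. 2 * \<epsilon> < \<bar>residual (s j) t \<omega>\<bar>}"
      let ?B = "{\<omega> \<in> space M. \<bar>X (s j) \<omega> - c\<bar> \<le> 1 \<and> \<bar>c - X (s j) \<omega> - \<sigma> (X (s j) \<omega>) * (W t \<omega> - W (s j) \<omega>)\<bar> \<le> 3 * \<epsilon>}"
      have [measurable]: "random_variable borel (residual (s j) t)"
        using s0 t by (intro residual_measurable) auto
      have Rm: "?R \<in> events" using EM by measurable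
      have Pm: "?P j \<in> events" by measurable
      have Bm: "?B \<in> events" by measurable
      have "?A \<subseteq> ?P j \<union> ?R \<union> ?B"
      proof
        fix \<omega> assume \<omega>: "\<omega> \<in> ?A"
        then have "\<bar>drift t \<omega> - drift (s j) \<omega>\<bar> \<le> \<epsilon>"
          using drift_small[OF s0[of j], of \<eta> \<omega>] elim by (auto simp: \<epsilon>_def H)
        then show "\<omega> \<in> ?P j \<union> ?R \<union> ?B"
          using \<omega> by (cases "2 * \<epsilon> < \<bar>residual (s j) t \<omega>\<bar>") (auto simp: E_def residual_def)
      qed
      then have "prob ?A \<le> prob (?P j \<union> ?R \<union> ?B)"
        using Rm Pm Bm by (intro finite_measure_mono sets.Un)
      also have "\<dots> \<le> prob (?P j \<union> ?R) + prob ?B"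
        using Rm Pm Bm by (intro measure_Un_le sets.Un)
      also have "prob (?P j \<union> ?R) \<le> prob (?P j) + prob ?R"
        using Rm Pm Bm by (intro measure_Un_le sets.Un)
      also have "prob ?B \<le> 6 * \<eta> / \<sigma>0"
        using small_ball_le[OF s0[of j] \<sigma>0 \<eta>] by (simp add: H \<epsilon>_def)
      also have "prob ?R \<le> prob (osc M ?Y U (u j) \<theta>) + \<theta>\<^sup>2 / \<eta>\<^sup>2"
      proof -
        have "prob ?R \<le> prob (E \<inter> osc M ?Y U (t - s j) \<theta>) + \<theta>\<^sup>2 * (t - s j) * prob E / \<epsilon>\<^sup>2"
          using residual_bound[OF u0[of j] lessI[of j] E[unfolded s_def] \<theta> \<epsilon> U UI]
          unfolding s_def r .
        also have "prob (E \<inter> osc M ?Y U (t - s j) \<theta>) \<le> prob (osc M ?Y U (u j) \<theta>)"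
          unfolding H using oscm by (intro finite_measure_mono) auto
        also have "\<theta>\<^sup>2 * (t - s j) * prob E / \<epsilon>\<^sup>2 = \<theta>\<^sup>2 / \<eta>\<^sup>2 * prob E"
          unfolding H using u0[of j] by (simp add: \<epsilon>_def power_mult_distrib)
        also have "\<dots> \<le> \<theta>\<^sup>2 / \<eta>\<^sup>2"
          using mult_left_mono[of "prob E" 1 "\<theta>\<^sup>2 / \<eta>\<^sup>2"] by simp
        finally show ?thesis by simp
      qed
      finally show ?case by simp
    qed
  qed simp
  have "prob ?A \<le> 0"
  proof (rule tendsto_lowerbound)
    have "(\<lambda>j. (inverse (real (Suc j)))\<^sup>2 + 6 * inverse (real (Suc j)) / \<sigma>0) \<longlonglongrightarrow> 0\<^sup>2 + 6 * 0 / \<sigma>0"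
      using \<sigma>0 by (intro tendsto_intros LIMSEQ_inverse_real_of_nat) auto
    then show "(\<lambda>j. (inverse (real (Suc j)))\<^sup>2 + 6 * inverse (real (Suc j)) / \<sigma>0) \<longlonglongrightarrow> 0" by simp
    show "\<forall>\<^sub>F j in sequentially. prob ?A \<le> (inverse (real (Suc j)))\<^sup>2 + 6 * inverse (real (Suc j)) / \<sigma>0"
    proof (intro always_eventually allI)
      fix j
      let ?\<eta> = "inverse (real (Suc j))"
      \<comment> \<open>The choice \<theta> = \<eta>^2 makes both terms of the bound vanish with
        \<eta>.\<close>
      have "prob ?A \<le> (?\<eta>\<^sup>2)\<^sup>2 / ?\<eta>\<^sup>2 + 6 * ?\<eta> / \<sigma>0" by (intro main) auto
      also have "(?\<eta>\<^sup>2)\<^sup>2 / ?\<eta>\<^sup>2 = ?\<eta>\<^sup>2" by (simp add: power2_eq_square)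
      finally show "prob ?A \<le> ?\<eta>\<^sup>2 + 6 * ?\<eta> / \<sigma>0" .
    qed
  qed simp
  then show ?thesis using measure_nonneg[of M ?A] by linarith
qed

section \<open>No touching extrema\<close>

text \<open>For $e = 1$: $X$ first reaches $c$ after $a$ between the grid times $(k-1)/2^j$ and $k/2^j$, and
  does not exceed $c$ on $[a, k/2^j]$; $e = -1$ is the mirror image. The events for distinct $k$ are
  disjoint, and each lies in the past of $k/2^j$.\<close>

definition touch :: "real \<Rightarrow> real \<Rightarrow> real \<Rightarrow> nat \<Rightarrow> nat \<Rightarrow> 'a set" where
  "touch e a c j k = {\<omega> \<in> space M. (\<exists>v\<in>{a..<real k / 2 ^ j}. X v \<omega> \<in> {c}) \<and>
     \<not> (\<exists>v\<in>{a..real k / 2 ^ j}. e * X v \<omega> \<in> {e * c<..}) \<and>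
     \<not> (\<exists>v\<in>{a..<(real k - 1) / 2 ^ j}. X v \<omega> \<in> {c})}"

lemma touch_filt:
  assumes "0 \<le> a"
  shows "touch e a c j k \<in> sets (filt (real k / 2 ^ j))"
proof -
  let ?s = "real k / 2 ^ j"
  let ?N = "filt ?s"
  have sub: "(real k - 1) / 2 ^ j \<le> ?s" by (intro divide_right_mono) auto
  have m: "X v \<in> borel_measurable ?N" if "a \<le> v" "v \<le> ?s" for v
    using that assms by (intro X_measurable_filt) auto
  have c: "continuous_on C (\<lambda>v. X v \<omega>)" if "C \<subseteq> {a..}" "\<omega> \<in> space ?N" for C \<omega>
    using that assms by (intro continuous_on_subset[OF X_cont]) auto
  have h: "{\<omega> \<in> space ?N. \<exists>v\<in>{a..<w}. X v \<omega> \<in> {c}} \<in> sets ?N" if "w \<le> ?s" for w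
    using that by (intro fsigma_hit_sets fsigma_atLeastLessThan closed_imp_fsigma m c) auto
  have h2: "{\<omega> \<in> space ?N. \<exists>v\<in>{a..?s}. e * X v \<omega> \<in> {e * c<..}} \<in> sets ?N"
    by (intro fsigma_hit_sets closed_imp_fsigma open_imp_fsigma borel_measurable_times borel_measurable_const
        continuous_on_mult continuous_on_const m c) auto
  have "touch e a c j k = {\<omega> \<in> space ?N. \<exists>v\<in>{a..<?s}. X v \<omega> \<in> {c}} -
     {\<omega> \<in> space ?N. \<exists>v\<in>{a..?s}. e * X v \<omega> \<in> {e * c<..}} -
     {\<omega> \<in> space ?N. \<exists>v\<in>{a..<(real k - 1) / 2 ^ j}. X v \<omega> \<in> {c}}"
    by (auto simp: touch_def)
  also have "\<dots> \<in> sets ?N" using h[of ?s] h2 h[OF sub] by auto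
  finally show ?thesis .
qed

lemma touch_events: "0 \<le> a \<Longrightarrow> touch e a c j k \<in> events"
  by (rule sets_filt_events[OF _ touch_filt]) auto

lemma touch_disjoint: "disjoint_family_on (touch e a c j) S"
proof -
  have *: "touch e a c j k \<inter> touch e a c j k' = {}" if "k < k'" for k k'
  proof -
    have "real k \<le> real k' - 1" using that by linarith
    then have "real k / 2 ^ j \<le> (real k' - 1) / 2 ^ j" by (intro divide_right_mono) auto
    then show ?thesis by (fastforce simp: touch_def)
  qed
  show ?thesis
    unfolding disjoint_family_on_def
  proof (intro ballI impI)
    fix k k' :: nat assume "k \<noteq> k'"
    then show "touch e a c j k \<inter> touch e a c j k' = {}"
      using *[of k k'] *[of k' k] by (cases "k < k'") auto
  qed
qed

text \<open>\<open>v\<close> need not be the first visit, so the least grid index preceded by a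
  visit is taken; its time is at most v + 2^-j. As the bound on X is assumed from \<open>a\<close>
  on, it holds up to that grid time and for a further 2^-l, which ends no later than v +
  \<delta>.\<close>

lemma touch_exists:
  assumes a: "0 \<le> a" and \<omega>: "\<omega> \<in> space M" and v: "a \<le> v" "v < real K" "X v \<omega> = c"
    and below: "\<And>w. a \<le> w \<Longrightarrow> w \<le> v + \<delta> \<Longrightarrow> e * X w \<omega> \<le> e * c"
    and jl: "1 / 2 ^ j + 1 / 2 ^ l \<le> \<delta>"
  shows "\<exists>k\<le>K * 2 ^ j. \<omega> \<in> touch e a c j k \<and> e * X (real k / 2 ^ j + 1 / 2 ^ l) \<omega> \<le> e * c"
proof -
  define P where "P k \<longleftrightarrow> (\<exists>v\<in>{a..<real k / 2 ^ j}. X v \<omega> = c)" for k :: nat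
  \<comment> \<open>Floor plus one gives a grid time strictly after v even if v lies on the grid, as
    the half-open windows demand.\<close>
  define k' where "k' = nat \<lfloor>v * 2 ^ j\<rfloor> + 1"
  have v0: "0 \<le> v * 2 ^ j" using a v by simp
  have rk': "real k' = real_of_int \<lfloor>v * 2 ^ j\<rfloor> + 1" using v0 by (simp add: k'_def)
  have k'1: "v < real k' / 2 ^ j" and k'2: "real k' / 2 ^ j \<le> v + 1 / 2 ^ j"
  proof -
    have "v * 2 ^ j < real k'" using rk' by linarith
    then show "v < real k' / 2 ^ j" by (simp add: pos_less_divide_eq)
    have "real k' \<le> v * 2 ^ j + 1" using rk' by linarith
    then have "real k' / 2 ^ j \<le> (v * 2 ^ j + 1) / 2 ^ j" by (rule divide_right_mono) simp
    then show "real k' / 2 ^ j \<le> v + 1 / 2 ^ j" by (simp add: add_divide_distrib)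
  qed
  have k'K: "k' \<le> K * 2 ^ j"
  proof -
    have "v * 2 ^ j < real K * 2 ^ j" using v by simp
    then have "v * 2 ^ j < real_of_int (int (K * 2 ^ j))" by simp
    then have "\<lfloor>v * 2 ^ j\<rfloor> < int (K * 2 ^ j)" by (simp only: floor_less_iff)
    then show ?thesis using v0 unfolding k'_def by linarith
  qed
  have P': "P k'" using v k'1 by (auto simp: P_def)
  define k where "k = (LEAST k. P k)"
  have k: "P k" "k \<le> k'" using P' by (auto simp: k_def intro: LeastI Least_le)
  have knot: "\<not> P i" if "i < k" for i using that not_less_Least by (auto simp: k_def)
  have kpos: "0 < k" using k(1) a by (cases k) (auto simp: P_def)
  have sk: "real k / 2 ^ j \<le> v + 1 / 2 ^ j"
    using k(2) k'2 divide_right_mono[of "real k" "real k'" "2 ^ j"] by simp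
  have ask: "a < real k / 2 ^ j" using k(1) by (auto simp: P_def)
  have l: "0 < 1 / (2::real) ^ l" by simp
  have "\<not> (\<exists>v\<in>{a..<(real k - 1) / 2 ^ j}. X v \<omega> = c)"
    using knot[of "k - 1"] kpos by (simp add: P_def of_nat_diff)
  moreover have "\<not> (\<exists>v\<in>{a..real k / 2 ^ j}. e * X v \<omega> \<in> {e * c<..})"
  proof clarsimp
    fix w assume w: "a \<le> w" "w \<le> real k / 2 ^ j" "e * c < e * X w \<omega>"
    have "e * X w \<omega> \<le> e * c" using w(1,2) sk jl l by (intro below) linarith+
    then show False using w(3) by simp
  qed
  ultimately have "\<omega> \<in> touch e a c j k"
    using k(1) \<omega> by (auto simp: touch_def P_def)
  moreover have "e * X (real k / 2 ^ j + 1 / 2 ^ l) \<omega> \<le> e * c"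
    using sk jl l ask by (intro below) linarith+
  ultimately show ?thesis using order_trans[OF k(2) k'K] by blast
qed

text \<open>The cell before the grid time contains a visit to c, so a gap above \<kappa> at the grid
  time is an oscillation within 2^-j. The visit may occur at an irrational time, which
  \<open>osc\<close> does not see here; a rational time just after it costs half of
  \<kappa>.\<close>

lemma touch_far_subset_osc:
  assumes a: "0 \<le> a" and \<kappa>: "0 < \<kappa>" and k: "real k / 2 ^ j \<le> L" and e: "e = 1 \<or> e = - 1"
  shows "{\<omega> \<in> touch e a c j k. e * X (real k / 2 ^ j) \<omega> < e * c - \<kappa>} \<subseteq> osc M X (\<rat> \<inter> {0..L}) (1 / 2 ^ j) (\<kappa> / 2)"
proof clarify
  fix \<omega> assume t: "\<omega> \<in> touch e a c j k" and far: "e * X (real k / 2 ^ j) \<omega> < e * c - \<kappa>"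
  let ?s = "real k / 2 ^ j"
  have \<omega>: "\<omega> \<in> space M" using t by (simp add: touch_def)
  obtain v where v: "a \<le> v" "v < ?s" "X v \<omega> = c" using t by (auto simp: touch_def)
  have v2: "(real k - 1) / 2 ^ j \<le> v"
    using t v by (auto simp: touch_def not_le[symmetric])
  have "\<exists>d>0. \<forall>w\<in>{0..}. dist w v < d \<longrightarrow> dist (X w \<omega>) (X v \<omega>) < \<kappa> / 2"
    using X_cont[OF \<omega>, unfolded continuous_on_iff, rule_format, of v "\<kappa> / 2"] \<kappa> a v(1) by auto
  then obtain d where d: "0 < d" "\<And>w. 0 \<le> w \<Longrightarrow> dist w v < d \<Longrightarrow> dist (X w \<omega>) (X v \<omega>) < \<kappa> / 2" by auto
  have "v < min ?s (v + d)" using v d by simp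
  then obtain q where q: "q \<in> \<rat>" "v < q" "q < min ?s (v + d)" using Rats_dense_in_real by blast
  have "\<bar>X q \<omega> - c\<bar> < \<kappa> / 2"
    using d(2)[of q] q a v by (auto simp: dist_real_def)
  moreover have "X ?s \<omega> < c - \<kappa> \<or> c + \<kappa> < X ?s \<omega>"
    using far e by auto
  ultimately have "\<kappa> / 2 < \<bar>X ?s \<omega> - X q \<omega>\<bar>"
    using \<kappa> by linarith
  moreover have "\<bar>?s - q\<bar> \<le> 1 / 2 ^ j"
    using v2 q by (simp add: diff_divide_distrib)
  moreover have "?s \<in> \<rat> \<inter> {0..L}" "q \<in> \<rat> \<inter> {0..L}"
    using q k a v by auto
  ultimately show "\<omega> \<in> osc M X (\<rat> \<inter> {0..L}) (1 / 2 ^ j) (\<kappa> / 2)"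
    using \<omega> unfolding osc_def by blast
qed

text \<open>If X is within \<eta> sqrt H of c at time s, not beyond c at time s + H, and the
  residual is at most 2 \<epsilon>, then the Gaussian term in direction \<open>e\<close> is at most
  4 \<epsilon> = \<sigma>0 sqrt H, so the increment of \<open>W\<close> in that direction is at most
  sqrt H. This increment is independent of the past, to which \<open>E\<close> belongs, and is that
  small with probability at most \<open>1 - escape\<close>.\<close>

lemma touch_step:
  assumes a: "0 \<le> a" and e: "e = 1 \<or> e = - 1" and lj: "l \<le> j" and kL: "real k / 2 ^ j + 1 / 2 ^ l \<le> L"
    and \<sigma>0: "0 < \<sigma>0" "\<And>x. \<bar>x - c\<bar> \<le> 1 \<Longrightarrow> \<sigma>0 \<le> \<sigma> x"
    and \<theta>: "0 < \<theta>"
  defines "H \<equiv> 1 / 2 ^ l" and "s \<equiv> real k / 2 ^ j" and "U \<equiv> \<rat> \<inter> {0..L}"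
    and "E \<equiv> touch e a c j k" and "\<eta> \<equiv> \<sigma>0 / 4"
  assumes small: "\<eta> * sqrt H \<le> 1" "\<beta> * sqrt H \<le> \<eta>"
  shows "prob {\<omega> \<in> E. e * c - \<eta> * sqrt H \<le> e * X s \<omega> \<and> e * X (s + H) \<omega> \<le> e * c} \<le>
     prob (E \<inter> osc M (\<lambda>v \<omega>. \<sigma> (X v \<omega>)) U H \<theta>) + (\<theta>\<^sup>2 / \<eta>\<^sup>2 + (1 - escape)) * prob E"
proof -
  have H: "0 < H" by (simp add: H_def)
  have s0: "0 \<le> s" by (simp add: s_def)
  have \<eta>: "0 < \<eta>" using \<sigma>0 by (simp add: \<eta>_def)
  define E' where "E' = {\<omega> \<in> E. e * c - \<eta> * sqrt H \<le> e * X s \<omega>}"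
  define \<epsilon> where "\<epsilon> = \<eta> * sqrt H"
  have \<epsilon>: "0 < \<epsilon>" using \<eta> H by (simp add: \<epsilon>_def)
  define u where "u = 1 / (2::real) ^ j"
  \<comment> \<open>The look-ahead H consists of \<open>2 ^ (j - l)\<close> grid steps, by
    \<open>l \<le> j\<close>, so s and s + H are both multiples of u.\<close>
  define N where "N = k + 2 ^ (j - l)"
  have u: "0 < u" by (simp add: u_def)
  have su: "s = real k * u" by (simp add: s_def u_def)
  have "(2::real) ^ j = 2 ^ (j - l) * 2 ^ l" using lj by (simp add: power_add[symmetric])
  then have ru: "s + H = real N * u" by (simp add: N_def u_def s_def H_def field_simps)
  have kN: "k < N" by (simp add: N_def)
  have Ef: "E \<in> sets (filt s)" unfolding E_def s_def by (rule touch_filt[OF a])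
  have E'f: "E' \<in> sets (filt s)"
  proof -
    have [measurable]: "X s \<in> borel_measurable (filt s)" using s0 by (intro X_measurable_filt) auto
    have "{\<omega> \<in> space (filt s). e * c - \<eta> * sqrt H \<le> e * X s \<omega>} \<in> sets (filt s)" by measurable
    then have "E \<inter> {\<omega> \<in> space (filt s). e * c - \<eta> * sqrt H \<le> e * X s \<omega>} \<in> sets (filt s)" using Ef by auto
    also have "E \<inter> {\<omega> \<in> space (filt s). e * c - \<eta> * sqrt H \<le> e * X s \<omega>} = E'"
      using sets.sets_into_space[OF Ef] by (auto simp: E'_def)
    finally show ?thesis .
  qed
  have EM: "E \<in> events" "E' \<in> events" using sets_filt_events s0 Ef E'f by blast+
  have E'E: "prob E' \<le> prob E" using EM by (intro finite_measure_mono) (auto simp: E'_def)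
  have U: "countable U" "U \<subseteq> {0..L}" by (auto simp: U_def countable_rat intro!: countable_Int1)
  have UI: "real i * (u / 2 ^ m) \<in> U" if "i \<le> N * 2 ^ m" for i m
  proof -
    have "real i \<le> real N * 2 ^ m" using of_nat_mono[OF that, where 'a=real] by simp
    then have "real i * (u / 2 ^ m) \<le> real N * 2 ^ m * (u / 2 ^ m)" using u by (intro mult_right_mono) auto
    also have "\<dots> = s + H" using ru by simp
    also have "\<dots> \<le> L" using kL by (simp add: s_def H_def)
    finally show ?thesis using u by (auto simp: U_def u_def)
  qed
  let ?Y = "\<lambda>v \<omega>. \<sigma> (X v \<omega>)"
  let ?R = "{\<omega> \<in> E'. 2 * \<epsilon> < \<bar>residual s (s + H) \<omega>\<bar>}"
  let ?B = "E' \<inter> ((\<lambda>\<omega>. W (s + H) \<omega> - W s \<omega>) -` {x. e * x \<le> sqrt H} \<inter> space M)"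
  have oscm: "osc M ?Y U \<delta> \<theta> \<in> events" for \<delta> \<theta>
    using U by (intro osc_sets measurable_compose[OF X_measurable \<sigma>_borel]) auto
  have [measurable]: "random_variable borel (residual s (s + H))"
    using s0 H by (intro residual_measurable) auto
  have [measurable]: "random_variable borel (W (s + H))" "random_variable borel (W s)"
    using s0 H by (auto intro!: W_measurable)
  have Rm: "?R \<in> events" using EM by measurable
  have Cb: "{x. e * x \<le> sqrt H} \<in> sets borel" by measurable
  have Bm: "?B \<in> events"
    using EM by (intro sets.Int measurable_sets[OF _ Cb]) auto
  have "{\<omega> \<in> E. e * c - \<eta> * sqrt H \<le> e * X s \<omega> \<and> e * X (s + H) \<omega> \<le> e * c} \<subseteq> ?R \<union> ?B"
  proof clarify
    fix \<omega> assume \<omega>E: "\<omega> \<in> E" and lo: "e * c - \<eta> * sqrt H \<le> e * X s \<omega>" and hi: "e * X (s + H) \<omega> \<le> e * c"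
      and nB: "\<not> \<omega> \<in> ?B"
    have \<omega>: "\<omega> \<in> space M" using \<omega>E by (simp add: E_def touch_def)
    have \<omega>E': "\<omega> \<in> E'" using \<omega>E lo by (simp add: E'_def)
    \<comment> \<open>A visit to c before s shows that [a, s] is nonempty, so the one-sided bound
      holds at s itself.\<close>
    have up: "e * X s \<omega> \<le> e * c"
    proof -
      have "a \<le> s" using \<omega>E by (auto simp: E_def touch_def s_def)
      then show ?thesis using \<omega>E unfolding E_def touch_def s_def[symmetric] by (auto simp: not_less)
    qed
    have near: "\<bar>X s \<omega> - c\<bar> \<le> 1" using up lo small(1) e by auto
    have \<sigma>: "\<sigma>0 \<le> \<sigma> (X s \<omega>)" using \<sigma>0(2)[OF near] .
    have dr: "\<bar>drift (s + H) \<omega> - drift s \<omega>\<bar> \<le> \<epsilon>"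
      using drift_small[of s "s + H" \<eta> \<omega>] s0 H small(2) \<omega> by (simp add: \<epsilon>_def)
    have gt: "sqrt H < e * (W (s + H) \<omega> - W s \<omega>)" using nB \<omega>E' \<omega> by auto
    have "2 * \<epsilon> < \<bar>residual s (s + H) \<omega>\<bar>"
    proof (rule ccontr)
      assume "\<not> ?thesis"
      then have r: "\<bar>residual s (s + H) \<omega>\<bar> \<le> 2 * \<epsilon>" by simp
      have "\<sigma>0 * sqrt H \<le> \<sigma> (X s \<omega>) * sqrt H" using \<sigma> H by (intro mult_right_mono) auto
      also have "\<dots> < \<sigma> (X s \<omega>) * (e * (W (s + H) \<omega> - W s \<omega>))"
        using gt \<sigma> \<sigma>0(1) by (intro mult_strict_left_mono) auto
      also have "\<dots> = e * (\<sigma> (X s \<omega>) * (W (s + H) \<omega> - W s \<omega>))" by simp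
      also have "\<dots> \<le> e * X (s + H) \<omega> - e * X s \<omega> + 3 * \<epsilon>"
        using r dr e by (auto simp: residual_def)
      also have "\<dots> \<le> 4 * \<epsilon>" using hi lo by (simp add: \<epsilon>_def)
      finally show False by (simp add: \<epsilon>_def \<eta>_def)
    qed
    then show "\<omega> \<in> E' \<and> 2 * \<epsilon> < \<bar>residual s (s + H) \<omega>\<bar>" using \<omega>E' by simp
  qed
  then have "prob {\<omega> \<in> E. e * c - \<eta> * sqrt H \<le> e * X s \<omega> \<and> e * X (s + H) \<omega> \<le> e * c} \<le> prob (?R \<union> ?B)"
    using Rm Bm by (intro finite_measure_mono sets.Un)
  also have "\<dots> \<le> prob ?R + prob ?B" using Rm Bm by (rule measure_Un_le)
  also have "prob ?R \<le> prob (E' \<inter> osc M ?Y U (s + H - s) \<theta>) + \<theta>\<^sup>2 * (s + H - s) * prob E' / \<epsilon>\<^sup>2"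
    unfolding ru unfolding su by (rule residual_bound[OF u kN E'f[unfolded su] \<theta> \<epsilon> U UI])
  also have "prob (E' \<inter> osc M ?Y U (s + H - s) \<theta>) \<le> prob (E \<inter> osc M ?Y U H \<theta>)"
    using oscm EM by (intro finite_measure_mono) (auto simp: E'_def)
  also have "\<theta>\<^sup>2 * (s + H - s) * prob E' / \<epsilon>\<^sup>2 = \<theta>\<^sup>2 / \<eta>\<^sup>2 * prob E'"
    using H by (simp add: \<epsilon>_def power_mult_distrib)
  also have "\<theta>\<^sup>2 / \<eta>\<^sup>2 * prob E' \<le> \<theta>\<^sup>2 / \<eta>\<^sup>2 * prob E" using E'E by (intro mult_left_mono) auto
  also have "prob ?B = prob E' * prob ((\<lambda>\<omega>. W (s + H) \<omega> - W s \<omega>) -` {x. e * x \<le> sqrt H} \<inter> space M)"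
    using E'f s0 H Cb by (intro nat_filt_indep_increment) (auto simp: sets_filt)
  also have "(\<lambda>\<omega>. W (s + H) \<omega> - W s \<omega>) -` {x. e * x \<le> sqrt H} \<inter> space M =
      {\<omega> \<in> space M. e * (W (s + H) \<omega> - W s \<omega>) \<le> sqrt (s + H - s)}" by auto
  also have "prob E' * prob {\<omega> \<in> space M. e * (W (s + H) \<omega> - W s \<omega>) \<le> sqrt (s + H - s)} \<le> prob E * (1 - escape)"
    using prob_increment_le[OF s0 _ e, of "s + H"] H E'E
    by (intro mult_mono) (auto intro: order_trans[OF measure_nonneg])
  finally show ?thesis by (simp add: algebra_simps)
qed

text \<open>\<open>R l\<close> says that X, a time 2^-l after the grid time following its first
  visit to c, is not beyond c; these events converge to \<open>?G\<close>. Each \<open>touch\<close>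
  event is contained in \<open>?G\<close>, so summing \<open>touch_step\<close> over disjoint grid
  events bounds the probability of \<open>R l\<close> by vanishing terms plus
  \<open>1 - escape / 2\<close> times that of \<open>?G\<close>. The horizon \<open>K\<close> keeps
  the number of grid events finite.\<close>

lemma local_extremum_null:
  assumes a: "0 \<le> a" and e: "e = 1 \<or> e = - 1"
  shows "{\<omega> \<in> space M. \<exists>v\<in>{a..<real K}. X v \<omega> = c \<and>
    (\<exists>\<delta>>0. \<forall>w. a \<le> w \<longrightarrow> w \<le> v + \<delta> \<longrightarrow> e * X w \<omega> \<le> e * c)} \<in> null_sets M" (is "?G \<in> _")
proof -
  have half: "(\<lambda>l. 1 / (2::real) ^ l) \<longlonglongrightarrow> 0"
    using LIMSEQ_realpow_zero[of "1 / 2 :: real"] by (simp add: power_divide)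
  \<comment> \<open>The remaining time from the visit to the grid point serves as \<delta>.\<close>
  have D: "touch e a c j k \<subseteq> ?G" if "k \<le> K * 2 ^ j" for j k
  proof
    fix \<omega> assume t: "\<omega> \<in> touch e a c j k"
    have "real k \<le> real K * 2 ^ j" using of_nat_mono[OF that, where 'a=real] by simp
    then have kK: "real k / 2 ^ j \<le> real K" by (simp add: divide_le_eq)
    obtain v where v: "a \<le> v" "v < real k / 2 ^ j" "X v \<omega> = c" using t by (auto simp: touch_def)
    have below: "e * X w \<omega> \<le> e * c" if "a \<le> w" "w \<le> v + (real k / 2 ^ j - v)" for w
      using t that by (auto simp: touch_def not_less)
    show "\<omega> \<in> ?G"
    proof (intro CollectI conjI bexI[of _ v])
      show "\<exists>\<delta>>0. \<forall>w. a \<le> w \<longrightarrow> w \<le> v + \<delta> \<longrightarrow> e * X w \<omega> \<le> e * c"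
        using below v(2) by (intro exI[of _ "real k / 2 ^ j - v"]) auto
    qed (use t v kK in \<open>auto simp: touch_def\<close>)
  qed
  have ev: "\<exists>l0. \<forall>l\<ge>l0. \<forall>j\<ge>l. \<exists>k\<le>K * 2 ^ j. \<omega> \<in> touch e a c j k \<and> e * X (real k / 2 ^ j + 1 / 2 ^ l) \<omega> \<le> e * c"
    if \<omega>G: "\<omega> \<in> ?G" for \<omega>
  proof -
    obtain v \<delta> where v: "\<omega> \<in> space M" "a \<le> v" "v < real K" "X v \<omega> = c" "0 < \<delta>"
        "\<And>w. a \<le> w \<Longrightarrow> w \<le> v + \<delta> \<Longrightarrow> e * X w \<omega> \<le> e * c"
      using \<omega>G by auto
    have "\<forall>\<^sub>F l in sequentially. 1 / (2::real) ^ l < \<delta> / 2"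
      using v(5) by (intro order_tendstoD[OF half]) auto
    then obtain l0 where l0: "\<And>l. l0 \<le> l \<Longrightarrow> 1 / (2::real) ^ l < \<delta> / 2"
      by (auto simp: eventually_sequentially)
    have "\<exists>k\<le>K * 2 ^ j. \<omega> \<in> touch e a c j k \<and> e * X (real k / 2 ^ j + 1 / 2 ^ l) \<omega> \<le> e * c"
      if "l0 \<le> l" "l \<le> j" for l j
    proof (rule touch_exists[OF a v(1,2,3,4,6)])
      show "1 / 2 ^ j + 1 / 2 ^ l \<le> \<delta>" using l0[of l] l0[of j] that by linarith
    qed auto
    then show ?thesis by blast
  qed
  \<comment> \<open>The uncountable quantifiers over v and \<delta> become a countable union, which
    makes \<open>?G\<close> measurable.\<close>
  have "?G = (\<Union>j. \<Union>k\<in>{..K * 2 ^ j}. touch e a c j k)"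
  proof (intro equalityI subsetI)
    fix \<omega> assume "\<omega> \<in> ?G"
    from ev[OF this] show "\<omega> \<in> (\<Union>j. \<Union>k\<in>{..K * 2 ^ j}. touch e a c j k)" by blast
  qed (use D in blast)
  then have G: "?G \<in> events" using touch_events[OF a] by auto
  obtain \<sigma>0 where \<sigma>0: "0 < \<sigma>0" "\<And>x. \<bar>x - c\<bar> \<le> 1 \<Longrightarrow> \<sigma>0 \<le> \<sigma> x" using \<sigma>_lower_bound[of c] by blast
  define \<eta> where "\<eta> = \<sigma>0 / 4"
  have \<eta>: "0 < \<eta>" using \<sigma>0 by (simp add: \<eta>_def)
  define L where "L = real K + 1"
  define U where "U = \<rat> \<inter> {0..L}"
  have U: "countable U" "U \<subseteq> {0..L}" by (auto simp: U_def countable_rat intro!: countable_Int1)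
  \<comment> \<open>Half of \<open>escape\<close> is spent on the residual: \<theta>^2 / \<eta>^2 +
    (1 - escape) = 1 - escape / 2.\<close>
  define \<theta> where "\<theta> = \<eta> * sqrt (escape / 2)"
  have \<theta>: "0 < \<theta>" "\<theta>\<^sup>2 / \<eta>\<^sup>2 = escape / 2" using \<eta> escape_pos by (auto simp: \<theta>_def power_mult_distrib)
  let ?Y = "\<lambda>v \<omega>. \<sigma> (X v \<omega>)"
  define \<kappa> where "\<kappa> l = \<eta> * sqrt (1 / 2 ^ l)" for l :: nat
  have \<kappa>: "0 < \<kappa> l" for l using \<eta> by (simp add: \<kappa>_def)
  \<comment> \<open>For given l the grid is refined until, except with probability below 1 / (l +
    1), X at the grid time is within \<open>\<kappa> l\<close> of c.\<close>
  have "\<exists>j\<ge>l. prob (osc M X U (1 / 2 ^ j) (\<kappa> l / 2)) < inverse (real (Suc l))" for l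
  proof -
    have "(\<lambda>j. prob (osc M X U (1 / 2 ^ j) (\<kappa> l / 2))) \<longlonglongrightarrow> 0"
    proof (rule prob_osc_tendsto_0[OF U _ _ _ half])
      show "random_variable borel (X v)" if "v \<in> U" for v
        using U(2) that by (intro X_measurable) auto
      show "0 < \<kappa> l / 2" using \<kappa>[of l] by simp
    qed (rule X_cont)
    then have "\<forall>\<^sub>F j in sequentially. prob (osc M X U (1 / 2 ^ j) (\<kappa> l / 2)) < inverse (real (Suc l))"
      by (rule order_tendstoD) simp
    then obtain j0 where "\<And>j. j0 \<le> j \<Longrightarrow> prob (osc M X U (1 / 2 ^ j) (\<kappa> l / 2)) < inverse (real (Suc l))"
      by (auto simp: eventually_sequentially)
    from this[of "max l j0"] show ?thesis by (intro exI[of _ "max l j0"]) auto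
  qed
  then obtain J where J: "\<And>l. l \<le> J l" "\<And>l. prob (osc M X U (1 / 2 ^ J l) (\<kappa> l / 2)) < inverse (real (Suc l))"
    by metis
  define s where "s l k = real k / 2 ^ J l" for l k :: nat
  define R where "R l = (\<Union>k\<in>{..K * 2 ^ J l}. {\<omega> \<in> touch e a c (J l) k. e * X (s l k + 1 / 2 ^ l) \<omega> \<le> e * c})" for l
  define Q where "Q l k = {\<omega> \<in> touch e a c (J l) k. e * c - \<kappa> l \<le> e * X (s l k) \<omega> \<and> e * X (s l k + 1 / 2 ^ l) \<omega> \<le> e * c}" for l k
  have s0: "0 \<le> s l k" for l k by (simp add: s_def)
  have Xm: "random_variable borel (X (s l k))" "random_variable borel (X (s l k + 1 / 2 ^ l))" for l k
    using s0[of l k] by (auto intro!: X_measurable)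
  have Rm: "R l \<in> events" for l
  proof -
    have "{\<omega> \<in> touch e a c (J l) k. e * X (s l k + 1 / 2 ^ l) \<omega> \<le> e * c} \<in> events" for k
      using touch_events[OF a, of e c "J l" k] Xm[of l k] by measurable
    then show ?thesis unfolding R_def by auto
  qed
  have Qm: "Q l k \<in> events" for l k
    unfolding Q_def using touch_events[OF a, of e c "J l" k] Xm[of l k] by measurable
  have RG: "R l \<subseteq> ?G" for l
    unfolding R_def
  proof (rule UN_least)
    fix k assume "k \<in> {..K * 2 ^ J l}"
    then have "touch e a c (J l) k \<subseteq> ?G" by (intro D) simp
    then show "{\<omega> \<in> touch e a c (J l) k. e * X (s l k + 1 / 2 ^ l) \<omega> \<le> e * c} \<subseteq> ?G"
      by (rule order_trans[rotated]) (rule Collect_subset)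
  qed
  have Rlim: "(\<lambda>l. prob (R l)) \<longlonglongrightarrow> prob ?G"
  proof (rule prob_tendsto_of_eventually[OF Rm G], rule AE_I2)
    fix \<omega>
    show "\<forall>\<^sub>F l in sequentially. \<omega> \<in> R l \<longleftrightarrow> \<omega> \<in> ?G"
    proof (cases "\<omega> \<in> ?G")
      case True
      from ev[OF True] obtain l0 where l0: "\<forall>l\<ge>l0. \<forall>j\<ge>l. \<exists>k\<le>K * 2 ^ j. \<omega> \<in> touch e a c j k \<and>
          e * X (real k / 2 ^ j + 1 / 2 ^ l) \<omega> \<le> e * c" ..
      have "\<omega> \<in> R l" if "l0 \<le> l" for l
        using l0[rule_format, OF that J(1)] by (auto simp: R_def s_def)
      then show ?thesis using True by (auto simp: eventually_sequentially)
    next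
      case False
      then have "\<omega> \<notin> R l" for l using RG by (rule contra_subsetD[rotated])
      then show ?thesis using False by simp
    qed
  qed
  have oscm: "osc M ?Y U \<delta> \<theta> \<in> events" "osc M X U \<delta> \<theta> \<in> events" for \<delta> \<theta>
    using U by (auto intro!: osc_sets X_measurable measurable_compose[OF X_measurable \<sigma>_borel])
  have osclim: "(\<lambda>l. prob (osc M ?Y U (1 / 2 ^ l) \<theta>)) \<longlonglongrightarrow> 0"
    using U(2) by (intro prob_osc_tendsto_0[OF U _ _ \<theta>(1) half] \<sigma>X_cont measurable_compose[OF X_measurable \<sigma>_borel]) auto
  have sq: "(\<lambda>l. sqrt (1 / 2 ^ l)) \<longlonglongrightarrow> 0" using tendsto_real_sqrt[OF half] by simp
  have "\<forall>\<^sub>F l in sequentially. \<eta> * sqrt (1 / 2 ^ l) < 1"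
    using tendsto_mult_right_zero[OF sq, of \<eta>] by (rule order_tendstoD) simp
  moreover have "\<forall>\<^sub>F l in sequentially. \<beta> * sqrt (1 / 2 ^ l) < \<eta>"
    using tendsto_mult_right_zero[OF sq, of \<beta>] \<eta> by (rule order_tendstoD)
  ultimately have bound: "\<forall>\<^sub>F l in sequentially. prob (R l) \<le>
      inverse (real (Suc l)) + prob (osc M ?Y U (1 / 2 ^ l) \<theta>) + (1 - escape / 2) * prob ?G"
  proof eventually_elim
    case (elim l)
    let ?S = "{..K * 2 ^ J l}"
    have sK: "s l k \<le> real K" if "k \<in> ?S" for k
    proof -
      have "real k \<le> real K * 2 ^ J l" using of_nat_mono[of k "K * 2 ^ J l", where 'a=real] that by simp
      then show ?thesis by (simp add: s_def divide_le_eq)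
    qed
    have step: "prob (Q l k) \<le> prob (touch e a c (J l) k \<inter> osc M ?Y U (1 / 2 ^ l) \<theta>)
        + (1 - escape / 2) * prob (touch e a c (J l) k)" if "k \<in> ?S" for k
    proof -
      have "1 / (2::real) ^ l \<le> 1" by simp
      then have "s l k + 1 / 2 ^ l \<le> L" using sK[OF that] unfolding L_def by linarith
      then have "prob (Q l k) \<le> prob (touch e a c (J l) k \<inter> osc M ?Y U (1 / 2 ^ l) \<theta>)
        + (\<theta>\<^sup>2 / \<eta>\<^sup>2 + (1 - escape)) * prob (touch e a c (J l) k)"
        unfolding Q_def s_def \<kappa>_def U_def \<eta>_def
        using elim \<eta> by (intro touch_step[OF a e J(1) _ \<sigma>0 \<theta>(1)]) (auto simp: s_def \<eta>_def)
      then show ?thesis unfolding \<theta>(2) by simp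
    qed
    have "R l \<subseteq> osc M X U (1 / 2 ^ J l) (\<kappa> l / 2) \<union> (\<Union>k\<in>?S. Q l k)"
    proof
      fix \<omega> assume "\<omega> \<in> R l"
      then obtain k where k: "k \<in> ?S" "\<omega> \<in> touch e a c (J l) k" "e * X (s l k + 1 / 2 ^ l) \<omega> \<le> e * c"
        by (auto simp: R_def)
      have sL: "s l k \<le> L" using sK[OF k(1)] by (simp add: L_def)
      show "\<omega> \<in> osc M X U (1 / 2 ^ J l) (\<kappa> l / 2) \<union> (\<Union>k\<in>?S. Q l k)"
      proof (cases "e * X (s l k) \<omega> < e * c - \<kappa> l")
        case True
        then show ?thesis
          using touch_far_subset_osc[OF a \<kappa> sL[unfolded s_def] e, of c l] k(2) by (auto simp: s_def U_def)
      next
        case False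
        then show ?thesis using k by (auto simp: Q_def)
      qed
    qed
    then have "prob (R l) \<le> prob (osc M X U (1 / 2 ^ J l) (\<kappa> l / 2) \<union> (\<Union>k\<in>?S. Q l k))"
      using oscm Qm by (intro finite_measure_mono) auto
    also have "\<dots> \<le> prob (osc M X U (1 / 2 ^ J l) (\<kappa> l / 2)) + prob (\<Union>k\<in>?S. Q l k)"
      using oscm Qm by (intro measure_Un_le) auto
    also have "prob (\<Union>k\<in>?S. Q l k) \<le> (\<Sum>k\<in>?S. prob (Q l k))"
      using Qm by (intro measure_UNION_le) auto
    also have "\<dots> \<le> (\<Sum>k\<in>?S. prob (touch e a c (J l) k \<inter> osc M ?Y U (1 / 2 ^ l) \<theta>)
        + (1 - escape / 2) * prob (touch e a c (J l) k))"
      by (intro sum_mono step)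
    also have "\<dots> = (\<Sum>k\<in>?S. prob (touch e a c (J l) k \<inter> osc M ?Y U (1 / 2 ^ l) \<theta>))
        + (1 - escape / 2) * (\<Sum>k\<in>?S. prob (touch e a c (J l) k))"
      by (simp add: sum.distrib sum_distrib_left)
    \<comment> \<open>Disjointness keeps this sum below a single oscillation probability, although
      the number of grid events grows with l.\<close>
    also have "(\<Sum>k\<in>?S. prob (touch e a c (J l) k \<inter> osc M ?Y U (1 / 2 ^ l) \<theta>)) \<le> prob (osc M ?Y U (1 / 2 ^ l) \<theta>)"
      using touch_disjoint[of e a c "J l" ?S] oscm touch_events[OF a]
      by (intro sum_measure_disjoint_le) (auto simp: disjoint_family_on_def)
    also have "(1 - escape / 2) * (\<Sum>k\<in>?S. prob (touch e a c (J l) k)) \<le> (1 - escape / 2) * prob ?G"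
    proof (rule mult_left_mono)
      show "(\<Sum>k\<in>?S. prob (touch e a c (J l) k)) \<le> prob ?G"
      proof (rule sum_measure_disjoint_le[OF _ touch_disjoint touch_events[OF a] _ G])
        show "touch e a c (J l) k \<subseteq> ?G" if "k \<in> ?S" for k
          using that by (intro D) simp
      qed simp
      have "0 \<le> 1 - escape"
        using prob_increment_le[of 0 1 1] by (rule order_trans[OF measure_nonneg]) auto
      then show "0 \<le> 1 - escape / 2" using escape_pos by simp
    qed
    finally show ?case using J(2)[of l] by simp
  qed
  have "prob ?G \<le> (1 - escape / 2) * prob ?G"
  proof (rule tendsto_le[OF _ _ Rlim bound])
    have "(\<lambda>l. inverse (real (Suc l)) + prob (osc M ?Y U (1 / 2 ^ l) \<theta>) + (1 - escape / 2) * prob ?G)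
       \<longlonglongrightarrow> 0 + 0 + (1 - escape / 2) * prob ?G"
      by (intro tendsto_add tendsto_const osclim LIMSEQ_inverse_real_of_nat)
    then show "(\<lambda>l. inverse (real (Suc l)) + prob (osc M ?Y U (1 / 2 ^ l) \<theta>) + (1 - escape / 2) * prob ?G)
       \<longlonglongrightarrow> (1 - escape / 2) * prob ?G" by simp
  qed simp
  then have "escape * prob ?G \<le> 0" by (simp add: algebra_simps)
  then have "prob ?G = 0" using escape_pos measure_nonneg[of M ?G] by (simp add: mult_le_0_iff)
  then show ?thesis using G by (simp add: null_sets_def emeasure_eq_measure)
qed

text \<open>For a visit at v < d the remaining time d - v serves as \<delta>. A visit at d has no
  time after it in the interval and is excluded because \<open>X d\<close> has no atom at c.\<close>

lemma no_touching_extremum: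
  assumes a: "0 \<le> a" "a < d" and e: "e = 1 \<or> e = - 1"
  shows "AE \<omega> in M. \<not> (\<exists>v\<in>{a..d}. X v \<omega> = c \<and> (\<forall>w\<in>{a..d}. e * X w \<omega> \<le> e * c))"
proof -
  obtain K where K: "d < real K" using reals_Archimedean2 by blast
  have "{\<omega> \<in> space M. X d \<omega> = c} \<in> null_sets M"
    using X_no_atom[of d c] X_measurable[of d] a by (auto simp: null_sets_def emeasure_eq_measure)
  then have "AE \<omega> in M. \<omega> \<notin> {\<omega> \<in> space M. X d \<omega> = c}" by (rule AE_not_in)
  with AE_not_in[OF local_extremum_null[OF a(1) e, of K c]] AE_space show ?thesis
  proof eventually_elim
    case (elim \<omega>)
    show ?case
    proof
      assume "\<exists>v\<in>{a..d}. X v \<omega> = c \<and> (\<forall>w\<in>{a..d}. e * X w \<omega> \<le> e * c)"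
      then obtain v where v: "a \<le> v" "v \<le> d" "X v \<omega> = c" "\<And>w. a \<le> w \<Longrightarrow> w \<le> d \<Longrightarrow> e * X w \<omega> \<le> e * c"
        by auto
      have "v \<noteq> d" using v elim by auto
      then have "\<exists>\<delta>>0. \<forall>w. a \<le> w \<longrightarrow> w \<le> v + \<delta> \<longrightarrow> e * X w \<omega> \<le> e * c"
        using v by (intro exI[of _ "d - v"]) auto
      moreover have "v \<in> {a..<real K}" using v K by auto
      ultimately show False using elim v(3) by blast
    qed
  qed
qed

section \<open>Convergence\<close>

text \<open>There is one null set for each c, p, q and sign, and these are countably many; hence the
  restriction of interval ends to \<open>D\<close>.\<close>

lemma AE_crosses:
  assumes F: "countable F" and D: "countable D" "D \<subseteq> {0..}"
  shows "AE \<omega> in M. crosses (\<lambda>u. X u \<omega>) F D"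
proof -
  have one: "AE \<omega> in M. p < q \<longrightarrow> \<not> (\<exists>v\<in>{p..q}. X v \<omega> = c \<and> (\<forall>w\<in>{p..q}. e * X w \<omega> \<le> e * c))"
    if "p \<in> D" "e = 1 \<or> e = - 1" for p q c e
    using no_touching_extremum[of p q e c] that D(2) by (cases "p < q") auto
  have "AE \<omega> in M. \<forall>e\<in>{1, - 1}. \<forall>c\<in>F. \<forall>p\<in>D. \<forall>q\<in>D.
      p < q \<longrightarrow> \<not> (\<exists>v\<in>{p..q}. X v \<omega> = c \<and> (\<forall>w\<in>{p..q}. e * X w \<omega> \<le> e * c))"
    using F D by (simp only: AE_ball_countable countable_insert countable_empty) (intro ballI one, auto)
  then show ?thesis
  proof eventually_elim
    case (elim \<omega>)
    show ?case
      unfolding crosses_def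
    proof (intro ballI impI)
      fix c p q v assume *: "c \<in> F" "p \<in> D" "q \<in> D" "p < q" "v \<in> {p..q}" "X v \<omega> = c"
      have "\<not> (\<forall>w\<in>{p..q}. e * X w \<omega> \<le> e * c)" if "e \<in> {1, - 1}" for e
        using elim * that by blast
      from this[of 1] this[of "- 1"] show "(\<exists>w\<in>{p..q}. c < X w \<omega>) \<and> (\<exists>w\<in>{p..q}. X w \<omega> < c)"
        by (auto simp: not_le)
    qed
  qed
qed

lemma sat_dia_events:
  assumes "fsigma B" "fsigma I" "I \<subseteq> {0..}" "0 \<le> t"
  shows "{\<omega> \<in> space M. sat_dia (\<lambda>u. X u \<omega>) B I t} \<in> events"
  unfolding sat_dia_def
proof (rule fsigma_hit_sets[OF assms(2,1)])
  show "random_variable borel (X (t + v))" if "v \<in> I" for v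
    using that assms by (intro X_measurable) auto
  show "continuous_on I (\<lambda>v. X (t + v) \<omega>)" if "\<omega> \<in> space M" for \<omega>
    using assms by (intro continuous_on_compose2[OF X_cont[OF that]] continuous_intros) auto
qed

lemma sat_dia_n_events:
  assumes "fsigma B" "I \<subseteq> {0..}" "0 \<le> t"
  shows "{\<omega> \<in> space M. sat_dia_n (\<lambda>u. X u \<omega>) B I n t} \<in> events"
  unfolding sat_dia_n_def
proof (rule sets.sets_Collect_countable_Ex')
  have "grid n = range (\<lambda>k. real k / real n)" by (auto simp: grid_def)
  then show "countable (I \<inter> grid n)" by (simp add: countable_Int2)
  show "{\<omega> \<in> space M. X (t + s) \<omega> \<in> B} \<in> events" if "s \<in> I \<inter> grid n" for s
  proof -
    have "0 \<le> t + s" using that assms by auto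
    then show ?thesis
      using measurable_sets[OF X_measurable fsigma_imp_borel[OF assms(1)]]
      by (simp add: vimage_def Int_def conj_commute)
  qed
qed

lemma AE_sat_dia_n_eventually_iff:
  fixes cS cT :: bool
  assumes t: "0 \<le> t" "0 \<le> S" and T: "ereal S < T" and B: "crossing_set B F"
  defines "I \<equiv> ivl (ereal S) T cS cT"
  shows "AE \<omega> in M. \<forall>\<^sub>F n in sequentially.
    sat_dia_n (\<lambda>u. X u \<omega>) B I n (Lambda n t) \<longleftrightarrow> sat_dia (\<lambda>u. X u \<omega>) B I t"
proof -
  \<comment> \<open>The rationals supply density. The window ends t + S and, for finite T, t + T are
    added because they may be irrational.\<close>
  define D where "D = (\<rat> \<inter> {0..}) \<union> {t + S} \<union> (if T = \<infinity> then {} else {t + real_of_ereal T})"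
  have "0 \<le> real_of_ereal T" using T t by (cases T) auto
  then have D: "countable D" "D \<subseteq> {0..}"
    using t by (auto simp: D_def countable_rat intro!: countable_Int1)
  have "countable F" using B by (auto simp: crossing_set_def countable_finite)
  from AE_crosses[OF this D] AE_space show ?thesis
  proof eventually_elim
    case (elim \<omega>)
    show ?case
      unfolding I_def
    proof (rule sat_dia_n_eventually_iff[OF X_cont[OF elim(2)] t T B elim(1)])
      fix x y :: real assume "0 \<le> x" "x < y"
      then obtain d where "d \<in> \<rat>" "x < d" "d < y" using Rats_dense_in_real by blast
      then show "\<exists>d\<in>D. x < d \<and> d < y" using \<open>0 \<le> x\<close> by (intro bexI[of _ d]) (auto simp: D_def)
    qed (auto simp: D_def)
  qed
qed

text \<open>Stated for crossing sets so that it applies to \<open>B\<close> and to its complement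
  alike.\<close>

lemma sat_dia_n_convergence:
  fixes cS cT :: bool
  assumes t: "0 \<le> t" "0 \<le> S" and T: "ereal S < T" and B: "crossing_set B F"
  defines "I \<equiv> ivl (ereal S) T cS cT"
  shows "AE \<omega> in M. (\<lambda>n. of_bool (sat_dia_n (\<lambda>u. X u \<omega>) B I n (Lambda n t)) :: real)
      \<longlonglongrightarrow> of_bool (sat_dia (\<lambda>u. X u \<omega>) B I t)"
    and "(\<lambda>n. prob {\<omega>\<in>space M. sat_dia_n (\<lambda>u. X u \<omega>) B I n (Lambda n t)})
      \<longlonglongrightarrow> prob {\<omega>\<in>space M. sat_dia (\<lambda>u. X u \<omega>) B I t}"
proof -
  note ev = AE_sat_dia_n_eventually_iff[OF t T B, of cS cT, folded I_def]
  show "AE \<omega> in M. (\<lambda>n. of_bool (sat_dia_n (\<lambda>u. X u \<omega>) B I n (Lambda n t)) :: real)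
      \<longlonglongrightarrow> of_bool (sat_dia (\<lambda>u. X u \<omega>) B I t)"
    using ev
  proof eventually_elim
    case (elim \<omega>)
    then have "\<forall>\<^sub>F n in sequentially. (of_bool (sat_dia_n (\<lambda>u. X u \<omega>) B I n (Lambda n t)) :: real) =
        of_bool (sat_dia (\<lambda>u. X u \<omega>) B I t)"
      by eventually_elim simp
    then show ?case by (rule tendsto_eventually)
  qed
  have I: "fsigma I" "I \<subseteq> {0..}"
    using fsigma_ivl[OF T] t by (auto simp: I_def ivl_def split: if_splits)
  show "(\<lambda>n. prob {\<omega>\<in>space M. sat_dia_n (\<lambda>u. X u \<omega>) B I n (Lambda n t)})
      \<longlonglongrightarrow> prob {\<omega>\<in>space M. sat_dia (\<lambda>u. X u \<omega>) B I t}"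
  proof (rule prob_tendsto_of_eventually)
    show "AE \<omega> in M. \<forall>\<^sub>F n in sequentially.
      \<omega> \<in> {\<omega>\<in>space M. sat_dia_n (\<lambda>u. X u \<omega>) B I n (Lambda n t)} \<longleftrightarrow> \<omega> \<in> {\<omega>\<in>space M. sat_dia (\<lambda>u. X u \<omega>) B I t}"
      using ev AE_space by eventually_elim simp
  qed (use crossing_set_fsigma[OF B] I t Lambda_nonneg in \<open>auto intro!: sat_dia_events sat_dia_n_events\<close>)
qed

end

theorem theorem6p8:
  fixes M :: "'a measure" and W X :: "real \<Rightarrow> 'a \<Rightarrow> real"
    and b \<sigma> :: "real \<Rightarrow> real" and \<xi> :: real
    and k :: nat and x y :: "nat \<Rightarrow> ereal" and cx cy :: "nat \<Rightarrow> bool"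
    and S :: real and T :: ereal and cS cT :: bool and t :: real
  assumes "prob_space M"
    and "brownian_motion M W"
    and "\<forall>K. compact K \<and> K \<noteq> {} \<longrightarrow> Inf (\<sigma> ` K) > 0"
    and "\<exists>L. lipschitz_on L UNIV \<sigma>"
    and "b \<in> borel_measurable borel" and "bounded (range b)"
    and "strong_solution M W b \<sigma> \<xi> X"
    and "\<forall>i<k. x i < y i"
    and "\<forall>i<k. \<forall>j<k. i \<noteq> j \<longrightarrow>
           closure (ivl (x i) (y i) (cx i) (cy i)) \<inter> closure (ivl (x j) (y j) (cx j) (cy j)) = {}"
    and "0 \<le> S" and "ereal S < T"
    and "0 \<le> t"
  defines "B \<equiv> (\<Union>i<k. ivl (x i) (y i) (cx i) (cy i))"
    and "I \<equiv> ivl (ereal S) T cS cT"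
  shows "(AE \<omega> in M. (\<lambda>n. of_bool (sat_dia_n (\<lambda>u. X u \<omega>) B I n (Lambda n t)) :: real)
                        \<longlonglongrightarrow> of_bool (sat_dia (\<lambda>u. X u \<omega>) B I t))
       \<and> (AE \<omega> in M. (\<lambda>n. of_bool (sat_box_n (\<lambda>u. X u \<omega>) B I n (Lambda n t)) :: real)
                        \<longlonglongrightarrow> of_bool (sat_box (\<lambda>u. X u \<omega>) B I t))
       \<and> (\<lambda>n. measure M {\<omega>\<in>space M. sat_dia_n (\<lambda>u. X u \<omega>) B I n (Lambda n t)})
            \<longlonglongrightarrow> measure M {\<omega>\<in>space M. sat_dia (\<lambda>u. X u \<omega>) B I t}
       \<and> (\<lambda>n. measure M {\<omega>\<in>space M. sat_box_n (\<lambda>u. X u \<omega>) B I n (Lambda n t)})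
            \<longlonglongrightarrow> measure M {\<omega>\<in>space M. sat_box (\<lambda>u. X u \<omega>) B I t}"
proof -
  obtain \<beta> where \<beta>: "\<And>x. \<bar>b x\<bar> \<le> \<beta>"
    using assms(6) by (auto simp: bounded_iff)
  interpret sde M W b \<sigma> \<xi> X \<beta>
  proof (intro sde.intro brownian.intro brownian_axioms.intro sde_axioms.intro)
    show "continuous_on UNIV \<sigma>" using assms(4) lipschitz_on_continuous_on by blast
    \<comment> \<open>Singletons are compact, so the condition on infima gives positivity at every
      point.\<close>
    show "0 < \<sigma> z" for z using assms(3)[rule_format, of "{z}"] by simp
  qed (use assms \<beta> in auto)
  let ?F = "{c. \<exists>i<k. x i = ereal c \<or> y i = ereal c}"
  have B: "crossing_set B ?F"
    unfolding B_def using assms(8,9) by (intro crossing_set_Union_ivl) auto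
  note dia = sat_dia_n_convergence[OF assms(12,10,11) B, of cS cT, folded I_def]
  \<comment> \<open>The box operator for \<open>B\<close> is the negated diamond operator for its
    complement, so its indicators and probabilities are those of the complement subtracted from
    1.\<close>
  note compl = sat_dia_n_convergence[OF assms(12,10,11) crossing_set_Compl[OF B], of cS cT, folded I_def]
  have I: "fsigma I" "I \<subseteq> {0..}"
    using fsigma_ivl[OF assms(11)] assms(10) by (auto simp: I_def ivl_def split: if_splits)
  have Bc: "fsigma (- B)" using crossing_set_fsigma[OF crossing_set_Compl[OF B]] .
  have prob_not: "prob {\<omega>\<in>space M. \<not> P \<omega>} = 1 - prob {\<omega>\<in>space M. P \<omega>}" if "{\<omega>\<in>space M. P \<omega>} \<in> events" for P
  proof -
    have "{\<omega>\<in>space M. \<not> P \<omega>} = space M - {\<omega>\<in>space M. P \<omega>}" by auto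
    then show ?thesis using prob_compl[OF that] by simp
  qed
  have "AE \<omega> in M. (\<lambda>n. of_bool (sat_box_n (\<lambda>u. X u \<omega>) B I n (Lambda n t)) :: real)
      \<longlonglongrightarrow> of_bool (sat_box (\<lambda>u. X u \<omega>) B I t)"
    using compl(1)
  proof eventually_elim
    case (elim \<omega>)
    show ?case
      unfolding sat_box_iff_dia sat_box_n_iff_dia of_bool_not_iff
      using elim by (intro tendsto_diff tendsto_const)
  qed
  moreover have "(\<lambda>n. prob {\<omega>\<in>space M. sat_box_n (\<lambda>u. X u \<omega>) B I n (Lambda n t)})
      \<longlonglongrightarrow> prob {\<omega>\<in>space M. sat_box (\<lambda>u. X u \<omega>) B I t}"
    unfolding sat_box_iff_dia sat_box_n_iff_dia
    using Bc I assms(12)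
    by (subst (1 2) prob_not)
       (auto intro!: sat_dia_events sat_dia_n_events Lambda_nonneg tendsto_diff compl(2))
  ultimately show ?thesis using dia by blast
qed

end
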